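(* Let $K$ be a field, let $(P,L)$ be a projective plane of order $q$, let $d=q^2+q+1$ be its number of points, and let $I_\Delta=I_\Lambda+(x_1^2,\dots,x_d^2)\subset R=K[x_1,\dots,x_d]$, where $\Lambda$ is the incidence complex of $(P,L)$. Then the graded Betti numbers of $R/I_\Delta$ are $$\beta_{1,j}(R/I_\Delta)=\begin{cases}q^2+q+1&\text{if } j=2,\\ \binom{q^2+q+1}{3}-\binom{q+1}{3}(q^2+q+1)&\text{if } j=3,\\0&\text{otherwise,}\end{cases}$$ and, for each integer $i\ge 2$: (a) $\beta_{i,j}(R/I_\Delta)=0$ if $j\le i+1$; (b) if $j=i+2$, then $$\beta_{i,i+2}(R/I_\Delta)=-q(q+1)\binom{q^2+q+1}{i+2}+(q^2+q+1)\left[\binom{q^2}{i+2}+q\binom{q^2+q+1}{i+1}-(q+1)\binom{q^2}{i}+\binom{q+1}{2}\binom{q^2}{i-2}\right];$$ (c) if $j\ge i+3$, then $$\beta_{i,j}(R/I_\Delta)=(q^2+q+1)\binom{q+1}{j-i}\binom{q^2}{2i-j}.$$ In particular, $\beta_{i,j}(R/I_\Delta)$ is not zero if and only if one of the following holds: (1) $i=j=0$ or $i+1=j=2$; (2) $1\le i\le q^2+q$ and $j=i+2$; (3) $i\ge 2$ and $\max\{i+3,\,2i-q^2\}\le j\le\min\{2i,\,i+q+1\}$.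
   Context: A linear space $(P,L)$ consists of a finite set $P$ of points and a finite set $L$ of lines (identified with their sets of incident points) such that any two distinct points lie on exactly one common line and every line contains at least two points. A finite projective plane is a linear space such that any two distinct lines meet in exactly one point, there exist three noncollinear points, and every line contains at least three points. It has order $q$ if $\#P=\#L=q^2+q+1$, every point lies on exactly $q+1$ lines, and every line contains exactly $q+1$ points (every finite projective plane has an order in this sense). The incidence complex $\Lambda$ of $(P,L)$ is the simplicial complex on $P$ whose facets are the sets of points on each line. The variables of $R=K[x_1,\dots,x_d]$ (standard grading) are indexed by the points, and $I_\Lambda\subset R$ is the Stanley-Reisner ideal, generated by the squarefree monomials corresponding to nonfaces of $\Lambda$. $\beta_{i,j}(M)=\dim_K[\operatorname{Tor}_i^R(K,M)]_j$. Binomial coefficients $\binom{a}{b}$ with $a\ge0$ are $0$ if $b<0$ or $b>a$. *)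

theory Defs
  imports Complex_Main "HOL-Library.Poly_Mapping" "HOL-Library.Function_Algebras"
    "HOL-Library.Set_Algebras"
begin

section \<open>Linear spaces and projective planes\<close>

definition linear_space :: "'p set \<Rightarrow> 'p set set \<Rightarrow> bool" where
  "linear_space P L \<longleftrightarrow> finite P \<and> finite L \<and> (\<forall>l\<in>L. l \<subseteq> P \<and> card l \<ge> 2) \<and>
     (\<forall>x\<in>P. \<forall>y\<in>P. x \<noteq> y \<longrightarrow> (\<exists>!l. l \<in> L \<and> x \<in> l \<and> y \<in> l))"

definition projective_plane :: "'p set \<Rightarrow> 'p set set \<Rightarrow> bool" where
  "projective_plane P L \<longleftrightarrow> linear_space P L \<and>
     (\<forall>l\<in>L. \<forall>m\<in>L. l \<noteq> m \<longrightarrow> (\<exists>!x. x \<in> l \<and> x \<in> m)) \<and>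
     (\<exists>x\<in>P. \<exists>y\<in>P. \<exists>z\<in>P. x \<noteq> y \<and> x \<noteq> z \<and> y \<noteq> z \<and> \<not> (\<exists>l\<in>L. {x, y, z} \<subseteq> l)) \<and>
     (\<forall>l\<in>L. card l \<ge> 3)"

definition projective_plane_of_order :: "'p set \<Rightarrow> 'p set set \<Rightarrow> nat \<Rightarrow> bool" where
  "projective_plane_of_order P L q \<longleftrightarrow> projective_plane P L \<and>
     card P = q\<^sup>2 + q + 1 \<and> card L = q\<^sup>2 + q + 1 \<and>
     (\<forall>x\<in>P. card {l \<in> L. x \<in> l} = q + 1) \<and> (\<forall>l\<in>L. card l = q + 1)"

definition incidence_complex :: "'p set set \<Rightarrow> 'p set set" where
  "incidence_complex L = {\<sigma>. \<exists>l\<in>L. \<sigma> \<subseteq> l}"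


section \<open>The polynomial ring with variables indexed by a finite type\<close>

type_synonym ('p, 'k) mpoly = "('p \<Rightarrow>\<^sub>0 nat) \<Rightarrow>\<^sub>0 'k"

definition poly_var :: "'p \<Rightarrow> ('p, 'k::comm_ring_1) mpoly" where
  "poly_var p = Poly_Mapping.single (Poly_Mapping.single p 1) 1"

definition const_poly :: "'k \<Rightarrow> ('p, 'k::comm_ring_1) mpoly" where
  "const_poly c = Poly_Mapping.single 0 c"

definition const_coeff :: "('p, 'k::comm_ring_1) mpoly \<Rightarrow> 'k" where
  "const_coeff f = Poly_Mapping.lookup f 0"

text \<open>Degrees are integers; a graded piece in negative degree is zero.\<close>

definition homogeneous :: "int \<Rightarrow> ('p::finite, 'k::comm_ring_1) mpoly \<Rightarrow> bool" where
  "homogeneous e f \<longleftrightarrow>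
     (\<forall>m\<in>Poly_Mapping.keys f. int (\<Sum>p\<in>UNIV. Poly_Mapping.lookup m p) = e)"

global_interpretation ring_module: module "(*) :: 'a::comm_ring_1 \<Rightarrow> 'a \<Rightarrow> 'a"
  defines ideal_generated_by = ring_module.span
  by unfold_locales (simp_all add: algebra_simps)

definition stanley_reisner_ideal :: "'p set set \<Rightarrow> ('p::finite, 'k::field) mpoly set" where
  "stanley_reisner_ideal \<Lambda> = ideal_generated_by {\<Prod>p\<in>\<sigma>. poly_var p | \<sigma>. \<sigma> \<notin> \<Lambda>}"

definition squares_ideal :: "('p::finite, 'k::field) mpoly set" where
  "squares_ideal = ideal_generated_by (range (\<lambda>p. poly_var p ^ 2))"


section \<open>Graded free resolutions of the residue field\<close>

text \<open>
  Elements of a free module over \<open>R\<close> are coordinate functions \<open>nat \<Rightarrow> R\<close> that vanish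
  outside the (finite) index set of a basis.  The following makes these functions a
  vector space over the field of coefficients.
\<close>

global_interpretation coords: vector_space
  "\<lambda>(c::'k::field) (v :: nat \<Rightarrow> ('p, 'k) mpoly) b. const_poly c * v b"
  defines coords_dim = coords.dim
proof unfold_locales
  fix a b :: 'k and v w :: "nat \<Rightarrow> ('p, 'k) mpoly"
  show "(\<lambda>k. const_poly a * (v + w) k) = (\<lambda>k. const_poly a * v k) + (\<lambda>k. const_poly a * w k)"
    by (rule ext) (simp add: distrib_left)
  show "(\<lambda>k. const_poly (a + b) * v k) = (\<lambda>k. const_poly a * v k) + (\<lambda>k. const_poly b * v k)"
    by (rule ext) (simp add: const_poly_def single_add distrib_right)
  show "(\<lambda>k. const_poly a * (const_poly b * v k)) = (\<lambda>k. const_poly (a * b) * v k)"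
    by (rule ext) (simp add: const_poly_def mult_single flip: mult.assoc)
  show "(\<lambda>k. const_poly 1 * v k) = v"
    by (rule ext) (simp add: const_poly_def)
qed

text \<open>
  A complex \<open>\<dots> \<rightarrow> F\<^sub>2 \<rightarrow> F\<^sub>1 \<rightarrow> F\<^sub>0 \<rightarrow> K\<close>, where \<open>F\<^sub>i\<close> is free with basis \<open>basis i\<close>, the basis
  element \<open>b\<close> of \<open>F\<^sub>i\<close> has degree \<open>bdeg i b\<close>, the map \<open>F\<^sub>i \<rightarrow> F\<^sub>i\<^sub>-\<^sub>1\<close> has the matrix entries
  \<open>entry i r b\<close> (\<open>r\<close> in \<open>basis (i - 1)\<close>, \<open>b\<close> in \<open>basis i\<close>) for \<open>i \<ge> 1\<close>, and \<open>F\<^sub>0 \<rightarrow> K\<close> sends the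
  basis element \<open>b\<close> to \<open>aug b\<close>.  Here \<open>R\<close> acts on \<open>K = R/(x\<^sub>p)\<close> through constant coefficients.
\<close>

record (overloaded) ('p, 'k) aug_complex =
  basis :: "nat \<Rightarrow> nat set"
  bdeg :: "nat \<Rightarrow> nat \<Rightarrow> int"
  entry :: "nat \<Rightarrow> nat \<Rightarrow> nat \<Rightarrow> ('p, 'k) mpoly"
  aug :: "nat \<Rightarrow> 'k"

definition free_module :: "nat set \<Rightarrow> (nat \<Rightarrow> 'a::zero) set" where
  "free_module B = {v. \<forall>b. b \<notin> B \<longrightarrow> v b = 0}"

definition bdry :: "('p, 'k::field) aug_complex \<Rightarrow> nat \<Rightarrow>
    (nat \<Rightarrow> ('p, 'k) mpoly) \<Rightarrow> nat \<Rightarrow> ('p, 'k) mpoly" where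
  "bdry F i v = (\<lambda>r. if i \<noteq> 0 \<and> r \<in> basis F (i - 1)
                     then \<Sum>b\<in>basis F i. entry F i r b * v b else 0)"

definition augmentation :: "('p, 'k::field) aug_complex \<Rightarrow> (nat \<Rightarrow> ('p, 'k) mpoly) \<Rightarrow> 'k" where
  "augmentation F v = (\<Sum>b\<in>basis F 0. const_coeff (v b) * aug F b)"

definition graded_piece :: "('p::finite, 'k::field) aug_complex \<Rightarrow> nat \<Rightarrow> int \<Rightarrow>
    (nat \<Rightarrow> ('p, 'k) mpoly) set" where
  "graded_piece F i j =
     {v \<in> free_module (basis F i). \<forall>b\<in>basis F i. homogeneous (j - bdeg F i b) (v b)}"

definition graded_free_resolution :: "('p::finite, 'k::field) aug_complex \<Rightarrow> bool" where
  "graded_free_resolution F \<longleftrightarrow>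
     (\<forall>i. finite (basis F i)) \<and>
     (\<forall>i\<ge>1. \<forall>r\<in>basis F (i - 1). \<forall>b\<in>basis F i.
        homogeneous (bdeg F i b - bdeg F (i - 1) r) (entry F i r b)) \<and>
     (\<forall>b\<in>basis F 0. aug F b \<noteq> 0 \<longrightarrow> bdeg F 0 b = 0) \<and>
     (\<forall>i\<ge>1. {v \<in> free_module (basis F i). bdry F i v = 0} =
             bdry F (i + 1) ` free_module (basis F (i + 1))) \<and>
     {v \<in> free_module (basis F 0). augmentation F v = 0} =
        bdry F 1 ` free_module (basis F 1) \<and>
     augmentation F ` free_module (basis F 0) = UNIV"


section \<open>Graded Betti numbers of a quotient of the polynomial ring\<close>

text \<open>
  \<open>Tor\<^sub>i(K, R/I)\<close> is the homology of \<open>F \<otimes> R/I = F/IF\<close> for a graded free resolution \<open>F\<close> of \<open>K\<close>,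
  where \<open>I\<close> is a homogeneous ideal.  Cycles and boundaries of \<open>F/IF\<close> in degree \<open>j\<close> are
  represented by their preimages in the degree \<open>j\<close> piece of \<open>F\<^sub>i\<close>.  These are subspaces of a
  finite-dimensional space, one contained in the other, so the dimension of the quotient is
  the difference of the dimensions.
\<close>

definition tor_cycles :: "('p::finite, 'k::field) aug_complex \<Rightarrow> ('p, 'k) mpoly set \<Rightarrow>
    nat \<Rightarrow> int \<Rightarrow> (nat \<Rightarrow> ('p, 'k) mpoly) set" where
  "tor_cycles F I i j = {v \<in> graded_piece F i j. \<forall>r. bdry F i v r \<in> I}"

definition tor_boundaries :: "('p::finite, 'k::field) aug_complex \<Rightarrow> ('p, 'k) mpoly set \<Rightarrow>
    nat \<Rightarrow> int \<Rightarrow> (nat \<Rightarrow> ('p, 'k) mpoly) set" where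
  "tor_boundaries F I i j = {v \<in> graded_piece F i j.
     \<exists>w\<in>graded_piece F (i + 1) j. \<forall>b. v b - bdry F (i + 1) w b \<in> I}"

text \<open>\<open>betti I i j\<close> is the graded Betti number of \<open>R/I\<close> (not of \<open>I\<close>).\<close>

definition betti :: "('p::finite, 'k::field) mpoly set \<Rightarrow> nat \<Rightarrow> int \<Rightarrow> nat" where
  "betti I i j = (let F = (SOME F. graded_free_resolution F) in
     coords_dim (tor_cycles F I i j) - coords_dim (tor_boundaries F I i j))"


section \<open>Binomial coefficients with an integer lower index\<close>

definition binom :: "nat \<Rightarrow> int \<Rightarrow> int" where
  "binom a b = (if b < 0 then 0 else int (a choose nat b))"

end

theory Submission
  imports Defs "HOL-Library.FuncSet" "HOL-Library.Countable"
begin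

text \<open>
  Let \<open>N = q\<^sup>2 + q + 1\<close>. Betti numbers may be computed from any graded free resolution of \<open>K\<close>
  (\<open>tor_dim_unique\<close>), in particular from the Koszul complex (\<open>koszul_resolution\<close>). Modulo the ideal, its basis
  in homological degree \<open>i\<close> and internal degree \<open>j\<close> consists of the \<open>e\<^sub>\<tau> x\<^sup>\<sigma>\<close> where \<open>\<tau>\<close> is a set of \<open>i\<close> points
  and \<open>\<sigma>\<close> a face with \<open>k = j - i\<close> points, and the differential moves points from \<open>\<tau>\<close> to \<open>\<sigma>\<close>.

  Two properties of the incidence complex determine the homology. A face with at least two points lies on
  exactly one line, and the differential does not change this line. Hence in degrees \<open>k \<ge> 2\<close> the complex is the
  direct sum, over the lines \<open>l\<close>, of the Koszul complexes of the complete intersections defined by the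
  variables outside \<open>l\<close> and the squares of the variables in \<open>l\<close>. On the other hand all pairs of points are
  faces, so in degrees \<open>k \<le> 2\<close> the complex is that of another complete intersection, defined by all the
  squares. For a set \<open>l\<close> of \<open>s\<close> points the homology of the complete intersection is an exterior algebra, with basis
  the \<open>e\<^sub>\<tau> x\<^sup>\<sigma>\<close> such that \<open>\<sigma> = \<tau> \<inter> l\<close>; there are \<open>(s choose k) (N - s choose (i - k))\<close> of them
  (\<open>card_critical_face_pairs\<close>). So for \<open>k \<ge> 3\<close> the Betti number is \<open>N\<close> times this number with \<open>s = q + 1\<close>, and for
  \<open>k \<le> 1\<close> it is this number with \<open>s = N\<close>. For \<open>k = 2\<close> the cycles are those of the lines and the boundaries
  those of the squares, which gives the remaining formula (\<open>betti_row_2\<close>).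

  The dimensions are found over an arbitrary field by an acyclic matching: given \<open>(\<tau>, \<sigma>)\<close>, select the first point
  of \<open>l\<close> that lies in exactly one of \<open>\<tau>\<close> and \<open>\<sigma>\<close>. A cycle can be prescribed on the pairs whose selected
  point is not in \<open>\<tau>\<close>, and it is determined there (\<open>cycle_zero_if_zero_on_free\<close>, \<open>koszul_diff_extend_free\<close>), so
  dimensions of cycles are obtained by counting pairs. By rank-nullity,
  a Betti number is the dimension of the cycles in degree \<open>i\<close>, plus that in degree \<open>i + 1\<close>, minus the number
  of basis vectors in degree \<open>i + 1\<close> (\<open>betti_monomial_ideal\<close>). A matching of the same kind on all
  monomials proves that the Koszul complex is exact.

  Where the formulas are products of binomial coefficients, their vanishing is visible. For \<open>k = 2\<close> the formula is
  alternating, and \<open>row_2_value_pos\<close> regroups it into nonnegative parts.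
\<close>

text \<open>
  This rule, obtained by viewing a ring as a module over itself, rewrites \<open>a * (b * x)\<close> to \<open>a * b * x\<close> and
  makes the simplifier loop together with \<open>algebra_simps\<close>.
\<close>

declare ring_module.scale_scale [simp del]

abbreviation "lookup \<equiv> Poly_Mapping.lookup"
abbreviation "keys \<equiv> Poly_Mapping.keys"

section \<open>Dimensions of subquotients\<close>

context vector_space
begin

text \<open>
  Linearity is asked for on the subspace \<open>W\<close> only: the maps of complexes below are linear on a free module
  inside a larger function space.
\<close>
lemma image_span_linear_on:
  assumes W: "subspace W"
    and add: "\<And>x y. x \<in> W \<Longrightarrow> y \<in> W \<Longrightarrow> f (x + y) = f x + f y"
    and scale: "\<And>c x. x \<in> W \<Longrightarrow> f (scale c x) = scale c (f x)"
    and S: "S \<subseteq> W" and x: "x \<in> span (f ` S)"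
  shows "\<exists>y\<in>span S. f y = x"
proof -
  have SW: "span S \<subseteq> W" using S W by (rule span_minimal)
  have "subspace (f ` span S)"
  proof (rule subspaceI)
    have "f 0 = 0" using scale[of 0 0] subspace_0[OF W] by simp
    then show "0 \<in> f ` span S" using span_zero by force
  next
    fix a b assume "a \<in> f ` span S" "b \<in> f ` span S"
    then obtain u v where "u \<in> span S" "v \<in> span S" "a = f u" "b = f v" by auto
    then have "a + b = f (u + v)" "u + v \<in> span S" using add[of u v, symmetric] SW by (auto intro: span_add)
    then show "a + b \<in> f ` span S" by simp
  next
    fix c a assume "a \<in> f ` span S"
    then obtain u where "u \<in> span S" "a = f u" by auto
    then have "scale c a = f (scale c u)" "scale c u \<in> span S" using scale[of u c, symmetric] SW by (auto intro: span_scale)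
    then show "scale c a \<in> f ` span S" by simp
  qed
  moreover have "f ` S \<subseteq> f ` span S" using span_superset by blast
  ultimately have "span (f ` S) \<subseteq> f ` span S" by (rule span_minimal[rotated])
  then show ?thesis using x by auto
qed

text \<open>
  Rank-nullity for the composite of \<open>f\<close> with the projection modulo \<open>N\<close>: the first set is the preimage of
  its image, the second set is its kernel. Homology is represented by preimages of cycles and boundaries, so
  this form applies without quotient spaces.
\<close>
lemma dim_image_plus_kernel_modulo:
  assumes W: "subspace W" and N: "subspace N"
    and finW: "finite E" "W \<subseteq> span E" and finN: "finite E'" "N \<subseteq> span E'"
    and add: "\<And>x y. x \<in> W \<Longrightarrow> y \<in> W \<Longrightarrow> f (x + y) = f x + f y"
    and scale: "\<And>c x. x \<in> W \<Longrightarrow> f (scale c x) = scale c (f x)"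
  shows "dim {v. \<exists>w\<in>W. v - f w \<in> N} + dim {w \<in> W. f w \<in> N} = dim W + dim N"
proof -
  define Ker where "Ker = {w \<in> W. f w \<in> N}"
  define Im where "Im = {v. \<exists>w\<in>W. v - f w \<in> N}"
  have f0: "f 0 = 0" using scale[of 0 0] subspace_0[OF W] by simp
  have fdiff: "f (x - y) = f x - f y" if "x \<in> W" "y \<in> W" for x y
    using add[of "x - y" y] that subspace_diff[OF W] by (simp add: algebra_simps)
  have fin: "finite B" if "independent B" "B \<subseteq> W" for B
    using independent_span_bound[OF finW(1) that(1)] that finW by auto
  have finN': "finite B" if "independent B" "B \<subseteq> N" for B
    using independent_span_bound[OF finN(1) that(1)] that finN by auto
  have sKer: "subspace Ker"
    using W N f0 by (auto simp: Ker_def subspace_def add scale)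
  obtain B1 where B1: "B1 \<subseteq> Ker" "independent B1" "Ker \<subseteq> span B1" "card B1 = dim Ker"
    by (rule basis_exists)
  have "B1 \<subseteq> W" using B1 by (auto simp: Ker_def)
  then obtain B where B: "B1 \<subseteq> B" "B \<subseteq> W" "independent B" "W \<subseteq> span B"
    using maximal_independent_subset_extend[OF _ B1(2)] by metis
  obtain B3 where B3: "B3 \<subseteq> N" "independent B3" "N \<subseteq> span B3" "card B3 = dim N"
    by (rule basis_exists)
  have spanB3: "span B3 = N" using B3 N by (simp add: span_subspace)
  have finB: "finite B" "finite B3" using fin B finN' B3 by auto
  then have finB1: "finite B1" using B(1) finite_subset by blast
  define B2 where "B2 = B - B1"
  have "independent (f ` C \<union> B3) \<and> card (f ` C \<union> B3) = card C + card B3" if "finite C" "C \<subseteq> B2" for C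
    using that
  proof (induction C rule: finite_induct)
    case empty
    then show ?case using B3 by simp
  next
    case (insert b C)
    have CW: "insert b C \<subseteq> W" using insert.prems B by (auto simp: B2_def)
    \<comment> \<open>a relation among the images modulo \<open>N\<close> lifts to a relation in \<open>W\<close> modulo the kernel\<close>
    have "f b \<notin> span (f ` C \<union> B3)"
    proof
      assume "f b \<in> span (f ` C \<union> B3)"
      then obtain x n where xn: "f b = x + n" "x \<in> span (f ` C)" "n \<in> N"
        unfolding span_Un spanB3 by auto
      obtain y where y: "y \<in> span C" "f y = x"
        using image_span_linear_on[OF W add scale _ xn(2)] CW by auto
      have yW: "y \<in> W" using y(1) CW span_minimal[OF _ W, of C] by auto
      have bW: "b \<in> W" using CW by auto
      have "f (b - y) \<in> N" using fdiff[OF bW yW] xn y by simp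
      then have "b - y \<in> Ker" unfolding Ker_def using subspace_diff[OF W bW yW] by simp
      then have by1: "b - y \<in> span B1" using B1 by auto
      have "b = (b - y) + y" by simp
      also have "\<dots> \<in> span (B1 \<union> C)"
        using subsetD[OF span_mono by1, of "B1 \<union> C"] subsetD[OF span_mono y(1), of "B1 \<union> C"]
        by (intro span_add) auto
      also have "span (B1 \<union> C) \<subseteq> span (B - {b})"
        using insert B by (intro span_mono) (auto simp: B2_def)
      finally have "b \<in> span (B - {b})" .
      moreover have "b \<in> B" using insert.prems by (auto simp: B2_def)
      ultimately show False using B(3) unfolding dependent_def by blast
    qed
    moreover from this have "f b \<notin> f ` C \<union> B3" using span_superset[of "f ` C \<union> B3"] by auto
    ultimately show ?case using insert finB by (simp add: independent_insertI)
  qed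
  from this[of B2] have ind: "independent (f ` B2 \<union> B3)" "card (f ` B2 \<union> B3) = card B2 + card B3"
    using finB finB1 by (auto simp: B2_def)
  have sIm: "subspace Im"
  proof (rule subspaceI)
    show "0 \<in> Im" unfolding Im_def using f0 subspace_0[OF W] subspace_0[OF N] by (auto intro!: bexI[of _ 0])
  next
    fix x y assume "x \<in> Im" "y \<in> Im"
    then obtain u v where uv: "u \<in> W" "v \<in> W" "x - f u \<in> N" "y - f v \<in> N" unfolding Im_def by auto
    have "x + y - f (u + v) = (x - f u) + (y - f v)" unfolding add[OF uv(1,2)] by (simp add: algebra_simps)
    then have "x + y - f (u + v) \<in> N" using subspace_add[OF N uv(3,4)] by (simp only:)
    then show "x + y \<in> Im" unfolding Im_def using subspace_add[OF W uv(1,2)] by blast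
  next
    fix c x assume "x \<in> Im"
    then obtain u where u: "u \<in> W" "x - f u \<in> N" unfolding Im_def by auto
    have "scale c x - f (scale c u) = scale c (x - f u)" unfolding scale[OF u(1)] by (simp add: scale_right_diff_distrib)
    then have "scale c x - f (scale c u) \<in> N" using subspace_scale[OF N u(2)] by (simp only:)
    then show "scale c x \<in> Im" unfolding Im_def using subspace_scale[OF W u(1)] by blast
  qed
  have sub: "f ` B2 \<union> B3 \<subseteq> Im"
  proof
    fix x assume "x \<in> f ` B2 \<union> B3"
    then show "x \<in> Im"
    proof
      assume "x \<in> f ` B2"
      then obtain b where "b \<in> W" "x = f b" using B by (auto simp: B2_def)
      then show ?thesis unfolding Im_def using subspace_0[OF N] by (auto intro!: bexI[of _ b])
    next
      assume "x \<in> B3"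
      then show ?thesis unfolding Im_def using f0 B3 subspace_0[OF W] by (auto intro!: bexI[of _ 0])
    qed
  qed
  have "Im \<subseteq> span (f ` B2 \<union> B3)"
  proof
    fix v assume "v \<in> Im"
    then obtain w where w: "w \<in> W" "v - f w \<in> N" unfolding Im_def by auto
    have "w \<in> span (B1 \<union> B2)" using B w by (auto simp: B2_def Un_absorb1)
    then obtain x y where xy: "w = x + y" "x \<in> span B1" "y \<in> span B2" unfolding span_Un by auto
    have xK: "x \<in> Ker" using xy B1 span_minimal[OF B1(1) sKer] by auto
    have B2W: "B2 \<subseteq> W" using B by (auto simp: B2_def)
    have yW: "y \<in> W" using xy(3) span_minimal[OF B2W W] by auto
    have "f y \<in> span (f ` B2)"
    proof -
      have "subspace {y \<in> W. f y \<in> span (f ` B2)}"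
        using W f0 by (auto simp: subspace_def add scale intro: span_zero span_add span_scale)
      moreover have "B2 \<subseteq> {y \<in> W. f y \<in> span (f ` B2)}" using B2W by (auto intro: span_base)
      ultimately have "span B2 \<subseteq> {y \<in> W. f y \<in> span (f ` B2)}" by (rule span_minimal[rotated])
      then show ?thesis using xy by auto
    qed
    moreover have "v = f y + (f x + (v - f w))" using add[of x y] xK yW xy by (simp add: Ker_def)
    moreover have "f x + (v - f w) \<in> N" using xK w subspace_add[OF N] by (auto simp: Ker_def)
    ultimately show "v \<in> span (f ` B2 \<union> B3)" unfolding span_Un spanB3 by blast
  qed
  then have "dim Im = card B2 + card B3" using dim_unique[OF sub _ ind] by simp
  moreover have "dim W = card B1 + card B2"
    using basis_card_eq_dim[OF B(2,4,3)] finB finB1 B(1) card_mono[OF finB(1) B(1)] by (simp add: B2_def card_Diff_subset)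
  ultimately show ?thesis using B1 B3 by (simp add: Ker_def Im_def)
qed

lemma dim_mono_finite:
  assumes "V \<subseteq> W" "finite E" "W \<subseteq> span E"
  shows "dim V \<le> dim W"
proof -
  obtain B where B: "B \<subseteq> W" "independent B" "W \<subseteq> span B" "card B = dim W" by (rule basis_exists)
  have "finite B" using independent_span_bound[OF assms(2) B(2)] B assms by auto
  then have "dim V \<le> card B" using dim_le_card[of V B] B assms by auto
  then show ?thesis using B by simp
qed

text \<open>
  The hypothesis \<open>reflects\<close> says that the map from \<open>Z/B\<close> to \<open>Z'/B'\<close> induced by \<open>f\<close> is well defined and injective.
\<close>
lemma dim_quotient_mono:
  assumes Z: "subspace Z" and B': "subspace B'"
    and fin: "finite E" "Z \<subseteq> span E" "finite E'" "Z' \<subseteq> span E'" and sub: "B' \<subseteq> Z'"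
    and Z': "subspace Z'"
    and add: "\<And>x y. x \<in> Z \<Longrightarrow> y \<in> Z \<Longrightarrow> f (x + y) = f x + f y"
    and scale: "\<And>c x. x \<in> Z \<Longrightarrow> f (scale c x) = scale c (f x)"
    and maps: "\<And>x. x \<in> Z \<Longrightarrow> f x \<in> Z'"
    and reflects: "{x \<in> Z. f x \<in> B'} = B"
  shows "dim Z - dim B \<le> dim Z' - dim B'"
proof -
  have "dim {v. \<exists>w\<in>Z. v - f w \<in> B'} + dim B = dim Z + dim B'"
    using dim_image_plus_kernel_modulo[OF Z B' fin(1,2) fin(3) order_trans[OF sub fin(4)] add scale] reflects
    by simp
  moreover have "{v. \<exists>w\<in>Z. v - f w \<in> B'} \<subseteq> Z'"
  proof clarify
    fix v w assume "w \<in> Z" "v - f w \<in> B'"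
    then have "(v - f w) + f w \<in> Z'" using maps sub subspace_add[OF Z'] by blast
    then show "v \<in> Z'" by simp
  qed
  then have "dim {v. \<exists>w\<in>Z. v - f w \<in> B'} \<le> dim Z'" by (rule dim_mono_finite[OF _ fin(3,4)])
  ultimately show ?thesis by linarith
qed

text \<open>
  The functionals \<open>c x\<close> identify \<open>V\<close> with the functions on \<open>X\<close>, and the vectors dual to them form a basis.
  The spanning set is returned as well, because in a space of infinite dimension monotonicity of \<open>dim\<close>
  needs a finite one.
\<close>
lemma basis_of_coordinates:
  assumes V: "subspace V" and X: "finite X"
    and add: "\<And>x u v. c x (u + v) = c x u + c x v"
    and scale: "\<And>x a v. c x (scale a v) = a * c x v"
    and inj: "\<And>v. v \<in> V \<Longrightarrow> (\<And>x. x \<in> X \<Longrightarrow> c x v = 0) \<Longrightarrow> v = 0"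
    and ex: "\<And>x. x \<in> X \<Longrightarrow> \<exists>e\<in>V. \<forall>y\<in>X. c y e = (if y = x then 1 else 0)"
  obtains E where "finite E" "V \<subseteq> span E" "dim V = card X"
proof -
  obtain e where e: "\<And>x. x \<in> X \<Longrightarrow> e x \<in> V"
    "\<And>x y. x \<in> X \<Longrightarrow> y \<in> X \<Longrightarrow> c y (e x) = (if y = x then 1 else 0)"
    using ex by metis
  have inje: "inj_on e X"
    by (rule inj_onI) (metis e(2) zero_neq_one)
  have csum: "c y (\<Sum>x\<in>Y. g x) = (\<Sum>x\<in>Y. c y (g x))" if "finite Y" for Y :: "'c set" and g y
    using that
  proof (induction Y rule: finite_induct)
    case empty
    show ?case using scale[of y 0 0] by simp
  qed (simp add: add)
  have "V \<subseteq> span (e ` X)"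
  proof
    fix v assume v: "v \<in> V"
    define w where "w = (\<Sum>x\<in>X. scale (c x v) (e x))"
    have wV: "w \<in> V" unfolding w_def using e V by (auto intro!: subspace_sum subspace_scale)
    have "c y w = c y v" if "y \<in> X" for y
    proof -
      have "c y w = (\<Sum>x\<in>X. c x v * (if y = x then 1 else 0))"
        unfolding w_def csum[OF X] scale using e that by (intro sum.cong) auto
      also have "\<dots> = c y v" using X that by (simp add: if_distrib cong: if_cong)
      finally show ?thesis .
    qed
    moreover have "c y (v - w) = c y v - c y w" for y
      using add[of y v "scale (-1) w"] scale[of y "-1" w] by simp
    ultimately have "v - w = 0" using subspace_diff[OF V v wV] by (intro inj) auto
    moreover have "w \<in> span (e ` X)" unfolding w_def by (intro span_sum span_scale span_base) auto
    ultimately show "v \<in> span (e ` X)" by simp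
  qed
  moreover have "independent (e ` X)"
    unfolding dependent_def
  proof clarify
    fix x assume x: "x \<in> X" and "e x \<in> span (e ` X - {e x})"
    moreover have "subspace {v. c x v = 0}"
      using scale[of x 0 0] by (auto simp: subspace_def add scale)
    moreover have "e ` X - {e x} \<subseteq> {v. c x v = 0}" using e x by auto
    ultimately have "e x \<in> {v. c x v = 0}" using span_minimal[of "e ` X - {e x}" "{v. c x v = 0}"] by auto
    then have "c x (e x) = 0" by simp
    then show False using e x by simp
  qed
  moreover have "e ` X \<subseteq> V" using e by auto
  ultimately show ?thesis using that[of "e ` X"] X dim_unique[of "e ` X" V] card_image[OF inje] by auto
qed

end

section \<open>Monomial degrees and homogeneous components\<close>

definition mdeg :: "('p::finite \<Rightarrow>\<^sub>0 nat) \<Rightarrow> nat" where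
  "mdeg m = (\<Sum>p\<in>UNIV. lookup m p)"

lemma mdeg_add [simp]: "mdeg (m + n) = mdeg m + mdeg n"
  by (simp add: mdeg_def lookup_add sum.distrib)

lemma mdeg_zero [simp]: "mdeg 0 = 0"
  by (simp add: mdeg_def)

lemma mdeg_single [simp]: "mdeg (Poly_Mapping.single p c) = c"
  by (simp add: mdeg_def lookup_single when_def)

lemma mdeg_eq_0_iff [simp]: "mdeg m = 0 \<longleftrightarrow> m = 0"
  by (auto simp: mdeg_def intro: poly_mapping_eqI)

lemma finite_monomials_of_degree: "finite {m :: 'p::finite \<Rightarrow>\<^sub>0 nat. int (mdeg m) = e}"
proof -
  have "lookup ` {m :: 'p \<Rightarrow>\<^sub>0 nat. int (mdeg m) = e} \<subseteq> PiE UNIV (\<lambda>_. {..nat e})"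
  proof clarify
    fix m :: "'p \<Rightarrow>\<^sub>0 nat" assume e: "e = int (mdeg m)"
    have "lookup m p \<le> mdeg m" for p
      unfolding mdeg_def by (rule member_le_sum) auto
    then show "lookup m \<in> PiE UNIV (\<lambda>_. {..nat (int (mdeg m))})" by auto
  qed
  moreover have "finite (PiE (UNIV::'p set) (\<lambda>_. {..nat e}))" by (intro finite_PiE) auto
  ultimately have "finite (lookup ` {m :: 'p \<Rightarrow>\<^sub>0 nat. int (mdeg m) = e})"
    using finite_subset by blast
  then show ?thesis by (rule finite_imageD) (auto simp: inj_on_def intro: poly_mapping_eqI)
qed

lemma homogeneous_iff: "homogeneous e f \<longleftrightarrow> (\<forall>m. lookup f m \<noteq> 0 \<longrightarrow> int (mdeg m) = e)"
  by (auto simp: homogeneous_def mdeg_def in_keys_iff)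

lemma homogeneous_zero [simp]: "homogeneous e 0"
  by (simp add: homogeneous_iff)

lemma homogeneous_add: "homogeneous e f \<Longrightarrow> homogeneous e g \<Longrightarrow> homogeneous e (f + g)"
  by (auto simp: homogeneous_iff lookup_add) (metis add.right_neutral add.commute)

lemma homogeneous_diff: "homogeneous e f \<Longrightarrow> homogeneous e g \<Longrightarrow> homogeneous e (f - g)"
  by (auto simp: homogeneous_iff lookup_minus) (metis diff_self)

lemma homogeneous_mult: "homogeneous d f \<Longrightarrow> homogeneous e g \<Longrightarrow> homogeneous (d + e) (f * g)"
  using keys_mult[of f g] by (force simp: homogeneous_iff in_keys_iff)

lemma homogeneous_sum: "(\<And>x. x \<in> A \<Longrightarrow> homogeneous e (f x)) \<Longrightarrow> homogeneous e (\<Sum>x\<in>A. f x)"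
  by (induction A rule: infinite_finite_induct) (auto intro: homogeneous_add)

lemma homogeneous_const [simp]: "homogeneous 0 (const_poly c)"
  by (auto simp: homogeneous_iff const_poly_def lookup_single when_def)

lemma homogeneous_one [simp]: "homogeneous 0 1"
  using homogeneous_const[of 1] by (simp add: const_poly_def)

lemma lookup_const_mult [simp]: "lookup (const_poly c * f) m = c * lookup f m"
  unfolding const_poly_def mult_map_scale_conv_mult[symmetric]
  by (simp add: map.rep_eq when_def)

definition hom_part :: "int \<Rightarrow> ('p::finite, 'k::comm_ring_1) mpoly \<Rightarrow> ('p, 'k) mpoly" where
  "hom_part e f = Abs_poly_mapping (\<lambda>m. if int (mdeg m) = e then lookup f m else 0)"

lemma lookup_hom_part:
  "lookup (hom_part e f) m = (if int (mdeg m) = e then lookup f m else 0)"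
proof -
  have "finite {m. (if int (mdeg m) = e then lookup f m else 0) \<noteq> 0}"
    by (rule finite_subset[OF _ finite_lookup[of f]]) auto
  then show ?thesis by (simp add: hom_part_def)
qed

lemma homogeneous_hom_part: "homogeneous e (hom_part e f)"
  by (auto simp: homogeneous_iff lookup_hom_part split: if_splits)

lemma hom_part_id: "homogeneous e f \<Longrightarrow> hom_part e f = f"
  by (rule poly_mapping_eqI) (auto simp: homogeneous_iff lookup_hom_part)

lemma hom_part_add: "hom_part e (f + g) = hom_part e f + hom_part e g"
  by (rule poly_mapping_eqI) (auto simp: lookup_hom_part lookup_add)

lemma hom_part_sum: "hom_part e (\<Sum>x\<in>A. f x) = (\<Sum>x\<in>A. hom_part e (f x))"
proof (induction A rule: infinite_finite_induct)
  have "hom_part e (0::('a, 'b) mpoly) = 0" by (rule hom_part_id) simp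
  then show "hom_part e (sum f {}) = (\<Sum>x\<in>{}. hom_part e (f x))" by simp
  then show "hom_part e (sum f A) = (\<Sum>x\<in>A. hom_part e (f x))" if "infinite A" for A using that by simp
qed (auto simp: hom_part_add)

text \<open>
  The components of \<open>f\<close> of degree other than \<open>e - d\<close> contribute to \<open>a * f\<close> only in degrees other than \<open>e\<close>.
\<close>
lemma hom_part_homogeneous_mult:
  assumes "homogeneous d a"
  shows "hom_part e (a * f) = a * hom_part (e - d) f"
proof -
  define g where "g = f - hom_part (e - d) f"
  have "hom_part e (a * g) = 0"
  proof (rule poly_mapping_eqI)
    fix m
    have "lookup (a * g) m = 0" if m: "int (mdeg m) = e"
    proof (rule ccontr)
      assume "lookup (a * g) m \<noteq> 0"
      then obtain x y where "m = x + y" "lookup a x \<noteq> 0" "lookup g y \<noteq> 0"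
        using keys_mult[of a g] by (auto simp: in_keys_iff)
      then show False using assms m by (auto simp: homogeneous_iff g_def lookup_minus lookup_hom_part split: if_splits)
    qed
    then show "lookup (hom_part e (a * g)) m = lookup 0 m"
      by (simp add: lookup_hom_part)
  qed
  moreover have "a * f = a * hom_part (e - d) f + a * g" by (simp add: g_def algebra_simps)
  moreover have "homogeneous e (a * hom_part (e - d) f)"
    using homogeneous_mult[OF assms homogeneous_hom_part[of "e - d" f]] by simp
  ultimately show ?thesis by (simp add: hom_part_add hom_part_id)
qed

section \<open>Graded free modules\<close>

lemma free_module_diff: "u \<in> free_module B \<Longrightarrow> v \<in> free_module B \<Longrightarrow> (u - v :: nat \<Rightarrow> 'a::group_add) \<in> free_module B"
  by (simp add: free_module_def)

lemma free_module_smult: "v \<in> free_module B \<Longrightarrow> (\<lambda>b. (c::'a::mult_zero) * v b) \<in> free_module B"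
  by (simp add: free_module_def)

lemma free_module_zero [simp]: "0 \<in> free_module B"
  by (simp add: free_module_def)

lemma graded_piece_add: "u \<in> graded_piece F i j \<Longrightarrow> v \<in> graded_piece F i j \<Longrightarrow> u + v \<in> graded_piece F i j"
  by (auto simp: graded_piece_def free_module_def intro: homogeneous_add)

lemma graded_piece_diff: "u \<in> graded_piece F i j \<Longrightarrow> v \<in> graded_piece F i j \<Longrightarrow> u - v \<in> graded_piece F i j"
  by (auto simp: graded_piece_def free_module_def intro: homogeneous_diff)

lemma graded_piece_zero [simp]: "0 \<in> graded_piece F i j"
  by (auto simp: graded_piece_def)

lemma graded_piece_smult:
  "v \<in> graded_piece F i j \<Longrightarrow> homogeneous d c \<Longrightarrow> (\<lambda>b. c * v b) \<in> graded_piece F i (j + d)"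
  by (auto simp: graded_piece_def free_module_def intro: homogeneous_mult
      dest: homogeneous_mult[of d c "j - _"] simp: algebra_simps)

lemma graded_piece_scale: "v \<in> graded_piece F i j \<Longrightarrow> (\<lambda>b. const_poly c * v b) \<in> graded_piece F i j"
  using graded_piece_smult[of v F i j 0 "const_poly c"] by simp

lemma graded_piece_free: "v \<in> graded_piece F i j \<Longrightarrow> v \<in> free_module (basis F i)"
  by (simp add: graded_piece_def)

definition unit_vec :: "nat \<Rightarrow> nat \<Rightarrow> 'a::zero_neq_one" where
  "unit_vec b = (\<lambda>r. if r = b then 1 else 0)"

lemma unit_vec_free: "b \<in> B \<Longrightarrow> unit_vec b \<in> free_module B"
  by (auto simp: free_module_def unit_vec_def)

lemma unit_vec_graded: "b \<in> basis F i \<Longrightarrow> unit_vec b \<in> graded_piece F i (bdeg F i b)"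
  by (auto simp: graded_piece_def unit_vec_free) (auto simp: unit_vec_def)

lemma graded_piece_basis:
  fixes F :: "('p::finite, 'k::field) aug_complex"
  assumes "finite (basis F i)"
  obtains E where "finite E" "graded_piece F i j \<subseteq> coords.span E"
    "coords_dim (graded_piece F i j) = card {(b, m :: 'p \<Rightarrow>\<^sub>0 nat). b \<in> basis F i \<and> int (mdeg m) = j - bdeg F i b}"
proof -
  let ?X = "{(b, m :: 'p \<Rightarrow>\<^sub>0 nat). b \<in> basis F i \<and> int (mdeg m) = j - bdeg F i b}"
  have "?X = Sigma (basis F i) (\<lambda>b. {m. int (mdeg m) = j - bdeg F i b})" by auto
  then have fin: "finite ?X" using assms finite_monomials_of_degree by auto
  have sub: "coords.subspace (graded_piece F i j)"
    by (rule coords.subspaceI) (auto intro: graded_piece_add graded_piece_scale)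
  have inj: "v = 0" if "v \<in> graded_piece F i j" "\<And>x. x \<in> ?X \<Longrightarrow> lookup (v (fst x)) (snd x) = 0" for v
  proof (rule ext, rule poly_mapping_eqI)
    fix b m
    show "lookup (v b) m = lookup (0 b) m"
    proof (cases "b \<in> basis F i \<and> int (mdeg m) = j - bdeg F i b")
      case True
      then show ?thesis using that(2)[of "(b, m)"] by simp
    next
      case False
      show ?thesis
      proof (cases "b \<in> basis F i")
        case True
        then have "homogeneous (j - bdeg F i b) (v b)" using that(1) by (simp add: graded_piece_def)
        then show ?thesis using False True unfolding homogeneous_iff by auto
      next
        case False
        then show ?thesis using that(1) by (simp add: graded_piece_def free_module_def)
      qed
    qed
  qed
  have ex: "\<exists>e\<in>graded_piece F i j. \<forall>y\<in>?X. lookup (e (fst y)) (snd y) = (if y = x then 1 else 0)"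
    if x: "x \<in> ?X" for x
  proof -
    obtain b m where bm: "x = (b, m)" by force
    show ?thesis
      by (rule bexI[of _ "\<lambda>r. if r = b then Poly_Mapping.single m 1 else 0"])
        (use x in \<open>auto simp: bm graded_piece_def free_module_def homogeneous_iff lookup_single when_def\<close>)
  qed
  show ?thesis
  proof (rule coords.basis_of_coordinates[where V = "graded_piece F i j" and X = ?X and
        c = "\<lambda>x v. lookup (v (fst x)) (snd x)", OF sub fin _ _ inj ex])
    fix E assume "finite E" "graded_piece F i j \<subseteq> coords.span E" "coords_dim (graded_piece F i j) = card ?X"
    then show thesis by (rule that)
  qed (simp_all add: lookup_add)
qed

section \<open>Graded linear maps\<close>

text \<open>
  Degree-preserving \<open>R\<close>-linear maps from \<open>F\<^sub>i\<close> to \<open>G\<^sub>k\<close>. All conditions are relative to the free module,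
  since a coordinate outside the basis has no meaning.
\<close>
definition graded_linear ::
  "('p::finite, 'k::field) aug_complex \<Rightarrow> nat \<Rightarrow> ('p, 'k) aug_complex \<Rightarrow> nat \<Rightarrow>
     ((nat \<Rightarrow> ('p, 'k) mpoly) \<Rightarrow> nat \<Rightarrow> ('p, 'k) mpoly) \<Rightarrow> bool" where
  "graded_linear F i G k f \<longleftrightarrow>
     (\<forall>u\<in>free_module (basis F i). \<forall>v\<in>free_module (basis F i). f (u + v) = f u + f v) \<and>
     (\<forall>c. \<forall>v\<in>free_module (basis F i). f (\<lambda>b. c * v b) = (\<lambda>r. c * f v r)) \<and>
     (\<forall>v\<in>free_module (basis F i). f v \<in> free_module (basis G k)) \<and>
     (\<forall>j. \<forall>v\<in>graded_piece F i j. f v \<in> graded_piece G k j)"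

context
  fixes F G :: "('p::finite, 'k::field) aug_complex" and i k f
  assumes lin: "graded_linear F i G k f"
begin

lemma graded_linear_add: "u \<in> free_module (basis F i) \<Longrightarrow> v \<in> free_module (basis F i) \<Longrightarrow> f (u + v) = f u + f v"
  using lin unfolding graded_linear_def by blast

lemma graded_linear_smult: "v \<in> free_module (basis F i) \<Longrightarrow> f (\<lambda>b. c * v b) = (\<lambda>r. c * f v r)"
  using lin unfolding graded_linear_def by blast

lemma graded_linear_free: "v \<in> free_module (basis F i) \<Longrightarrow> f v \<in> free_module (basis G k)"
  using lin unfolding graded_linear_def by blast

lemma graded_linear_graded: "v \<in> graded_piece F i j \<Longrightarrow> f v \<in> graded_piece G k j"
  using lin unfolding graded_linear_def by blast

lemma graded_linear_zero: "f 0 = 0"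
proof -
  have "f (\<lambda>b. 0 * (0 :: nat \<Rightarrow> ('p, 'k) mpoly) b) = (\<lambda>r. 0 * f 0 r)"
    by (rule graded_linear_smult) (rule free_module_zero)
  then show ?thesis by (simp add: zero_fun_def)
qed

lemma graded_linear_diff:
  "u \<in> free_module (basis F i) \<Longrightarrow> v \<in> free_module (basis F i) \<Longrightarrow> f (u - v) = f u - f v"
  using graded_linear_add[of "u - v" v] by (simp add: free_module_diff algebra_simps)

lemma graded_linear_expand:
  assumes fin: "finite (basis F i)" and v: "v \<in> free_module (basis F i)"
  shows "f v r = (\<Sum>b\<in>basis F i. v b * f (unit_vec b) r)"
proof -
  have "f v r = (\<Sum>b\<in>S. v b * f (unit_vec b) r)"
    if "finite S" "S \<subseteq> basis F i" "v \<in> free_module S" for S v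
    using that
  proof (induction S arbitrary: v rule: finite_induct)
    case empty
    then have "v = 0" by (auto simp: free_module_def)
    then show ?case using fun_cong[OF graded_linear_zero, of r] unfolding \<open>v = 0\<close> by (simp add: zero_fun_def)
  next
    case (insert b S)
    define v' where "v' = (\<lambda>x. if x = b then 0 else v x)"
    have v': "v' \<in> free_module S" "v' \<in> free_module (basis F i)"
      using insert.prems insert.hyps by (auto simp: v'_def free_module_def)
    have b: "b \<in> basis F i" using insert.prems by auto
    have vdec: "v = v' + (\<lambda>x. v b * unit_vec b x)" by (auto simp: v'_def unit_vec_def fun_eq_iff)
    have "f v = f v' + (\<lambda>r. v b * f (unit_vec b) r)"
      by (subst vdec, subst graded_linear_add)
        (use v' b in \<open>auto intro: free_module_smult unit_vec_free simp: graded_linear_smult unit_vec_free\<close>)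
    moreover have "f v' r = (\<Sum>x\<in>S. v x * f (unit_vec x) r)"
      using insert v' by (auto simp: v'_def intro!: sum.cong)
    ultimately show ?case using insert.hyps by (simp add: add.commute)
  qed
  from this[OF fin _ v] show ?thesis by simp
qed

text \<open>
  This is why a graded linear map descends to \<open>F/IF\<close>: it is given by a matrix over \<open>R\<close>.
\<close>
lemma graded_linear_ideal:
  assumes "finite (basis F i)" "ring_module.subspace I" "v \<in> free_module (basis F i)" "\<And>b. v b \<in> I"
  shows "f v r \<in> I"
proof -
  have "f v r = (\<Sum>b\<in>basis F i. f (unit_vec b) r * v b)"
    using graded_linear_expand[OF assms(1,3)] by (simp add: mult.commute)
  then show ?thesis
    using assms by (auto intro!: ring_module.subspace_sum ring_module.subspace_scale)
qed

end

lemma graded_linear_compose: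
  "graded_linear F i G k f \<Longrightarrow> graded_linear G k H l g \<Longrightarrow> graded_linear F i H l (\<lambda>v. g (f v))"
  unfolding graded_linear_def by simp

lemma graded_linear_minus:
  fixes F G :: "('p::finite, 'k::field) aug_complex"
  assumes f: "graded_linear F i G k f" and g: "graded_linear F i G k g"
  shows "graded_linear F i G k (\<lambda>v. f v - g v)"
  unfolding graded_linear_def
proof (intro conjI ballI allI)
  fix u v :: "nat \<Rightarrow> ('p, 'k) mpoly" and c
  assume v: "v \<in> free_module (basis F i)"
  show "f (\<lambda>b. c * v b) - g (\<lambda>b. c * v b) = (\<lambda>r. c * (f v - g v) r)"
    by (simp add: graded_linear_smult[OF f v] graded_linear_smult[OF g v] fun_eq_iff algebra_simps)
  show "f v - g v \<in> free_module (basis G k)"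
    using graded_linear_free[OF f v] graded_linear_free[OF g v] by (rule free_module_diff)
  assume u: "u \<in> free_module (basis F i)"
  show "f (u + v) - g (u + v) = f u - g u + (f v - g v)"
    by (simp add: graded_linear_add[OF f u v] graded_linear_add[OF g u v])
next
  fix j v assume "v \<in> graded_piece F i j"
  then show "f v - g v \<in> graded_piece G k j"
    using graded_linear_graded[OF f] graded_linear_graded[OF g] by (intro graded_piece_diff)
qed

lemma graded_linear_ident: "graded_linear F i F i (\<lambda>v. v)"
  unfolding graded_linear_def by simp

text \<open>
  The universal property of a graded free module.
\<close>
lemma graded_linear_of_images:
  fixes F G :: "('p::finite, 'k::field) aug_complex"
  assumes u: "\<And>b. b \<in> basis F i \<Longrightarrow> u b \<in> graded_piece G k (bdeg F i b)"
  shows "graded_linear F i G k (\<lambda>v r. \<Sum>b\<in>basis F i. v b * u b r)"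
  unfolding graded_linear_def
proof (intro conjI ballI allI)
  fix v w :: "nat \<Rightarrow> ('p, 'k) mpoly" and c
  show "(\<lambda>r. \<Sum>b\<in>basis F i. (v + w) b * u b r) = (\<lambda>r. \<Sum>b\<in>basis F i. v b * u b r) + (\<lambda>r. \<Sum>b\<in>basis F i. w b * u b r)"
    by (rule ext) (simp add: distrib_right sum.distrib)
  show "(\<lambda>r. \<Sum>b\<in>basis F i. c * v b * u b r) = (\<lambda>r. c * (\<Sum>b\<in>basis F i. v b * u b r))"
    by (simp only: sum_distrib_left mult.assoc)
  show "(\<lambda>r. \<Sum>b\<in>basis F i. v b * u b r) \<in> free_module (basis G k)"
    using u by (auto simp: free_module_def graded_piece_def intro!: sum.neutral)
  fix j assume v: "v \<in> graded_piece F i j"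
  show "(\<lambda>r. \<Sum>b\<in>basis F i. v b * u b r) \<in> graded_piece G k j"
    unfolding graded_piece_def
  proof (intro CollectI conjI ballI)
    show "(\<lambda>r. \<Sum>b\<in>basis F i. v b * u b r) \<in> free_module (basis G k)"
      using u by (auto simp: free_module_def graded_piece_def intro!: sum.neutral)
    fix r assume r: "r \<in> basis G k"
    show "homogeneous (j - bdeg G k r) (\<Sum>b\<in>basis F i. v b * u b r)"
    proof (rule homogeneous_sum)
      fix b assume b: "b \<in> basis F i"
      have "homogeneous (j - bdeg F i b) (v b)" "homogeneous (bdeg F i b - bdeg G k r) (u b r)"
        using v u[OF b] b r by (auto simp: graded_piece_def)
      from homogeneous_mult[OF this] show "homogeneous (j - bdeg G k r) (v b * u b r)" by simp
    qed
  qed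
qed

section \<open>Comparison of graded free resolutions\<close>

lemma const_coeff_add: "const_coeff (f + g) = const_coeff f + const_coeff g"
  by (simp add: const_coeff_def lookup_add)

lemma const_coeff_mult:
  "const_coeff (f * g) = const_coeff f * const_coeff (g :: ('p::finite, 'k::comm_ring_1) mpoly)"
proof -
  have z: "0 = l + q \<longleftrightarrow> l = 0 \<and> q = 0" for l q :: "'p \<Rightarrow>\<^sub>0 nat"
    by (auto simp: poly_mapping_eq_iff lookup_add fun_eq_iff)
  have "const_coeff (f * g) = (\<Sum>l. lookup f l * (\<Sum>q. (lookup g q when l = 0) when q = 0))"
    unfolding const_coeff_def lookup_mult z by (simp only: when_when conj_commute)
  also have "\<dots> = (\<Sum>l. (lookup f l * lookup g 0) when l = 0)"
    by (simp only: Sum_any_when_equal mult_when)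
  also have "\<dots> = const_coeff f * const_coeff g" by (simp only: Sum_any_when_equal const_coeff_def)
  finally show ?thesis .
qed

lemma augmentation_add: "augmentation F (u + v) = augmentation F u + augmentation F v"
  by (simp add: augmentation_def const_coeff_add distrib_right sum.distrib)

lemma augmentation_smult:
  fixes F :: "('p::finite, 'k::field) aug_complex"
  shows "augmentation F (\<lambda>b. c * v b) = const_coeff c * augmentation F v"
  by (auto simp only: augmentation_def const_coeff_mult sum_distrib_left mult.assoc)

lemma augmentation_diff: "augmentation F (u - v) = augmentation F u - augmentation F v"
  using augmentation_add[of F "u - v" v] by simp

text \<open>
  The augmentation counts as the boundary map out of degree zero, so exactness and the lifting argument
  need no special case at the end of the complex.
\<close>
definition augmented_cycles :: "('p, 'k::field) aug_complex \<Rightarrow> nat \<Rightarrow> (nat \<Rightarrow> ('p, 'k) mpoly) set" where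
  "augmented_cycles F i = {v \<in> free_module (basis F i). if i = 0 then augmentation F v = 0 else bdry F i v = 0}"

lemma bdry_zero_index: "bdry F 0 v = 0"
  by (simp add: bdry_def fun_eq_iff)

lemma bdry_add: "bdry F i (u + v) = bdry F i u + bdry F i v"
  by (rule ext) (simp add: bdry_def distrib_left sum.distrib)

lemma bdry_diff: "bdry F i (u - v) = bdry F i u - bdry F i v"
  using bdry_add[of F i "u - v" v] by simp

lemma bdry_smult: "bdry F i (\<lambda>b. c * v b) = (\<lambda>r. c * bdry F i v r)"
  by (rule ext) (auto simp only: bdry_def sum_distrib_left mult.left_commute mult_zero_right if_True if_False split: if_split)

lemma graded_free_resolutionD:
  assumes "graded_free_resolution F"
  shows "finite (basis F i)"
    and "\<forall>i\<ge>1. \<forall>r\<in>basis F (i - 1). \<forall>b\<in>basis F i.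
        homogeneous (bdeg F i b - bdeg F (i - 1) r) (entry F i r b)"
    and "b \<in> basis F 0 \<Longrightarrow> aug F b \<noteq> 0 \<Longrightarrow> bdeg F 0 b = 0"
    and "\<forall>i\<ge>1. {v \<in> free_module (basis F i). bdry F i v = 0} =
             bdry F (i + 1) ` free_module (basis F (i + 1))"
    and "{v \<in> free_module (basis F 0). augmentation F v = 0} =
        bdry F 1 ` free_module (basis F 1)"
    and "augmentation F ` free_module (basis F 0) = UNIV"
  subgoal using assms unfolding graded_free_resolution_def by (elim conjE) (erule allE)
  subgoal using assms unfolding graded_free_resolution_def by (elim conjE)
  subgoal using assms unfolding graded_free_resolution_def by (elim conjE) (drule bspec, assumption, erule mp)
  subgoal using assms unfolding graded_free_resolution_def by (elim conjE)
  subgoal using assms unfolding graded_free_resolution_def by (elim conjE)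
  subgoal using assms unfolding graded_free_resolution_def by (elim conjE)
  done

context
  fixes F :: "('p::finite, 'k::field) aug_complex"
  assumes res: "graded_free_resolution F"
begin

lemmas resolution_finite = graded_free_resolutionD(1)[OF res]

lemma resolution_exact: "augmented_cycles F i = bdry F (Suc i) ` free_module (basis F (Suc i))"
proof (cases i)
  case 0
  then show ?thesis using graded_free_resolutionD(5)[OF res] by (simp add: augmented_cycles_def)
next
  case (Suc k)
  then show ?thesis using spec[OF graded_free_resolutionD(4)[OF res], of i] by (simp add: augmented_cycles_def)
qed

lemma bdry_in_augmented_cycles: "v \<in> free_module (basis F (Suc i)) \<Longrightarrow> bdry F (Suc i) v \<in> augmented_cycles F i"
  unfolding resolution_exact by blast

lemma augmented_cycles_free: "v \<in> augmented_cycles F i \<Longrightarrow> v \<in> free_module (basis F i)"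
  by (simp add: augmented_cycles_def)

lemma bdry_bdry: "v \<in> free_module (basis F (Suc i)) \<Longrightarrow> bdry F i (bdry F (Suc i) v) = 0"
  using bdry_in_augmented_cycles[of v i] by (cases i) (auto simp: augmented_cycles_def bdry_zero_index)

lemma entry_homogeneous:
  "r \<in> basis F i \<Longrightarrow> b \<in> basis F (Suc i) \<Longrightarrow>
     homogeneous (bdeg F (Suc i) b - bdeg F i r) (entry F (Suc i) r b)"
  using spec[OF graded_free_resolutionD(2)[OF res], of "Suc i"] by simp

lemma graded_linear_bdry: "graded_linear F (Suc i) F i (bdry F (Suc i))"
proof -
  define u where "u = (\<lambda>b r. if r \<in> basis F i then entry F (Suc i) r b else 0)"
  have "bdry F (Suc i) = (\<lambda>v r. \<Sum>b\<in>basis F (Suc i). v b * u b r)"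
    by (intro ext) (auto simp: bdry_def u_def mult.commute intro!: sum.cong)
  moreover have "u b \<in> graded_piece F i (bdeg F (Suc i) b)" if "b \<in> basis F (Suc i)" for b
    using that entry_homogeneous by (auto simp: u_def graded_piece_def free_module_def)
  ultimately show ?thesis using graded_linear_of_images[of F "Suc i" u F i] by simp
qed

lemma bdry_graded: "v \<in> graded_piece F i j \<Longrightarrow> bdry F i v \<in> graded_piece F (i - 1) j"
  using graded_linear_graded[OF graded_linear_bdry] by (cases i) (auto simp: bdry_zero_index)

text \<open>
  Exactness is assumed for the ungraded modules. A preimage of a homogeneous vector may be replaced by its
  homogeneous component of the same degree because the entries of the boundary map are homogeneous.
\<close>
lemma resolution_graded_exact:
  assumes v: "v \<in> augmented_cycles F i" "v \<in> graded_piece F i j"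
  shows "\<exists>w\<in>graded_piece F (Suc i) j. bdry F (Suc i) w = v"
proof -
  obtain w where w: "w \<in> free_module (basis F (Suc i))" "v = bdry F (Suc i) w"
    using v(1) unfolding resolution_exact by blast
  define w' where "w' b = (if b \<in> basis F (Suc i) then hom_part (j - bdeg F (Suc i) b) (w b) else 0)" for b
  have "w' \<in> graded_piece F (Suc i) j"
    by (auto simp: graded_piece_def free_module_def w'_def homogeneous_hom_part)
  moreover have "bdry F (Suc i) w' = v"
  proof
    fix r
    show "bdry F (Suc i) w' r = v r"
    proof (cases "r \<in> basis F i")
      case True
      have "bdry F (Suc i) w' r = (\<Sum>b\<in>basis F (Suc i). hom_part (j - bdeg F i r) (entry F (Suc i) r b * w b))"
        using True by (auto simp: bdry_def w'_def hom_part_homogeneous_mult[OF entry_homogeneous[OF True]] intro!: sum.cong)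
      also have "\<dots> = hom_part (j - bdeg F i r) (v r)"
        using True by (simp add: w(2) bdry_def hom_part_sum)
      also have "\<dots> = v r" using v(2) True by (intro hom_part_id) (simp add: graded_piece_def)
      finally show ?thesis .
    qed (simp add: w(2) bdry_def)
  qed
  ultimately show ?thesis by blast
qed

end

text \<open>
  Graded free modules are projective: a preimage is chosen for every basis vector. Chain maps and homotopies
  are both built from this step, one homological degree at a time.
\<close>
lemma lift_through_boundary:
  assumes F: "finite (basis F n)" and G: "graded_free_resolution G"
    and \<alpha>: "graded_linear F n G m \<alpha>"
    and cyc: "\<And>v. v \<in> free_module (basis F n) \<Longrightarrow> \<alpha> v \<in> augmented_cycles G m"
  shows "\<exists>g. graded_linear F n G (Suc m) g \<and> (\<forall>v\<in>free_module (basis F n). bdry G (Suc m) (g v) = \<alpha> v)"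
proof -
  have "\<exists>w\<in>graded_piece G (Suc m) (bdeg F n b). bdry G (Suc m) w = \<alpha> (unit_vec b)"
    if "b \<in> basis F n" for b
    by (intro resolution_graded_exact[OF G] cyc unit_vec_free that
        graded_linear_graded[OF \<alpha>] unit_vec_graded)
  then obtain u where u: "\<And>b. b \<in> basis F n \<Longrightarrow> u b \<in> graded_piece G (Suc m) (bdeg F n b)"
    "\<And>b. b \<in> basis F n \<Longrightarrow> bdry G (Suc m) (u b) = \<alpha> (unit_vec b)" by metis
  define g where "g = (\<lambda>v r. \<Sum>b\<in>basis F n. v b * u b r)"
  have g: "graded_linear F n G (Suc m) g" unfolding g_def by (rule graded_linear_of_images) (rule u)
  have gu: "g (unit_vec b) = u b" if "b \<in> basis F n" for b
    using F that by (auto simp: g_def unit_vec_def fun_eq_iff if_distribR if_distrib[of "\<lambda>x. x * _"] cong: if_cong)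
  have "bdry G (Suc m) (g v) = \<alpha> v" if v: "v \<in> free_module (basis F n)" for v
  proof
    fix r
    have "bdry G (Suc m) (g v) r = (\<Sum>b\<in>basis F n. v b * bdry G (Suc m) (g (unit_vec b)) r)"
      by (rule graded_linear_expand[OF graded_linear_compose[OF g graded_linear_bdry[OF G]] F v])
    also have "\<dots> = \<alpha> v r"
      unfolding graded_linear_expand[OF \<alpha> F v] by (intro sum.cong) (auto simp: gu u)
    finally show "bdry G (Suc m) (g v) r = \<alpha> v r" .
  qed
  then show ?thesis using g by blast
qed

text \<open>
  The invariant \<open>P\<close> records that cycles go to cycles, which is the hypothesis of the next lifting step.
\<close>
lemma chain_map_exists:
  fixes F G :: "('p::finite, 'k::field) aug_complex"
  assumes F: "graded_free_resolution F" and G: "graded_free_resolution G"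
  obtains \<phi> where "\<And>i. graded_linear F i G i (\<phi> i)"
    "\<And>v. v \<in> free_module (basis F 0) \<Longrightarrow> augmentation G (\<phi> 0 v) = augmentation F v"
    "\<And>i v. v \<in> free_module (basis F (Suc i)) \<Longrightarrow> bdry G (Suc i) (\<phi> (Suc i) v) = \<phi> i (bdry F (Suc i) v)"
proof -
  define P where "P = (\<lambda>n f. graded_linear F n G n f \<and> (\<forall>v\<in>augmented_cycles F n. f v \<in> augmented_cycles G n) \<and>
     (n = 0 \<longrightarrow> (\<forall>v\<in>free_module (basis F 0). augmentation G (f v) = augmentation F v)))"
  define Q where "Q = (\<lambda>n f g. \<forall>v\<in>free_module (basis F (Suc n)). bdry G (Suc n) (g v) = f (bdry F (Suc n) v))"
  have "\<exists>f. \<forall>n. P n (f n) \<and> Q n (f n) (f (Suc n))"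
  proof (rule dependent_nat_choice)
    have "augmentation G ` free_module (basis G 0) = UNIV"
      by (rule graded_free_resolutionD(6)[OF G])
    then have "1 \<in> augmentation G ` free_module (basis G 0)" by simp
    then obtain v0 where "1 = augmentation G v0" by blast
    then have "(\<Sum>b\<in>basis G 0. const_coeff (v0 b) * aug G b) \<noteq> 0" by (simp add: augmentation_def)
    then obtain b0 where b0: "b0 \<in> basis G 0" "const_coeff (v0 b0) * aug G b0 \<noteq> 0"
      by (rule sum.not_neutral_contains_not_neutral)
    then have b0: "b0 \<in> basis G 0" "aug G b0 \<noteq> 0" by auto
    have deg0: "bdeg F 0 b = 0" if "aug F b \<noteq> 0" "b \<in> basis F 0" for b
      using graded_free_resolutionD(3)[OF F that(2,1)] .
    have "bdeg G 0 b0 = 0" by (rule graded_free_resolutionD(3)[OF G b0])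
    \<comment> \<open>\<open>aug G\<close> does not vanish on \<open>b0\<close>, so a scalar multiple of this basis vector has any prescribed augmentation\<close>
    define u :: "nat \<Rightarrow> nat \<Rightarrow> ('p, 'k) mpoly"
      where "u b = (\<lambda>r. const_poly (aug F b / aug G b0) * unit_vec b0 r)" for b
    have ug: "u b \<in> graded_piece G 0 (bdeg F 0 b)" if "b \<in> basis F 0" for b
    proof (cases "aug F b = 0")
      case True
      then show ?thesis by (simp add: u_def const_poly_def graded_piece_def free_module_def)
    next
      case False
      then show ?thesis using graded_piece_scale[OF unit_vec_graded[of b0 G 0]] b0 \<open>bdeg G 0 b0 = 0\<close>
          deg0[OF _ that] by (simp add: u_def)
    qed
    define f where "f = (\<lambda>v r. \<Sum>b\<in>basis F 0. v b * u b r)"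
    have f: "graded_linear F 0 G 0 f" unfolding f_def using ug by (rule graded_linear_of_images)
    have augf: "augmentation G (f v) = augmentation F v" for v
    proof -
      have "f v = (\<lambda>r. (\<Sum>b\<in>basis F 0. v b * const_poly (aug F b / aug G b0)) * unit_vec b0 r)"
        by (simp only: f_def u_def sum_distrib_right mult.assoc)
      then have "augmentation G (f v) = const_coeff (\<Sum>b\<in>basis F 0. v b * const_poly (aug F b / aug G b0))
          * augmentation G (unit_vec b0)"
        by (simp only: augmentation_smult)
      also have "augmentation G (unit_vec b0) = (\<Sum>b\<in>basis G 0. if b = b0 then aug G b else 0)"
        unfolding augmentation_def by (intro sum.cong) (auto simp: unit_vec_def const_coeff_def)
      also have "\<dots> = aug G b0"
        using b0 resolution_finite[OF G] by simp
      also have "const_coeff (\<Sum>b\<in>basis F 0. v b * const_poly (aug F b / aug G b0)) =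
          (\<Sum>b\<in>basis F 0. const_coeff (v b) * (aug F b / aug G b0))"
      proof -
        have s: "const_coeff (\<Sum>b\<in>A. g b) = (\<Sum>b\<in>A. const_coeff (g b))" for A and g :: "nat \<Rightarrow> ('p,'k) mpoly"
          by (simp add: const_coeff_def lookup_sum)
        show ?thesis unfolding s const_coeff_mult by (simp add: const_coeff_def const_poly_def)
      qed
      finally show ?thesis using b0 by (simp add: augmentation_def sum_distrib_right)
    qed
    show "\<exists>f. P 0 f"
    proof (intro exI[of _ f])
      show "P 0 f" unfolding P_def using f augf graded_linear_free[OF f] by (auto simp: augmented_cycles_def)
    qed
  next
    fix f n assume P: "P n f"
    then have f: "graded_linear F n G n f" "\<And>v. v \<in> augmented_cycles F n \<Longrightarrow> f v \<in> augmented_cycles G n"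
      unfolding P_def by auto
    have "\<exists>g. graded_linear F (Suc n) G (Suc n) g \<and>
        (\<forall>v\<in>free_module (basis F (Suc n)). bdry G (Suc n) (g v) = f (bdry F (Suc n) v))"
      by (rule lift_through_boundary[OF resolution_finite[OF F] G
            graded_linear_compose[OF graded_linear_bdry[OF F] f(1)]])
        (intro f(2) bdry_in_augmented_cycles[OF F])
    then obtain g where g: "graded_linear F (Suc n) G (Suc n) g"
      "\<And>v. v \<in> free_module (basis F (Suc n)) \<Longrightarrow> bdry G (Suc n) (g v) = f (bdry F (Suc n) v)" by blast
    have "P (Suc n) g" unfolding P_def
      using g graded_linear_free[OF g(1)] graded_linear_zero[OF f(1)] by (auto simp: augmented_cycles_def)
    then show "\<exists>g. P (Suc n) g \<and> Q n f g" using g unfolding Q_def by blast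
  qed
  then obtain \<phi> where "\<And>n. P n (\<phi> n)" "\<And>n. Q n (\<phi> n) (\<phi> (Suc n))" by blast
  then show ?thesis using that[of \<phi>] unfolding P_def Q_def by blast
qed

text \<open>
  A chain endomorphism that is zero after augmentation is null-homotopic. It will be applied to the difference
  of a round trip between two resolutions and the identity.
\<close>
lemma homotopy_exists:
  fixes F :: "('p::finite, 'k::field) aug_complex"
  assumes F: "graded_free_resolution F"
    and \<theta>: "\<And>i. graded_linear F i F i (\<theta> i)"
    and aug: "\<And>v. v \<in> free_module (basis F 0) \<Longrightarrow> augmentation F (\<theta> 0 v) = 0"
    and chain: "\<And>i v. v \<in> free_module (basis F (Suc i)) \<Longrightarrow> bdry F (Suc i) (\<theta> (Suc i) v) = \<theta> i (bdry F (Suc i) v)"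
  obtains h where "\<And>i. graded_linear F i F (Suc i) (h i)"
    "\<And>v. v \<in> free_module (basis F 0) \<Longrightarrow> \<theta> 0 v = bdry F 1 (h 0 v)"
    "\<And>i v. v \<in> free_module (basis F (Suc i)) \<Longrightarrow>
        \<theta> (Suc i) v = bdry F (Suc (Suc i)) (h (Suc i) v) + h i (bdry F (Suc i) v)"
proof -
  define P where "P = (\<lambda>n h. graded_linear F n F (Suc n) h \<and> (\<forall>v\<in>augmented_cycles F n. \<theta> n v = bdry F (Suc n) (h v)) \<and>
     (n = 0 \<longrightarrow> (\<forall>v\<in>free_module (basis F 0). \<theta> 0 v = bdry F 1 (h v))))"
  define Q where "Q = (\<lambda>n h g. \<forall>v\<in>free_module (basis F (Suc n)).
      \<theta> (Suc n) v = bdry F (Suc (Suc n)) (g v) + h (bdry F (Suc n) v))"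
  have "\<exists>f. \<forall>n. P n (f n) \<and> Q n (f n) (f (Suc n))"
  proof (rule dependent_nat_choice)
    have "\<exists>g. graded_linear F 0 F (Suc 0) g \<and> (\<forall>v\<in>free_module (basis F 0). bdry F (Suc 0) (g v) = \<theta> 0 v)"
      by (rule lift_through_boundary[OF resolution_finite[OF F] F \<theta>])
        (use aug graded_linear_free[OF \<theta>] in \<open>auto simp: augmented_cycles_def\<close>)
    then show "\<exists>h. P 0 h" unfolding P_def by (fastforce simp: augmented_cycles_def)
  next
    fix h n assume P: "P n h"
    then have h: "graded_linear F n F (Suc n) h" "\<And>v. v \<in> augmented_cycles F n \<Longrightarrow> \<theta> n v = bdry F (Suc n) (h v)"
      unfolding P_def by auto
    define \<alpha> where "\<alpha> = (\<lambda>v. \<theta> (Suc n) v - h (bdry F (Suc n) v))"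
    have \<alpha>: "graded_linear F (Suc n) F (Suc n) \<alpha>" unfolding \<alpha>_def
      by (intro graded_linear_minus \<theta> graded_linear_compose[OF graded_linear_bdry[OF F] h(1)])
    have "\<alpha> v \<in> augmented_cycles F (Suc n)" if v: "v \<in> free_module (basis F (Suc n))" for v
    proof -
      have "bdry F (Suc n) (\<alpha> v) = 0"
        unfolding \<alpha>_def bdry_diff chain[OF v] using h(2)[OF bdry_in_augmented_cycles[OF F v]] by simp
      then show ?thesis using graded_linear_free[OF \<alpha> v] by (simp add: augmented_cycles_def)
    qed
    from lift_through_boundary[OF resolution_finite[OF F] F \<alpha> this]
    obtain g where g: "graded_linear F (Suc n) F (Suc (Suc n)) g"
      "\<And>v. v \<in> free_module (basis F (Suc n)) \<Longrightarrow> bdry F (Suc (Suc n)) (g v) = \<alpha> v" by blast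
    have "Q n h g" unfolding Q_def using g(2) by (simp add: \<alpha>_def)
    moreover have "P (Suc n) g" unfolding P_def
    proof (intro conjI ballI impI g(1))
      fix v assume v: "v \<in> augmented_cycles F (Suc n)"
      then have "bdry F (Suc n) v = 0" by (simp add: augmented_cycles_def)
      then show "\<theta> (Suc n) v = bdry F (Suc (Suc n)) (g v)"
        using g(2)[OF augmented_cycles_free[OF F v]] graded_linear_zero[OF h(1)] by (simp add: \<alpha>_def)
    qed simp
    ultimately show "\<exists>g. P (Suc n) g \<and> Q n h g" by blast
  qed
  then obtain h where "\<And>n. P n (h n)" "\<And>n. Q n (h n) (h (Suc n))" by blast
  then show ?thesis using that[of h] unfolding P_def Q_def by blast
qed

section \<open>Independence of Tor from the resolution\<close>

context
  fixes F :: "('p::finite, 'k::field) aug_complex" and I :: "('p, 'k) mpoly set"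
  assumes F: "graded_free_resolution F" and I: "ring_module.subspace I"
begin

lemma subspace_tor_cycles: "coords.subspace (tor_cycles F I i j)"
  by (rule coords.subspaceI)
    (auto simp: tor_cycles_def bdry_add bdry_smult graded_piece_add graded_piece_scale
      ring_module.subspace_0[OF I] bdry_def[of F i 0]
      intro: ring_module.subspace_add[OF I] ring_module.subspace_scale[OF I])

lemma subspace_tor_boundaries: "coords.subspace (tor_boundaries F I i j)"
proof (rule coords.subspaceI)
  show "0 \<in> tor_boundaries F I i j" unfolding tor_boundaries_def
    by (auto simp: bdry_def ring_module.subspace_0[OF I] intro!: bexI[of _ 0])
next
  fix u v assume "u \<in> tor_boundaries F I i j" "v \<in> tor_boundaries F I i j"
  then obtain w w' where *: "u \<in> graded_piece F i j" "v \<in> graded_piece F i j"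
    "w \<in> graded_piece F (i + 1) j" "w' \<in> graded_piece F (i + 1) j"
    "\<And>b. u b - bdry F (i + 1) w b \<in> I" "\<And>b. v b - bdry F (i + 1) w' b \<in> I"
    unfolding tor_boundaries_def by auto
  have "(u + v) b - bdry F (i + 1) (w + w') b \<in> I" for b
    using ring_module.subspace_add[OF I *(5)[of b] *(6)[of b]] unfolding bdry_add
    by (simp add: algebra_simps)
  then show "u + v \<in> tor_boundaries F I i j"
    using * unfolding tor_boundaries_def by (blast intro: graded_piece_add)
next
  fix c v assume "v \<in> tor_boundaries F I i j"
  then obtain w where *: "v \<in> graded_piece F i j" "w \<in> graded_piece F (i + 1) j"
    "\<And>b. v b - bdry F (i + 1) w b \<in> I"
    unfolding tor_boundaries_def by auto
  have "const_poly c * v b - bdry F (i + 1) (\<lambda>b. const_poly c * w b) b \<in> I" for b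
    using ring_module.subspace_scale[OF I *(3)[of b], of "const_poly c"] unfolding bdry_smult
    by (simp add: algebra_simps)
  then show "(\<lambda>b. const_poly c * v b) \<in> tor_boundaries F I i j"
    using * unfolding tor_boundaries_def by (blast intro: graded_piece_scale)
qed

lemma tor_boundaries_subset: "tor_boundaries F I i j \<subseteq> tor_cycles F I i j"
proof
  fix v assume "v \<in> tor_boundaries F I i j"
  then obtain w where *: "v \<in> graded_piece F i j" "w \<in> graded_piece F (Suc i) j"
    "\<And>b. v b - bdry F (Suc i) w b \<in> I"
    unfolding tor_boundaries_def by auto
  have "bdry F i v r \<in> I" for r
  proof (cases i)
    case 0
    then show ?thesis by (simp add: bdry_zero_index ring_module.subspace_0[OF I])
  next
    case (Suc k)
    have "bdry F (Suc k) (v - bdry F (Suc i) w) r \<in> I"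
    proof (rule graded_linear_ideal[OF graded_linear_bdry[OF F] resolution_finite[OF F] I])
      show "v - bdry F (Suc i) w \<in> free_module (basis F (Suc k))"
        using graded_piece_free[OF *(1)] graded_linear_free[OF graded_linear_bdry[OF F] graded_piece_free[OF *(2)]]
        by (intro free_module_diff) (auto simp: Suc)
    qed (use * in auto)
    then show ?thesis using bdry_bdry[OF F graded_piece_free[OF *(2)]] by (simp add: bdry_diff Suc)
  qed
  then show "v \<in> tor_cycles F I i j" using * by (auto simp: tor_cycles_def)
qed

end

text \<open>
  The map induced on homology by \<open>\<phi>\<close> is injective because \<open>\<psi> \<circ> \<phi>\<close> is homotopic to the identity. An inequality
  suffices, the roles of \<open>F\<close> and \<open>G\<close> being symmetric.
\<close>
lemma tor_dim_le:
  fixes F G :: "('p::finite, 'k::field) aug_complex"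
  assumes F: "graded_free_resolution F" and G: "graded_free_resolution G"
    and I: "ring_module.subspace I"
  shows "coords_dim (tor_cycles F I i j) - coords_dim (tor_boundaries F I i j)
       \<le> coords_dim (tor_cycles G I i j) - coords_dim (tor_boundaries G I i j)"
proof -
  obtain \<phi> where \<phi>: "\<And>i. graded_linear F i G i (\<phi> i)"
    "\<And>v. v \<in> free_module (basis F 0) \<Longrightarrow> augmentation G (\<phi> 0 v) = augmentation F v"
    "\<And>i v. v \<in> free_module (basis F (Suc i)) \<Longrightarrow> bdry G (Suc i) (\<phi> (Suc i) v) = \<phi> i (bdry F (Suc i) v)"
    by (rule chain_map_exists[OF F G]) blast
  obtain \<psi> where \<psi>: "\<And>i. graded_linear G i F i (\<psi> i)"
    "\<And>v. v \<in> free_module (basis G 0) \<Longrightarrow> augmentation F (\<psi> 0 v) = augmentation G v"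
    "\<And>i v. v \<in> free_module (basis G (Suc i)) \<Longrightarrow> bdry F (Suc i) (\<psi> (Suc i) v) = \<psi> i (bdry G (Suc i) v)"
    by (rule chain_map_exists[OF G F]) blast
  define \<theta> where "\<theta> i v = \<psi> i (\<phi> i v) - v" for i v
  have \<theta>: "graded_linear F i F i (\<theta> i)" for i unfolding \<theta>_def
    by (intro graded_linear_minus graded_linear_ident graded_linear_compose[OF \<phi>(1) \<psi>(1)])
  have \<theta>aug: "augmentation F (\<theta> 0 v) = 0" if "v \<in> free_module (basis F 0)" for v
    using \<phi>(2)[OF that] \<psi>(2)[OF graded_linear_free[OF \<phi>(1) that]]
    unfolding \<theta>_def augmentation_diff by simp
  have \<theta>chain: "bdry F (Suc i) (\<theta> (Suc i) v) = \<theta> i (bdry F (Suc i) v)"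
    if "v \<in> free_module (basis F (Suc i))" for i v
    using \<phi>(3)[OF that] \<psi>(3)[OF graded_linear_free[OF \<phi>(1) that]]
    unfolding \<theta>_def bdry_diff by simp
  obtain h where h: "\<And>i. graded_linear F i F (Suc i) (h i)"
    "\<And>v. v \<in> free_module (basis F 0) \<Longrightarrow> \<theta> 0 v = bdry F 1 (h 0 v)"
    "\<And>i v. v \<in> free_module (basis F (Suc i)) \<Longrightarrow>
        \<theta> (Suc i) v = bdry F (Suc (Suc i)) (h (Suc i) v) + h i (bdry F (Suc i) v)"
    by (rule homotopy_exists[OF F \<theta> \<theta>aug \<theta>chain]) blast+
  have \<phi>I: "\<phi> i v r \<in> I" if "v \<in> free_module (basis F i)" "\<And>b. v b \<in> I" for i v r
    by (rule graded_linear_ideal[OF \<phi>(1) resolution_finite[OF F] I that])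
  have \<psi>I: "\<psi> i v r \<in> I" if "v \<in> free_module (basis G i)" "\<And>b. v b \<in> I" for i v r
    by (rule graded_linear_ideal[OF \<psi>(1) resolution_finite[OF G] I that])
  have hI: "h i v r \<in> I" if "v \<in> free_module (basis F i)" "\<And>b. v b \<in> I" for i v r
    by (rule graded_linear_ideal[OF h(1) resolution_finite[OF F] I that])
  have bF: "bdry F (Suc i) v \<in> free_module (basis F i)" if "v \<in> free_module (basis F (Suc i))" for i v
    by (rule graded_linear_free[OF graded_linear_bdry[OF F] that])
  have bG: "bdry G (Suc i) v \<in> free_module (basis G i)" if "v \<in> free_module (basis G (Suc i))" for i v
    by (rule graded_linear_free[OF graded_linear_bdry[OF G] that])
  \<comment> \<open>modulo \<open>I\<close>, every cycle agrees with its image under \<open>\<psi> \<circ> \<phi>\<close> up to a boundary\<close>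
  have homotopic: "\<exists>x\<in>graded_piece F (Suc i) j. \<forall>b. v b - (\<psi> i (\<phi> i v) b + bdry F (Suc i) x b) \<in> I"
    if v: "v \<in> tor_cycles F I i j" for v
  proof -
    have vg: "v \<in> graded_piece F i j" "\<And>r. bdry F i v r \<in> I" using v by (auto simp: tor_cycles_def)
    note vf = graded_piece_free[OF vg(1)]
    have x: "- h i v \<in> graded_piece F (Suc i) j"
      using graded_piece_diff[OF graded_piece_zero graded_linear_graded[OF h(1) vg(1)]] by simp
    have neg: "bdry F (Suc i) (- h i v) = - bdry F (Suc i) (h i v)"
      using bdry_diff[of F "Suc i" 0 "h i v"] bdry_diff[of F "Suc i" 0 0] by simp
    have "v b - (\<psi> i (\<phi> i v) b + bdry F (Suc i) (- h i v) b) \<in> I" for b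
    proof (cases i)
      case 0
      have "\<psi> i (\<phi> i v) b - v b = bdry F (Suc i) (h i v) b"
        using fun_cong[OF h(2)[of v], of b] vf by (simp add: 0 \<theta>_def)
      then have "v b - (\<psi> i (\<phi> i v) b + bdry F (Suc i) (- h i v) b) = 0"
        by (simp add: neg algebra_simps)
      then show ?thesis using ring_module.subspace_0[OF I] by simp
    next
      case (Suc k)
      have vf': "v \<in> free_module (basis F (Suc k))" using vf Suc by simp
      have "\<psi> i (\<phi> i v) b - v b = bdry F (Suc i) (h i v) b + h k (bdry F i v) b"
        using fun_cong[OF h(3)[OF vf'], of b] by (simp add: Suc \<theta>_def)
      then have "v b - (\<psi> i (\<phi> i v) b + bdry F (Suc i) (- h i v) b) = - h k (bdry F i v) b"
        by (simp add: neg algebra_simps)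
      moreover have "h k (bdry F i v) b \<in> I" using bF[OF vf'] vg(2) by (intro hI) (auto simp: Suc)
      ultimately show ?thesis using ring_module.subspace_neg[OF I] by simp
    qed
    then show ?thesis using x by blast
  qed
  have cyc: "\<phi> i v \<in> tor_cycles G I i j" if v: "v \<in> tor_cycles F I i j" for v
  proof -
    have vg: "v \<in> graded_piece F i j" "\<And>r. bdry F i v r \<in> I" using v by (auto simp: tor_cycles_def)
    have "bdry G i (\<phi> i v) r \<in> I" for r
    proof (cases i)
      case 0
      then show ?thesis by (simp add: bdry_zero_index ring_module.subspace_0[OF I])
    next
      case (Suc k)
      then have "v \<in> free_module (basis F (Suc k))" using graded_piece_free[OF vg(1)] by simp
      from \<phi>(3)[OF this] \<phi>I[OF bF[OF this]] show ?thesis using vg(2) by (simp add: Suc)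
    qed
    then show ?thesis using graded_linear_graded[OF \<phi>(1) vg(1)] by (simp add: tor_cycles_def)
  qed
  have "{v \<in> tor_cycles F I i j. \<phi> i v \<in> tor_boundaries G I i j} = tor_boundaries F I i j" (is "?L = ?R")
  proof
    show "?L \<subseteq> ?R"
    proof clarify
      fix v assume v: "v \<in> tor_cycles F I i j" and bd: "\<phi> i v \<in> tor_boundaries G I i j"
      have vg: "v \<in> graded_piece F i j" using v by (auto simp: tor_cycles_def)
      obtain w where w: "w \<in> graded_piece G (Suc i) j" "\<And>b. \<phi> i v b - bdry G (Suc i) w b \<in> I"
        using bd by (auto simp: tor_boundaries_def)
      obtain x where x: "x \<in> graded_piece F (Suc i) j" "\<And>b. v b - (\<psi> i (\<phi> i v) b + bdry F (Suc i) x b) \<in> I"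
        using homotopic[OF v] by blast
      note wf = graded_piece_free[OF w(1)]
      note pf = graded_linear_free[OF \<phi>(1) graded_piece_free[OF vg]]
      have "\<psi> i (\<phi> i v - bdry G (Suc i) w) b \<in> I" for b
        using w(2) by (intro \<psi>I free_module_diff pf bG wf) auto
      then have 1: "\<psi> i (\<phi> i v) b - bdry F (Suc i) (\<psi> (Suc i) w) b \<in> I" for b
        using graded_linear_diff[OF \<psi>(1) pf bG[OF wf]] \<psi>(3)[OF wf] by simp
      have "v b - bdry F (Suc i) (\<psi> (Suc i) w + x) b \<in> I" for b
        using ring_module.subspace_add[OF I 1[of b] x(2)[of b]] by (simp add: bdry_add algebra_simps)
      moreover have "\<psi> (Suc i) w + x \<in> graded_piece F (Suc i) j"
        by (intro graded_piece_add x graded_linear_graded[OF \<psi>(1)] w)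
      ultimately show "v \<in> tor_boundaries F I i j" using vg by (auto simp: tor_boundaries_def)
    qed
    show "?R \<subseteq> ?L"
    proof
      fix v assume v: "v \<in> tor_boundaries F I i j"
      then have vc: "v \<in> tor_cycles F I i j" using tor_boundaries_subset[OF F I] by blast
      have vg: "v \<in> graded_piece F i j" using v by (auto simp: tor_boundaries_def)
      obtain w where w: "w \<in> graded_piece F (Suc i) j" "\<And>b. v b - bdry F (Suc i) w b \<in> I"
        using v by (auto simp: tor_boundaries_def)
      note wf = graded_piece_free[OF w(1)]
      have "\<phi> i (v - bdry F (Suc i) w) b \<in> I" for b
        using w(2) by (intro \<phi>I free_module_diff graded_piece_free[OF vg] bF wf) auto
      then have "\<phi> i v b - bdry G (Suc i) (\<phi> (Suc i) w) b \<in> I" for b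
        using graded_linear_diff[OF \<phi>(1) graded_piece_free[OF vg] bF[OF wf]] \<phi>(3)[OF wf] by simp
      then have "\<phi> i v \<in> tor_boundaries G I i j"
        using graded_linear_graded[OF \<phi>(1) w(1)] graded_linear_graded[OF \<phi>(1) vg]
        by (auto simp: tor_boundaries_def)
      then show "v \<in> ?L" using vc by simp
    qed
  qed
  moreover obtain E where E: "finite E" "graded_piece F i j \<subseteq> coords.span E"
    by (rule graded_piece_basis[OF resolution_finite[OF F]])
  moreover obtain E' where E': "finite E'" "graded_piece G i j \<subseteq> coords.span E'"
    by (rule graded_piece_basis[OF resolution_finite[OF G]])
  moreover have "tor_cycles F I i j \<subseteq> graded_piece F i j" "tor_cycles G I i j \<subseteq> graded_piece G i j"
    by (auto simp: tor_cycles_def)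
  ultimately show ?thesis
    by (intro coords.dim_quotient_mono[where f = "\<phi> i" and E = E and E' = E']
        subspace_tor_cycles[OF F I] subspace_tor_cycles[OF G I] subspace_tor_boundaries[OF G I]
        tor_boundaries_subset[OF G I] cyc graded_linear_add[OF \<phi>(1)] graded_linear_smult[OF \<phi>(1)]
        graded_piece_free[of _ F i j]) auto
qed

lemma tor_dim_unique:
  assumes "graded_free_resolution F" "graded_free_resolution G" "ring_module.subspace I"
  shows "coords_dim (tor_cycles F I i j) - coords_dim (tor_boundaries F I i j)
       = coords_dim (tor_cycles G I i j) - coords_dim (tor_boundaries G I i j)"
  using tor_dim_le[OF assms] tor_dim_le[OF assms(2,1,3)] by (rule antisym)

section \<open>Matchings on the Koszul complex\<close>

definition var_mon :: "'p \<Rightarrow> 'p \<Rightarrow>\<^sub>0 nat" where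
  "var_mon p = Poly_Mapping.single p 1"

lemma lookup_var_mon [simp]: "lookup (var_mon p) q = (if q = p then 1 else 0)"
  by (simp add: var_mon_def lookup_single when_def)

lemma mdeg_var_mon [simp]: "mdeg (var_mon p) = 1"
  by (simp add: var_mon_def)

lemma minus_var_mon_add: "0 < lookup n p \<Longrightarrow> n - var_mon p + var_mon p = n"
  by (rule poly_mapping_eqI) (auto simp: lookup_add lookup_minus)

lemma lookup_poly_var_mult:
  "lookup (poly_var p * f) n =
     (if 0 < lookup n p then lookup f (n - var_mon p) else 0)"
proof -
  have eq: "n = var_mon p + q \<longleftrightarrow> 0 < lookup n p \<and> q = n - var_mon p" for q
    using minus_var_mon_add[of n p] by (auto simp: lookup_add add.commute)
  have "lookup (poly_var p * f) n =
      (\<Sum>l. (\<Sum>q. lookup f q when n = var_mon p + q) when l = var_mon p)"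
    unfolding lookup_mult poly_var_def lookup_single when_mult var_mon_def[symmetric]
    by (auto simp: when_def intro!: Sum_any.cong)
  also have "\<dots> = (\<Sum>q. lookup f q when n = var_mon p + q)"
    by (simp only: Sum_any_when_equal)
  also have "\<dots> = (\<Sum>q. (lookup f q when 0 < lookup n p) when q = n - var_mon p)"
    unfolding eq when_when by (simp only: conj_commute)
  also have "\<dots> = (lookup f (n - var_mon p) when 0 < lookup n p)"
    by (simp only: Sum_any_when_equal)
  finally show ?thesis by (simp add: when_def)
qed

definition koszul_sign :: "'p::finite \<Rightarrow> 'p set \<Rightarrow> 'k::comm_ring_1" where
  "koszul_sign p \<tau> = (-1) ^ card {r \<in> \<tau>. to_nat r < to_nat p}"

lemma koszul_sign_square [simp]: "koszul_sign p \<tau> * koszul_sign p \<tau> = 1"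
  by (simp add: koszul_sign_def flip: power_mult_distrib)

lemma koszul_sign_square' [simp]: "koszul_sign p \<tau> * (koszul_sign p \<tau> * x) = x"
  by (simp flip: mult.assoc)

lemma koszul_sign_insert:
  assumes "p \<notin> \<tau>"
  shows "koszul_sign r (insert p \<tau>) = (if to_nat p < to_nat r then - koszul_sign r \<tau> else koszul_sign r \<tau>)"
proof -
  have "{s \<in> insert p \<tau>. to_nat s < to_nat r} =
    (if to_nat p < to_nat r then insert p {s \<in> \<tau>. to_nat s < to_nat r} else {s \<in> \<tau>. to_nat s < to_nat r})"
    by auto
  then show ?thesis using assms by (simp add: koszul_sign_def)
qed

text \<open>
  The Koszul differential on coefficient functions: \<open>f \<tau> m\<close> is the coefficient of \<open>e\<^sub>\<tau> x\<^sup>m\<close>, and the differential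
  moves a variable from \<open>\<tau>\<close> to \<open>m\<close>. There is no finiteness condition on \<open>f\<close>, so the combinatorial part of
  the argument does not mention polynomials.
\<close>
definition koszul_diff :: "('p::finite set \<Rightarrow> ('p \<Rightarrow>\<^sub>0 nat) \<Rightarrow> 'k::comm_ring_1) \<Rightarrow> 'p set \<Rightarrow> ('p \<Rightarrow>\<^sub>0 nat) \<Rightarrow> 'k" where
  "koszul_diff f \<rho> n = (\<Sum>p | p \<notin> \<rho> \<and> 0 < lookup n p. koszul_sign p \<rho> * f (insert p \<rho>) (n - var_mon p))"

lemma koszul_diff_cong:
  assumes "\<And>p. p \<notin> \<rho> \<Longrightarrow> 0 < lookup n p \<Longrightarrow> f (insert p \<rho>) (n - var_mon p) = g (insert p \<rho>) (n - var_mon p)"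
  shows "koszul_diff f \<rho> n = koszul_diff g \<rho> n"
  unfolding koszul_diff_def using assms by (intro sum.cong) auto

lemma koszul_diff_diff: "koszul_diff (\<lambda>\<tau> m. f \<tau> m - g \<tau> m) \<rho> n = koszul_diff f \<rho> n - koszul_diff g \<rho> n"
  unfolding koszul_diff_def by (simp add: right_diff_distrib sum_subtractf)

lemma koszul_diff_square: "koszul_diff (koszul_diff f) \<rho> n = 0"
proof -
  define A where "A = {p. p \<notin> \<rho> \<and> 0 < lookup n p}"
  define a where "a p r = koszul_sign p \<rho> * (koszul_sign r (insert p \<rho>) * f (insert r (insert p \<rho>)) (n - var_mon p - var_mon r))" for p r
  define S where "S = {(p, r). p \<in> A \<and> r \<in> A \<and> to_nat p < to_nat r}"
  have finS: "finite S" by (rule finite_subset[of _ UNIV]) auto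
  \<comment> \<open>removing \<open>p\<close> and \<open>r\<close> in either order gives the same basis vector with opposite signs\<close>
  have anti: "a r p = - a p r" if "(p, r) \<in> S" for p r
  proof -
    have "n - var_mon r - var_mon p = n - var_mon p - var_mon r"
      by (rule poly_mapping_eqI) (simp add: lookup_minus)
    then show ?thesis using that
      by (auto simp: a_def S_def A_def koszul_sign_insert insert_commute)
  qed
  have "koszul_diff (koszul_diff f) \<rho> n = (\<Sum>p\<in>A. \<Sum>r\<in>A - {p}. a p r)"
    unfolding koszul_diff_def A_def[symmetric]
  proof (rule sum.cong[OF refl])
    fix p assume p: "p \<in> A"
    have "{r. r \<notin> insert p \<rho> \<and> 0 < lookup (n - var_mon p) r} = A - {p}"
      by (auto simp: A_def lookup_minus split: if_splits)
    then show "koszul_sign p \<rho> * (\<Sum>r | r \<notin> insert p \<rho> \<and> 0 < lookup (n - var_mon p) r.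
        koszul_sign r (insert p \<rho>) * f (insert r (insert p \<rho>)) (n - var_mon p - var_mon r)) = (\<Sum>r\<in>A - {p}. a p r)"
      by (simp add: a_def sum_distrib_left)
  qed
  also have "\<dots> = (\<Sum>(p, r)\<in>Sigma A (\<lambda>p. A - {p}). a p r)"
    by (simp add: sum.Sigma)
  also have "Sigma A (\<lambda>p. A - {p}) = S \<union> prod.swap ` S"
    by (auto simp: S_def image_iff dest: injD[OF inj_to_nat]) (metis inj_to_nat injD linorder_neqE_nat)
  also have "(\<Sum>(p, r)\<in>S \<union> prod.swap ` S. a p r) = (\<Sum>(p, r)\<in>S. a p r) + (\<Sum>(p, r)\<in>prod.swap ` S. a p r)"
    using finS by (intro sum.union_disjoint) (auto simp: S_def)
  also have "(\<Sum>(p, r)\<in>prod.swap ` S. a p r) = (\<Sum>(p, r)\<in>S. a r p)"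
    by (subst sum.reindex) (auto intro!: inj_onI sum.cong simp: case_prod_unfold)
  also have "\<dots> = (\<Sum>(p, r)\<in>S. - a p r)"
    using anti by (intro sum.cong) auto
  finally show ?thesis by (simp add: case_prod_unfold sum_negf)
qed

text \<open>
  An acyclic matching, in the sense of discrete Morse theory, on the basis vectors \<open>e\<^sub>\<tau> x\<^sup>m\<close> of the Koszul
  complex of the ring with basis \<open>M\<close>. A pair \<open>(\<tau>, m)\<close> is matched by moving the point \<open>sel \<tau> m\<close> between \<open>\<tau>\<close> and
  \<open>m\<close>. The conditions \<open>push\<close> and \<open>pull\<close> say that the move is possible in either direction; \<open>sel_move\<close> says
  that the selected point is not affected by the moves that occur in the differential; \<open>crit\<close> says that
  no move leads to an unmatched pair. The bound \<open>k0\<close> restricts all this to monomials of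
  large degree: for a projective plane, the selection is made on the line spanned by the monomial, which
  exists from degree two on.
\<close>
locale koszul_matching =
  fixes M :: "('p::finite \<Rightarrow>\<^sub>0 nat) set" and k0 :: nat
    and sel :: "'p set \<Rightarrow> ('p \<Rightarrow>\<^sub>0 nat) \<Rightarrow> 'p option"
  assumes down: "m + var_mon r \<in> M \<Longrightarrow> m \<in> M"
    and push: "m \<in> M \<Longrightarrow> k0 \<le> mdeg m \<Longrightarrow> sel \<tau> m = Some p \<Longrightarrow> p \<in> \<tau> \<Longrightarrow> m + var_mon p \<in> M"
    and pull: "m \<in> M \<Longrightarrow> k0 \<le> mdeg m \<Longrightarrow> sel \<tau> m = Some p \<Longrightarrow> p \<notin> \<tau> \<Longrightarrow> 0 < lookup m p"
    and sel_move: "m + var_mon r \<in> M \<Longrightarrow> k0 \<le> mdeg m \<Longrightarrow> r \<notin> \<rho> \<Longrightarrow> sel (insert r \<rho>) m = sel \<rho> (m + var_mon r)"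
    and crit: "m \<in> M \<Longrightarrow> k0 \<le> mdeg m \<Longrightarrow> sel \<tau> m = None \<Longrightarrow> r \<notin> \<tau> \<Longrightarrow> lookup m r = 0"
begin

text \<open>
  The pairs on which the values of a cycle can be prescribed: the unmatched ones and those whose selected point
  lies in the monomial already.
\<close>
definition free_pair :: "'p set \<Rightarrow> ('p \<Rightarrow>\<^sub>0 nat) \<Rightarrow> bool" where
  "free_pair \<tau> m \<longleftrightarrow> (\<forall>p. sel \<tau> m = Some p \<longrightarrow> p \<notin> \<tau>)"

lemma sel_minus:
  assumes "n \<in> M" "k0 < mdeg n" "r \<notin> \<rho>" "0 < lookup n r"
  shows "sel (insert r \<rho>) (n - var_mon r) = sel \<rho> n" "n - var_mon r \<in> M" "mdeg n = Suc (mdeg (n - var_mon r))"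
proof -
  let ?m = "n - var_mon r"
  have n: "?m + var_mon r = n" by (rule minus_var_mon_add) (rule assms)
  show d: "mdeg n = Suc (mdeg ?m)" using mdeg_add[of ?m "var_mon r"] n by simp
  show "?m \<in> M" using down[of ?m r] n assms by simp
  show "sel (insert r \<rho>) ?m = sel \<rho> n" using sel_move[of ?m r \<rho>] n assms d by simp
qed

text \<open>
  If \<open>p\<close> is selected at \<open>(\<tau>, m)\<close> and lies in \<open>\<tau>\<close>, move it to the monomial and evaluate the differential at
  the resulting pair. Every term other than \<open>\<plusminus> f \<tau> m\<close> belongs to a free pair, because its first component does
  not contain \<open>p\<close>, which is still the selected point.
\<close>
lemma cycle_zero_if_zero_on_free:
  assumes cyc: "\<And>\<rho> n. Suc (card \<rho>) = i \<Longrightarrow> n \<in> M \<Longrightarrow> mdeg n = Suc d \<Longrightarrow> koszul_diff f \<rho> n = 0"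
    and free: "\<And>\<tau> m. card \<tau> = i \<Longrightarrow> m \<in> M \<Longrightarrow> mdeg m = d \<Longrightarrow> free_pair \<tau> m \<Longrightarrow> f \<tau> m = 0"
    and d: "k0 \<le> d" and \<tau>: "card \<tau> = i" and m: "m \<in> M" "mdeg m = d"
  shows "f \<tau> m = 0"
proof (cases "free_pair \<tau> m")
  case True
  then show ?thesis using free assms by blast
next
  case False
  then obtain p where p: "sel \<tau> m = Some p" "p \<in> \<tau>" by (auto simp: free_pair_def)
  define \<rho> n where "\<rho> = \<tau> - {p}" and "n = m + var_mon p"
  have \<rho>: "p \<notin> \<rho>" "insert p \<rho> = \<tau>" using p by (auto simp: \<rho>_def)
  have card\<rho>: "Suc (card \<rho>) = i" using \<rho> \<tau> card_insert_disjoint[of \<rho> p] by simp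
  have n: "n \<in> M" "mdeg n = Suc d" "0 < lookup n p" "n - var_mon p = m"
    using push[OF m(1) _ p] m d by (auto simp: n_def lookup_add)
  have selr: "sel \<rho> n = Some p" using sel_minus(1)[OF n(1) _ \<rho>(1) n(3)] n d p \<rho> by simp
  have "0 = koszul_diff f \<rho> n" using cyc[OF card\<rho> n(1,2)] by simp
  also have "\<dots> = (\<Sum>r | r \<notin> \<rho> \<and> 0 < lookup n r. if r = p then koszul_sign p \<rho> * f \<tau> m else 0)"
    unfolding koszul_diff_def
  proof (rule sum.cong[OF refl])
    fix r assume r: "r \<in> {r. r \<notin> \<rho> \<and> 0 < lookup n r}"
    then have s: "sel (insert r \<rho>) (n - var_mon r) = Some p" "n - var_mon r \<in> M" "mdeg (n - var_mon r) = d"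
      using sel_minus[OF n(1), of r \<rho>] selr n d by auto
    show "koszul_sign r \<rho> * f (insert r \<rho>) (n - var_mon r) = (if r = p then koszul_sign p \<rho> * f \<tau> m else 0)"
    proof (cases "r = p")
      case False
      then have "free_pair (insert r \<rho>) (n - var_mon r)" using s \<rho> by (auto simp: free_pair_def)
      then have "f (insert r \<rho>) (n - var_mon r) = 0" using s r card\<rho> by (intro free) auto
      then show ?thesis using False by simp
    qed (simp add: \<rho> n)
  qed
  also have "\<dots> = koszul_sign p \<rho> * f \<tau> m" using \<rho> n by simp
  finally have "koszul_sign p \<rho> * (koszul_sign p \<rho> * f \<tau> m) = 0" by simp
  then show ?thesis by simp
qed

text \<open>
  The value at a pair that is not free is the one forced by the vanishing of the differential at the pair
  obtained by moving the selected point.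
\<close>
definition extend_free ::
  "('p set \<Rightarrow> ('p \<Rightarrow>\<^sub>0 nat) \<Rightarrow> 'k::comm_ring_1) \<Rightarrow> 'p set \<Rightarrow> ('p \<Rightarrow>\<^sub>0 nat) \<Rightarrow> 'k" where
  "extend_free g \<tau> m = (if m \<in> M \<and> \<not> free_pair \<tau> m
     then (let p = the (sel \<tau> m); \<rho> = \<tau> - {p}; n = m + var_mon p in
        - koszul_sign p \<rho> * (\<Sum>r | r \<notin> \<rho> \<and> 0 < lookup n r \<and> r \<noteq> p. koszul_sign r \<rho> * g (insert r \<rho>) (n - var_mon r)))
     else g \<tau> m)"

text \<open>
  The differential vanishes on free pairs by the choice of the extension. As it is itself a cycle, it vanishes
  on all pairs by the preceding lemma.
\<close>
lemma koszul_diff_extend_free: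
  assumes n: "n \<in> M" "k0 < mdeg n"
  shows "koszul_diff (extend_free g) \<rho> n = 0"
proof -
  have free0: "koszul_diff (extend_free g) \<rho> n = 0" if n: "n \<in> M" "k0 < mdeg n" and fr: "free_pair \<rho> n" for \<rho> n
  proof (cases "sel \<rho> n")
    case None
    have e: "{p. p \<notin> \<rho> \<and> 0 < lookup n p} = {}"
      using crit[OF n(1) less_imp_le[OF n(2)] None] by force
    show ?thesis unfolding koszul_diff_def e by simp
  next
    case (Some p)
    have p: "p \<notin> \<rho>" "0 < lookup n p"
      using fr Some pull[OF n(1) _ Some] n(2) by (auto simp: free_pair_def)
    let ?A = "{r. r \<notin> \<rho> \<and> 0 < lookup n r}"
    let ?B = "{r. r \<notin> \<rho> \<and> 0 < lookup n r \<and> r \<noteq> p}"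
    have A: "?A = insert p ?B" using p by auto
    have s: "sel (insert r \<rho>) (n - var_mon r) = Some p" "n - var_mon r \<in> M" if "r \<in> ?A" for r
      using sel_minus[OF n, of r \<rho>] that Some by auto
    have "extend_free g (insert p \<rho>) (n - var_mon p) =
        - koszul_sign p \<rho> * (\<Sum>r\<in>?B. koszul_sign r \<rho> * g (insert r \<rho>) (n - var_mon r))"
      using s[of p] p minus_var_mon_add[of n p]
      by (auto simp: extend_free_def free_pair_def Let_def intro!: arg_cong[where f = "\<lambda>x. koszul_sign p \<rho> * x"] sum.cong)
    moreover have "extend_free g (insert r \<rho>) (n - var_mon r) = g (insert r \<rho>) (n - var_mon r)" if "r \<in> ?B" for r
      using s[of r] that p by (auto simp: extend_free_def free_pair_def)
    ultimately show ?thesis unfolding koszul_diff_def A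
      by (subst sum.insert) (auto simp: algebra_simps intro!: sum.cong)
  qed
  show ?thesis
    by (rule cycle_zero_if_zero_on_free[where f = "koszul_diff (extend_free g)" and i = "card \<rho>" and d = "mdeg n"])
      (use n free0 in \<open>auto simp: koszul_diff_square\<close>)
qed

definition contraction ::
  "('p set \<Rightarrow> ('p \<Rightarrow>\<^sub>0 nat) \<Rightarrow> 'k::comm_ring_1) \<Rightarrow> 'p set \<Rightarrow> ('p \<Rightarrow>\<^sub>0 nat) \<Rightarrow> 'k" where
  "contraction f \<tau> m = (if free_pair \<tau> m then 0
     else let p = the (sel \<tau> m) in koszul_sign p (\<tau> - {p}) * f (\<tau> - {p}) (m + var_mon p))"

text \<open>
  The difference between \<open>f\<close> and the differential of its contraction is a cycle that vanishes on free pairs.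
\<close>
lemma cycle_is_boundary:
  assumes M: "M = UNIV" "k0 = 0"
    and cyc: "\<And>\<rho> n. Suc (card \<rho>) = i \<Longrightarrow> koszul_diff f \<rho> n = 0"
    and crit0: "\<And>\<tau> m. card \<tau> = i \<Longrightarrow> sel \<tau> m = None \<Longrightarrow> f \<tau> m = 0"
    and \<tau>: "card \<tau> = i"
  shows "f \<tau> m = koszul_diff (contraction f) \<tau> m"
proof -
  have "f \<tau> m - koszul_diff (contraction f) \<tau> m = 0"
  proof (rule cycle_zero_if_zero_on_free[where f = "\<lambda>\<tau> m. f \<tau> m - koszul_diff (contraction f) \<tau> m" and i = i and d = "mdeg m"])
    fix \<rho> :: "'p set" and n assume "Suc (card \<rho>) = i"
    then show "koszul_diff (\<lambda>\<tau> m. f \<tau> m - koszul_diff (contraction f) \<tau> m) \<rho> n = 0"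
      by (simp add: koszul_diff_diff koszul_diff_square cyc)
  next
    fix \<tau> :: "'p set" and m' assume \<tau>: "card \<tau> = i" and fr: "free_pair \<tau> m'"
    show "f \<tau> m' - koszul_diff (contraction f) \<tau> m' = 0"
    proof (cases "sel \<tau> m'")
      case None
      have e: "{p. p \<notin> \<tau> \<and> 0 < lookup m' p} = {}" using crit[OF _ _ None] M by force
      have "koszul_diff (contraction f) \<tau> m' = 0" unfolding koszul_diff_def e by simp
      then show ?thesis using crit0[OF \<tau> None] by simp
    next
      case (Some p)
      have p: "p \<notin> \<tau>" "0 < lookup m' p"
        using fr Some pull[OF _ _ Some] M by (auto simp: free_pair_def)
      have pos: "k0 < mdeg m'" using p mdeg_eq_0_iff[of m'] M by (cases "mdeg m'") auto
      have "koszul_diff (contraction f) \<tau> m' = (\<Sum>r | r \<notin> \<tau> \<and> 0 < lookup m' r. if r = p then f \<tau> m' else 0)"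
        unfolding koszul_diff_def
      proof (rule sum.cong[OF refl])
        fix r assume r: "r \<in> {r. r \<notin> \<tau> \<and> 0 < lookup m' r}"
        then have s: "sel (insert r \<tau>) (m' - var_mon r) = Some p"
          using sel_minus(1)[of m' r \<tau>] pos M Some by auto
        show "koszul_sign r \<tau> * contraction f (insert r \<tau>) (m' - var_mon r) = (if r = p then f \<tau> m' else 0)"
        proof (cases "r = p")
          case True
          then show ?thesis using s p minus_var_mon_add[of m' p]
            by (simp add: contraction_def free_pair_def Let_def)
        next
          case False
          then show ?thesis using s p by (simp add: contraction_def free_pair_def)
        qed
      qed
      then show ?thesis using p by simp
    qed
  qed (use M \<tau> in auto)
  then show ?thesis by simp
qed

end

definition first_elem :: "'p::finite set \<Rightarrow> 'p option" where
  "first_elem S = (if S = {} then None else Some (arg_min_on to_nat S))"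

lemma first_elem_None [simp]: "first_elem S = None \<longleftrightarrow> S = {}"
  by (simp add: first_elem_def)

lemma first_elem_empty [simp]: "first_elem {} = None"
  by simp

lemma first_elem_Some: "first_elem S = Some p \<Longrightarrow> p \<in> S"
  by (auto simp: first_elem_def split: if_splits intro: arg_min_if_finite(1))

lemma keys_add_var_mon: "keys (m + var_mon r) = insert r (keys m)"
  by (auto simp: in_keys_iff lookup_add split: if_splits)

text \<open>
  In the polynomial ring the only unmatched pair is \<open>({}, 0)\<close>; hence the Koszul complex has no homology besides
  the field \<open>K\<close> in homological degree zero.
\<close>
interpretation full_ring: koszul_matching UNIV 0 "\<lambda>\<tau> m. first_elem (\<tau> \<union> keys m)"
  by unfold_locales (auto dest: first_elem_Some simp: keys_add_var_mon in_keys_iff)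


section \<open>The Koszul complex is a resolution\<close>

text \<open>
  Sets of points are coded as natural numbers, since the bases of a complex consist of natural numbers.
\<close>
definition koszul :: "('p::finite, 'k::field) aug_complex" where
  "koszul = \<lparr>basis = (\<lambda>i. to_nat ` {\<tau> :: 'p set. card \<tau> = i}), bdeg = (\<lambda>i b. int i),
     entry = (\<lambda>i r b. \<Sum>p | p \<notin> (from_nat r :: 'p set) \<and> from_nat b = insert p (from_nat r).
        const_poly (koszul_sign p (from_nat r)) * poly_var p),
     aug = (\<lambda>b. 1)\<rparr>"

definition coord :: "(nat \<Rightarrow> ('p::finite, 'k::zero) mpoly) \<Rightarrow> 'p set \<Rightarrow> ('p \<Rightarrow>\<^sub>0 nat) \<Rightarrow> 'k" where
  "coord v \<tau> m = lookup (v (to_nat \<tau>)) m"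

lemma basis_koszul: "basis (koszul :: ('p::finite, 'k::field) aug_complex) i = to_nat ` {\<tau> :: 'p set. card \<tau> = i}"
  by (simp add: koszul_def)

lemma bdeg_koszul [simp]: "bdeg koszul i b = int i"
  by (simp add: koszul_def)

abbreviation koszul_module :: "nat \<Rightarrow> (nat \<Rightarrow> ('p::finite, 'k::field) mpoly) set" where
  "koszul_module i \<equiv> free_module (basis (koszul :: ('p, 'k) aug_complex) i)"

lemma koszul_vec_eqI:
  fixes u v :: "nat \<Rightarrow> ('p::finite, 'k::field) mpoly"
  assumes "u \<in> koszul_module i" "v \<in> koszul_module i"
    and "\<And>\<tau> m. card \<tau> = i \<Longrightarrow> coord u \<tau> m = coord v \<tau> m"
  shows "u = v"
proof
  fix b
  show "u b = v b"
  proof (cases "b \<in> basis (koszul :: ('p, 'k) aug_complex) i")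
    case True
    then obtain \<tau> :: "'p set" where "b = to_nat \<tau>" "card \<tau> = i" by (auto simp: basis_koszul)
    then show ?thesis using assms(3)[of \<tau>] by (auto simp: coord_def intro: poly_mapping_eqI)
  next
    case False
    then show ?thesis using assms(1,2) by (simp add: free_module_def)
  qed
qed

lemma coord_bdry_koszul:
  fixes v :: "nat \<Rightarrow> ('p::finite, 'k::field) mpoly"
  assumes "Suc (card \<rho>) = i"
  shows "coord (bdry koszul i v) \<rho> n = koszul_diff (coord v) \<rho> n"
proof -
  have inj: "inj_on to_nat {\<tau> :: 'p set. card \<tau> = i}" by (rule inj_on_subset[OF inj_to_nat]) auto
  have \<rho>: "to_nat \<rho> \<in> basis (koszul :: ('p, 'k) aug_complex) (i - 1)" "i \<noteq> 0"
    using assms by (auto simp: basis_koszul)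
  have "bdry koszul i v (to_nat \<rho>) = (\<Sum>\<tau> :: 'p set | card \<tau> = i. entry koszul i (to_nat \<rho>) (to_nat \<tau>) * v (to_nat \<tau>))"
    using \<rho> by (simp add: bdry_def) (simp add: basis_koszul sum.reindex[OF inj] o_def)
  also have "\<dots> = (\<Sum>\<tau> :: 'p set | card \<tau> = i. \<Sum>p | p \<notin> \<rho> \<and> \<tau> = insert p \<rho>. const_poly (koszul_sign p \<rho>) * (poly_var p * v (to_nat \<tau>)))"
    by (simp only: koszul_def aug_complex.simps from_nat_to_nat sum_distrib_right mult.assoc)
  also have "\<dots> = (\<Sum>p | p \<notin> \<rho>. \<Sum>\<tau> | card \<tau> = i \<and> \<tau> = insert p \<rho>. const_poly (koszul_sign p \<rho>) * (poly_var p * v (to_nat \<tau>)))"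
  proof (subst sum.Sigma, force, force, subst sum.Sigma, force, force,
      rule sum.reindex_bij_witness[where i = prod.swap and j = prod.swap])
  qed auto
  also have "\<dots> = (\<Sum>p | p \<notin> \<rho>. const_poly (koszul_sign p \<rho>) * (poly_var p * v (to_nat (insert p \<rho>))))"
  proof (rule sum.cong[OF refl])
    fix p assume "p \<in> {p. p \<notin> \<rho>}"
    then have "{\<tau>. card \<tau> = i \<and> \<tau> = insert p \<rho>} = {insert p \<rho>}" using assms by auto
    then show "(\<Sum>\<tau> | card \<tau> = i \<and> \<tau> = insert p \<rho>. const_poly (koszul_sign p \<rho>) * (poly_var p * v (to_nat \<tau>))) =
      const_poly (koszul_sign p \<rho>) * (poly_var p * v (to_nat (insert p \<rho>)))" by simp
  qed
  finally have eq: "bdry koszul i v (to_nat \<rho>) =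
      (\<Sum>p | p \<notin> \<rho>. const_poly (koszul_sign p \<rho>) * (poly_var p * v (to_nat (insert p \<rho>))))" .
  have "coord (bdry koszul i v) \<rho> n = (\<Sum>p | p \<notin> \<rho>. if 0 < lookup n p
      then koszul_sign p \<rho> * coord v (insert p \<rho>) (n - var_mon p) else 0)"
    unfolding coord_def eq lookup_sum lookup_const_mult lookup_poly_var_mult
    by (intro sum.cong refl) (simp split: if_split)
  also have "\<dots> = koszul_diff (coord v) \<rho> n"
    unfolding koszul_diff_def by (subst sum.inter_filter[symmetric]) (auto intro!: sum.cong)
  finally show ?thesis .
qed

lemma bdry_koszul_free: "bdry koszul (Suc i) v \<in> koszul_module i"
  by (simp add: free_module_def bdry_def)

definition koszul_vec :: "nat \<Rightarrow> ('p::finite set \<Rightarrow> ('p \<Rightarrow>\<^sub>0 nat) \<Rightarrow> 'k::field) \<Rightarrow> nat \<Rightarrow> ('p, 'k) mpoly" where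
  "koszul_vec i f b = (if b \<in> basis (koszul :: ('p, 'k) aug_complex) i then Abs_poly_mapping (f (from_nat b)) else 0)"

lemma koszul_vec_free: "koszul_vec i f \<in> koszul_module i"
  by (simp add: free_module_def koszul_vec_def)

lemma coord_koszul_vec:
  assumes "\<And>\<tau>. card \<tau> = i \<Longrightarrow> finite {m. f \<tau> m \<noteq> 0}"
  shows "coord (koszul_vec i f) \<tau> m = (if card \<tau> = i then f \<tau> m else 0)"
  using assms[of \<tau>] by (auto simp: coord_def koszul_vec_def basis_koszul)

text \<open>
  This makes the contraction of a vector of polynomials again a vector of polynomials.
\<close>
lemma finite_contraction_support:
  fixes f :: "'p::finite set \<Rightarrow> ('p \<Rightarrow>\<^sub>0 nat) \<Rightarrow> 'k::field"
  assumes "\<And>\<tau>. finite {m. f \<tau> m \<noteq> 0}"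
  shows "finite {m. full_ring.contraction f \<tau> m \<noteq> 0}"
proof -
  have "{m. full_ring.contraction f \<tau> m \<noteq> 0} \<subseteq> (\<Union>p\<in>\<tau>. (\<lambda>m. m - var_mon p) ` {m. f (\<tau> - {p}) m \<noteq> 0})"
  proof
    fix m assume "m \<in> {m. full_ring.contraction f \<tau> m \<noteq> 0}"
    then obtain p where "p \<in> \<tau>" "f (\<tau> - {p}) (m + var_mon p) \<noteq> 0"
      by (auto simp: full_ring.contraction_def full_ring.free_pair_def Let_def split: if_splits)
    moreover have "m = (m + var_mon p) - var_mon p" by simp
    ultimately show "m \<in> (\<Union>p\<in>\<tau>. (\<lambda>m. m - var_mon p) ` {m. f (\<tau> - {p}) m \<noteq> 0})" by blast
  qed
  moreover have "finite \<dots>" using assms by auto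
  ultimately show ?thesis using finite_subset by blast
qed

lemma koszul_cycle_is_boundary:
  fixes v :: "nat \<Rightarrow> ('p::finite, 'k::field) mpoly"
  assumes v: "v \<in> koszul_module i"
    and cyc: "\<And>\<rho> n. Suc (card \<rho>) = i \<Longrightarrow> koszul_diff (coord v) \<rho> n = 0"
    and crit: "i = 0 \<Longrightarrow> coord v {} 0 = 0"
  shows "v \<in> bdry koszul (Suc i) ` koszul_module (Suc i)"
proof -
  define w :: "nat \<Rightarrow> ('p, 'k) mpoly" where "w = koszul_vec (Suc i) (full_ring.contraction (coord v))"
  have cfw: "coord w \<tau> m = (if card \<tau> = Suc i then full_ring.contraction (coord v) \<tau> m else 0)" for \<tau> m
    unfolding w_def by (rule coord_koszul_vec) (auto intro!: finite_contraction_support simp: coord_def)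
  have "v = bdry koszul (Suc i) w"
  proof (rule koszul_vec_eqI[OF v bdry_koszul_free])
    fix \<tau> :: "'p set" and m assume \<tau>: "card \<tau> = i"
    have "coord v \<tau> m = koszul_diff (full_ring.contraction (coord v)) \<tau> m"
      by (rule full_ring.cycle_is_boundary[OF refl refl cyc _ \<tau>]) (use crit in auto)
    also have "\<dots> = koszul_diff (coord w) \<tau> m"
      using \<tau> by (intro koszul_diff_cong) (auto simp: cfw)
    also have "\<dots> = coord (bdry koszul (Suc i) w) \<tau> m"
      by (rule coord_bdry_koszul[symmetric]) (simp add: \<tau>)
    finally show "coord v \<tau> m = coord (bdry koszul (Suc i) w) \<tau> m" .
  qed
  then show ?thesis using koszul_vec_free unfolding w_def by blast
qed

lemma augmentation_koszul: "augmentation koszul v = coord (v :: nat \<Rightarrow> ('p::finite, 'k::field) mpoly) {} 0"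
proof -
  have "{\<tau> :: 'p set. card \<tau> = 0} = {{}}" by auto
  then have "basis (koszul :: ('p, 'k) aug_complex) 0 = {to_nat ({} :: 'p set)}" by (simp add: basis_koszul)
  then show ?thesis unfolding augmentation_def by (simp add: coord_def const_coeff_def) (simp add: koszul_def)
qed

text \<open>
  Multidegree by multidegree, the matching of the polynomial ring contracts the complex.
\<close>
lemma koszul_resolution: "graded_free_resolution (koszul :: ('p::finite, 'k::field) aug_complex)"
proof -
  have homog: "homogeneous (bdeg koszul i b - bdeg koszul (i - 1) r) (entry (koszul :: ('p, 'k) aug_complex) i r b)"
    if "1 \<le> i" for i r b
  proof -
    have "homogeneous 1 (const_poly c * poly_var p :: ('p, 'k) mpoly)" for c p
      using homogeneous_mult[OF homogeneous_const[of c], of 1 "poly_var p"]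
      by (auto simp: homogeneous_iff poly_var_def lookup_single when_def)
    then show ?thesis using that by (auto simp: koszul_def of_nat_diff intro!: homogeneous_sum)
  qed
  have exact: "{v \<in> koszul_module i. bdry koszul i v = 0} =
      bdry (koszul :: ('p, 'k) aug_complex) (i + 1) ` koszul_module (i + 1)" if i: "1 \<le> i" for i
  proof -
    obtain k where k: "i = Suc k" using i by (cases i) auto
    have "v \<in> bdry koszul (i + 1) ` koszul_module (i + 1)"
      if v: "v \<in> koszul_module i" "bdry koszul i v = (0 :: nat \<Rightarrow> ('p, 'k) mpoly)" for v
    proof -
      have "koszul_diff (coord v) \<rho> n = 0" if "Suc (card \<rho>) = i" for \<rho> n
        using coord_bdry_koszul[OF that, of v n] unfolding v(2) by (simp add: coord_def)
      then show ?thesis using koszul_cycle_is_boundary[OF v(1)] k by auto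
    qed
    moreover have "bdry koszul i (bdry koszul (i + 1) w) = 0" for w :: "nat \<Rightarrow> ('p, 'k) mpoly"
    proof (rule koszul_vec_eqI[where i = k])
      show "bdry koszul i (bdry koszul (i + 1) w) \<in> koszul_module k"
        unfolding k by (rule bdry_koszul_free)
      fix \<rho> :: "'p set" and n assume \<rho>: "card \<rho> = k"
      have "coord (bdry koszul i (bdry koszul (i + 1) w)) \<rho> n = koszul_diff (coord (bdry koszul (i + 1) w)) \<rho> n"
        using \<rho> k by (intro coord_bdry_koszul) simp
      also have "\<dots> = koszul_diff (koszul_diff (coord w)) \<rho> n"
        using \<rho> k by (intro koszul_diff_cong coord_bdry_koszul) auto
      finally show "coord (bdry koszul i (bdry koszul (i + 1) w)) \<rho> n = coord 0 \<rho> n"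
        by (simp add: koszul_diff_square coord_def)
    qed simp
    ultimately show ?thesis using bdry_koszul_free[of i] by auto
  qed
  have exact0: "{v \<in> koszul_module 0. augmentation koszul v = 0} =
      bdry (koszul :: ('p, 'k) aug_complex) 1 ` koszul_module 1"
  proof -
    have "v \<in> bdry koszul 1 ` koszul_module 1"
      if v: "v \<in> koszul_module 0" "augmentation koszul v = (0 :: 'k)" for v :: "nat \<Rightarrow> ('p, 'k) mpoly"
      using koszul_cycle_is_boundary[OF v(1)] v(2) by (simp add: augmentation_koszul)
    moreover have "augmentation koszul (bdry koszul 1 w) = 0" for w :: "nat \<Rightarrow> ('p, 'k) mpoly"
      unfolding augmentation_koszul by (subst coord_bdry_koszul) (auto simp: koszul_diff_def)
    ultimately show ?thesis using bdry_koszul_free[of 0] by auto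
  qed
  have surj: "c \<in> augmentation koszul ` (koszul_module 0 :: (nat \<Rightarrow> ('p, 'k) mpoly) set)" for c
  proof
    let ?f = "\<lambda>(\<tau> :: 'p set) (m :: 'p \<Rightarrow>\<^sub>0 nat). if m = 0 then c else (0 :: 'k)"
    show "c = augmentation koszul (koszul_vec 0 ?f :: nat \<Rightarrow> ('p, 'k) mpoly)"
      unfolding augmentation_koszul by (subst coord_koszul_vec) (auto simp: finite_subset[of _ "{0}"])
  qed (rule koszul_vec_free)
  show ?thesis unfolding graded_free_resolution_def
    using homog exact exact0 surj by (auto simp: basis_koszul)
qed

section \<open>Koszul homology of a monomial ideal\<close>

text \<open>
  If \<open>M\<close> is closed under divisors, this is the ideal generated by the monomials outside \<open>M\<close>, and \<open>M\<close> is a basis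
  of the quotient ring.
\<close>
definition complement_ideal :: "('p \<Rightarrow>\<^sub>0 nat) set \<Rightarrow> ('p, 'k::zero) mpoly set" where
  "complement_ideal M = {f. \<forall>m\<in>M. lookup f m = 0}"

definition koszul_pairs :: "nat \<Rightarrow> int \<Rightarrow> ('p::finite set \<times> ('p \<Rightarrow>\<^sub>0 nat)) set" where
  "koszul_pairs i j = {(\<tau>, m). card \<tau> = i \<and> int (mdeg m) = j - int i}"

abbreviation koszul_graded_vec where
  "koszul_graded_vec i j f \<equiv> koszul_vec i (\<lambda>\<tau> m. if int (mdeg m) = j - int i then f \<tau> m else 0)"

lemma coord_koszul_graded_vec:
  "coord (koszul_graded_vec i j f) \<tau>' m' =
    (if card \<tau>' = i \<and> int (mdeg m') = j - int i then f \<tau>' m' else 0)"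
  by (subst coord_koszul_vec) (auto intro: finite_subset[OF _ finite_monomials_of_degree[of "j - int i"]])

lemma finite_koszul_pairs: "finite (koszul_pairs i j)"
  unfolding koszul_pairs_def
  by (rule finite_subset[of _ "UNIV \<times> {m. int (mdeg m) = j - int i}"])
    (auto intro: finite_monomials_of_degree)

text \<open>
  The instance of \<open>basis_of_coordinates\<close> for subspaces of a graded piece of the Koszul complex. The dual basis
  is described by coefficient functions, which \<open>koszul_vec\<close> turns into vectors.
\<close>
lemma koszul_coordinates:
  fixes V :: "(nat \<Rightarrow> ('p::finite, 'k::field) mpoly) set"
  assumes V: "coords.subspace V" "V \<subseteq> graded_piece koszul i j"
    and X: "X \<subseteq> koszul_pairs i j"
    and inj: "\<And>v \<tau> m. v \<in> V \<Longrightarrow> (\<And>\<tau> m. (\<tau>, m) \<in> X \<Longrightarrow> coord v \<tau> m = 0) \<Longrightarrow>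
        card \<tau> = i \<Longrightarrow> int (mdeg m) = j - int i \<Longrightarrow> coord v \<tau> m = 0"
    and ex: "\<And>\<tau> m. (\<tau>, m) \<in> X \<Longrightarrow> \<exists>f. (\<forall>\<tau>' m'. (\<tau>', m') \<in> X \<longrightarrow> f \<tau>' m' = (if \<tau>' = \<tau> \<and> m' = m then 1 else 0)) \<and>
        koszul_graded_vec i j f \<in> V"
  shows "coords_dim V = card X"
proof -
  have finX: "finite X" using X finite_koszul_pairs by (rule finite_subset)
  note X = X[unfolded koszul_pairs_def]
  have inj': "v = 0" if v: "v \<in> V" and z: "\<And>x. x \<in> X \<Longrightarrow> (\<lambda>(\<tau>, m). coord v \<tau> m) x = 0" for v
  proof (rule koszul_vec_eqI[where i = i])
    have g: "v \<in> graded_piece koszul i j" using v V by blast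
    then show "v \<in> koszul_module i" by (rule graded_piece_free)
    fix \<tau> :: "'p set" and m assume \<tau>: "card \<tau> = i"
    show "coord v \<tau> m = coord 0 \<tau> m"
    proof (cases "int (mdeg m) = j - int i")
      case True
      then show ?thesis using inj[OF v _ \<tau> True] z by (force simp: coord_def)
    next
      case False
      have "to_nat \<tau> \<in> basis (koszul :: ('p, 'k) aug_complex) i" using \<tau> by (simp add: basis_koszul)
      then have "homogeneous (j - int i) (v (to_nat \<tau>))" using g by (auto simp: graded_piece_def)
      then show ?thesis using False by (auto simp: coord_def homogeneous_iff)
    qed
  qed simp
  have ex': "\<exists>e\<in>V. \<forall>y\<in>X. (\<lambda>(\<tau>, m). coord e \<tau> m) y = (if y = x then 1 else 0)" if x: "x \<in> X" for x
  proof -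
    obtain \<tau> m where xm: "x = (\<tau>, m)" by force
    obtain f where f: "\<And>\<tau>' m'. (\<tau>', m') \<in> X \<Longrightarrow> f \<tau>' m' = (if \<tau>' = \<tau> \<and> m' = m then 1 else 0)"
      "koszul_graded_vec i j f \<in> V"
      using ex[of \<tau> m] x xm by blast
    have *: "coord (koszul_graded_vec i j f) \<tau>' m' = (if \<tau>' = \<tau> \<and> m' = m then 1 else 0)"
      if "(\<tau>', m') \<in> X" for \<tau>' m'
      using that X by (auto simp only: coord_koszul_graded_vec f(1)[OF that] split: if_splits)
    show ?thesis
    proof (intro bexI[OF _ f(2)] ballI)
      fix y assume y: "y \<in> X"
      obtain \<tau>' m' where ym: "y = (\<tau>', m')" by force
      show "(\<lambda>(\<tau>, m). coord (koszul_graded_vec i j f) \<tau> m) y =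
          (if y = x then 1 else 0)"
        using *[of \<tau>' m'] y unfolding ym xm by simp
    qed
  qed
  show ?thesis
    by (rule coords.basis_of_coordinates[where V = V and X = X and c = "\<lambda>(\<tau>, m) v. coord v \<tau> m"])
      (use V(1) finX inj' ex' in \<open>auto simp: coord_def lookup_add case_prod_unfold\<close>)
qed


lemma subspace_complement_ideal:
  assumes down: "\<And>m r. m + r \<in> M \<Longrightarrow> m \<in> M"
  shows "ring_module.subspace (complement_ideal M :: ('p, 'k::comm_ring_1) mpoly set)"
proof (rule ring_module.subspaceI)
  fix c f :: "('p, 'k) mpoly" assume f: "f \<in> complement_ideal M"
  have "lookup (c * f) m = 0" if "m \<in> M" for m
  proof (rule ccontr)
    assume "lookup (c * f) m \<noteq> 0"
    then obtain x y where "m = x + y" "lookup f y \<noteq> 0"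
      using keys_mult[of c f] by (auto simp: in_keys_iff)
    then show False using f down[of y x] that by (auto simp: complement_ideal_def add.commute)
  qed
  then show "c * f \<in> complement_ideal M" by (simp add: complement_ideal_def)
qed (auto simp: complement_ideal_def lookup_add)

lemma subspace_graded_piece: "coords.subspace (graded_piece F i j)"
  by (rule coords.subspaceI) (auto intro: graded_piece_add graded_piece_scale)

lemma koszul_vec_graded:
  fixes f :: "'p::finite set \<Rightarrow> ('p \<Rightarrow>\<^sub>0 nat) \<Rightarrow> 'k::field"
  shows
  "koszul_graded_vec i j f
    \<in> graded_piece (koszul :: ('p::finite, 'k::field) aug_complex) i j"
proof -
  let ?v = "koszul_graded_vec i j f :: nat \<Rightarrow> ('p, 'k) mpoly"
  have homog: "homogeneous (j - int i) (?v b)" if b: "b \<in> basis (koszul :: ('p, 'k) aug_complex) i" for b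
  proof -
    obtain \<tau> :: "'p set" where \<tau>: "b = to_nat \<tau>" using b by (auto simp: basis_koszul)
    have "lookup (?v b) m = coord ?v \<tau> m" for m by (simp add: coord_def \<tau>)
    then show ?thesis unfolding homogeneous_iff by (auto simp: coord_koszul_graded_vec split: if_splits)
  qed
  show ?thesis using homog by (simp add: graded_piece_def koszul_vec_free)
qed

lemma dim_graded_piece_koszul:
  "coords_dim (graded_piece (koszul :: ('p::finite, 'k::field) aug_complex) i j) =
     card (koszul_pairs i j :: ('p set \<times> _) set)"
proof (rule koszul_coordinates[OF subspace_graded_piece subset_refl])
  fix \<tau> :: "'p set" and m
  show "\<exists>f. (\<forall>\<tau>' m'. (\<tau>', m') \<in> koszul_pairs i j \<longrightarrow> f \<tau>' m' = (if \<tau>' = \<tau> \<and> m' = m then 1 else (0::'k))) \<and>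
        koszul_graded_vec i j f \<in> graded_piece koszul i j"
    by (rule exI[of _ "\<lambda>\<tau>' m'. if \<tau>' = \<tau> \<and> m' = m then 1 else 0"]) (simp add: koszul_vec_graded)
qed (auto simp: koszul_pairs_def)

lemma subspace_tor_ideal_part:
  assumes I: "ring_module.subspace I"
  shows "coords.subspace {v \<in> graded_piece F i j. \<forall>b. v b \<in> I}"
  by (rule coords.subspaceI)
    (auto intro: graded_piece_add graded_piece_scale
      ring_module.subspace_add[OF I] ring_module.subspace_scale[OF I] ring_module.subspace_0[OF I])

lemma complement_ideal_vec_iff:
  assumes "v \<in> (koszul_module i :: (nat \<Rightarrow> ('p::finite, 'k::field) mpoly) set)"
  shows "(\<forall>b. v b \<in> complement_ideal M) \<longleftrightarrow> (\<forall>\<tau> m. card \<tau> = i \<longrightarrow> m \<in> M \<longrightarrow> coord v \<tau> m = 0)"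
proof
  assume *: "\<forall>\<tau> m. card \<tau> = i \<longrightarrow> m \<in> M \<longrightarrow> coord v \<tau> m = 0"
  show "\<forall>b. v b \<in> complement_ideal M"
  proof
    fix b
    show "v b \<in> complement_ideal M"
    proof (cases "b \<in> basis (koszul :: ('p, 'k) aug_complex) i")
      case True
      then obtain \<tau> :: "'p set" where "b = to_nat \<tau>" "card \<tau> = i" by (auto simp: basis_koszul)
      then show ?thesis using * by (simp add: complement_ideal_def coord_def)
    next
      case False
      then have "v b = 0" using assms by (simp add: free_module_def)
      then show ?thesis by (simp add: complement_ideal_def)
    qed
  qed
qed (auto simp: complement_ideal_def coord_def)

lemma dim_ideal_part_koszul:
  assumes I: "ring_module.subspace (complement_ideal M :: ('p::finite, 'k::field) mpoly set)"
  shows "coords_dim {v \<in> graded_piece koszul i j. \<forall>b. v b \<in> (complement_ideal M :: ('p, 'k) mpoly set)} =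
     card {(\<tau>, m) \<in> koszul_pairs i j. m \<notin> M}"
proof (rule koszul_coordinates[OF subspace_tor_ideal_part[OF I]])
  fix \<tau> :: "'p set" and m
  assume m: "(\<tau>, m) \<in> {(\<tau>, m) \<in> koszul_pairs i j. m \<notin> M}"
  let ?f = "\<lambda>\<tau>' m'. if \<tau>' = \<tau> \<and> m' = m then 1 else (0::'k)"
  let ?v = "koszul_graded_vec i j ?f"
  have "\<forall>b. ?v b \<in> complement_ideal M"
    unfolding complement_ideal_vec_iff[OF koszul_vec_free] coord_koszul_graded_vec using m by auto
  then show "\<exists>f. (\<forall>\<tau>' m'. (\<tau>', m') \<in> {(\<tau>, m) \<in> koszul_pairs i j. m \<notin> M} \<longrightarrow>
         f \<tau>' m' = (if \<tau>' = \<tau> \<and> m' = m then 1 else (0::'k))) \<and>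
        koszul_graded_vec i j f
          \<in> {v \<in> graded_piece koszul i j. \<forall>b. v b \<in> complement_ideal M}"
    by (intro exI[of _ ?f]) (simp add: koszul_vec_graded)
next
  fix v and \<tau> :: "'p set" and m :: "'p \<Rightarrow>\<^sub>0 nat"
  assume v: "v \<in> {v \<in> graded_piece koszul i j. \<forall>b. v b \<in> (complement_ideal M :: ('p, 'k) mpoly set)}"
    and z: "\<And>\<tau> m. (\<tau>, m) \<in> {(\<tau>, m). (\<tau>, m) \<in> koszul_pairs i j \<and> m \<notin> M} \<Longrightarrow> coord v \<tau> m = 0"
    and *: "card \<tau> = i" "int (mdeg m) = j - int i"
  then show "coord v \<tau> m = 0"
    by (cases "m \<in> M") (auto simp: koszul_pairs_def coord_def complement_ideal_def)
qed (auto simp: koszul_pairs_def)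

lemma koszul_diff_graded:
  assumes v: "v \<in> graded_piece (koszul :: ('p::finite, 'k::field) aug_complex) i j"
    and \<rho>: "Suc (card \<rho>) = i" and n: "int (mdeg n) \<noteq> j - int i + 1"
  shows "koszul_diff (coord v) \<rho> n = 0"
proof -
  have "coord v (insert p \<rho>) (n - var_mon p) = 0" if "p \<notin> \<rho>" "0 < lookup n p" for p
  proof -
    have "mdeg n = mdeg (n - var_mon p) + 1"
      using minus_var_mon_add[OF that(2)] mdeg_add[of "n - var_mon p" "var_mon p"] by simp
    then have "int (mdeg (n - var_mon p)) \<noteq> j - int i" using n by simp
    moreover have "to_nat (insert p \<rho>) \<in> basis (koszul :: ('p, 'k) aug_complex) i"
      using \<rho> that by (auto simp: basis_koszul)
    then have "homogeneous (j - int i) (v (to_nat (insert p \<rho>)))" using v by (auto simp: graded_piece_def)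
    ultimately show ?thesis unfolding homogeneous_iff coord_def by blast
  qed
  then show ?thesis unfolding koszul_diff_def by (intro sum.neutral) auto
qed

lemma tor_cycles_koszul_iff:
  assumes I: "ring_module.subspace (complement_ideal M :: ('p::finite, 'k::field) mpoly set)"
  shows "v \<in> tor_cycles koszul (complement_ideal M :: ('p, 'k) mpoly set) i j \<longleftrightarrow>
    v \<in> graded_piece koszul i j \<and>
    (\<forall>\<rho> n. Suc (card \<rho>) = i \<longrightarrow> n \<in> M \<longrightarrow> int (mdeg n) = j - int i + 1 \<longrightarrow> koszul_diff (coord v) \<rho> n = 0)"
proof (cases i)
  case 0
  then show ?thesis using ring_module.subspace_0[OF I]
    by (auto simp: tor_cycles_def bdry_zero_index)
next
  case (Suc k)
  have "(\<forall>b. bdry koszul i v b \<in> (complement_ideal M :: ('p, 'k) mpoly set)) \<longleftrightarrow>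
    (\<forall>\<rho> n. card \<rho> = k \<longrightarrow> n \<in> M \<longrightarrow> coord (bdry koszul i v) \<rho> n = 0)"
    unfolding Suc by (rule complement_ideal_vec_iff[OF bdry_koszul_free])
  also have "\<dots> \<longleftrightarrow> (\<forall>\<rho> n. Suc (card \<rho>) = i \<longrightarrow> n \<in> M \<longrightarrow> koszul_diff (coord v) \<rho> n = 0)"
    using Suc by (auto simp: coord_bdry_koszul)
  finally have "v \<in> tor_cycles koszul (complement_ideal M :: ('p, 'k) mpoly set) i j \<longleftrightarrow>
    v \<in> graded_piece koszul i j \<and> (\<forall>\<rho> n. Suc (card \<rho>) = i \<longrightarrow> n \<in> M \<longrightarrow> koszul_diff (coord v) \<rho> n = 0)"
    by (simp add: tor_cycles_def)
  then show ?thesis using koszul_diff_graded[of v i j] by blast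
qed

text \<open>
  A cycle modulo the ideal is arbitrary on the monomials of the ideal; on the remaining pairs it is determined by
  its values on the free ones, and these can be prescribed.
\<close>
lemma (in koszul_matching) dim_tor_cycles_koszul:
  assumes I: "ring_module.subspace (complement_ideal M :: ('p, 'k::field) mpoly set)"
    and d: "int k0 \<le> j - int i"
  shows "coords_dim (tor_cycles koszul (complement_ideal M :: ('p, 'k) mpoly set) i j) =
     card {(\<tau>, m) \<in> koszul_pairs i j. m \<in> M \<and> free_pair \<tau> m} + card {(\<tau>, m) \<in> koszul_pairs i j. m \<notin> M}"
proof -
  let ?I = "complement_ideal M :: ('p, 'k) mpoly set"
  let ?X = "{(\<tau>, m) \<in> koszul_pairs i j. m \<notin> M \<or> free_pair \<tau> m}"
  obtain d' where d': "j - int i = int d'" "k0 \<le> d'" using d by (metis nat_int zero_le_imp_eq_int of_nat_0_le_iff order_trans nat_mono)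
  have "coords_dim (tor_cycles koszul ?I i j) = card ?X"
  proof (rule koszul_coordinates[OF subspace_tor_cycles[OF koszul_resolution I]])
    fix \<tau> m assume "(\<tau>, m) \<in> ?X"
    let ?\<delta> = "\<lambda>\<tau>' m'. if \<tau>' = \<tau> \<and> m' = m then 1 else (0::'k)"
    let ?v = "koszul_graded_vec i j (extend_free ?\<delta>)"
    have "koszul_diff (coord ?v) \<rho> n = 0" if \<rho>: "Suc (card \<rho>) = i" and n: "n \<in> M" "int (mdeg n) = j - int i + 1" for \<rho> n
    proof -
      have "koszul_diff (coord ?v) \<rho> n = koszul_diff (extend_free ?\<delta>) \<rho> n"
      proof (rule koszul_diff_cong)
        fix p assume p: "p \<notin> \<rho>" "0 < lookup n p"
        have "mdeg n = mdeg (n - var_mon p) + 1"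
          using minus_var_mon_add[OF p(2)] mdeg_add[of "n - var_mon p" "var_mon p"] by simp
        then show "coord ?v (insert p \<rho>) (n - var_mon p) = extend_free ?\<delta> (insert p \<rho>) (n - var_mon p)"
          unfolding coord_koszul_graded_vec using p \<rho> n by simp
      qed
      also have "\<dots> = 0" using n d' by (intro koszul_diff_extend_free) auto
      finally show ?thesis .
    qed
    then have "?v \<in> tor_cycles koszul ?I i j"
      unfolding tor_cycles_koszul_iff[OF I] using koszul_vec_graded by blast
    then show "\<exists>f. (\<forall>\<tau>' m'. (\<tau>', m') \<in> ?X \<longrightarrow> f \<tau>' m' = (if \<tau>' = \<tau> \<and> m' = m then 1 else (0::'k))) \<and>
        koszul_graded_vec i j f \<in> tor_cycles koszul ?I i j"
      by (intro exI[of _ "extend_free ?\<delta>"]) (auto simp: extend_free_def)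
  next
    fix v and \<tau> :: "'p set" and m :: "'p \<Rightarrow>\<^sub>0 nat"
    assume v: "v \<in> tor_cycles koszul ?I i j"
      and z: "\<And>\<tau> m. (\<tau>, m) \<in> ?X \<Longrightarrow> coord v \<tau> m = 0" and *: "card \<tau> = i" "int (mdeg m) = j - int i"
    show "coord v \<tau> m = 0"
    proof (cases "m \<in> M")
      case True
      show ?thesis
      proof (rule cycle_zero_if_zero_on_free[where f = "coord v" and i = i and d = d'])
        fix \<rho> :: "'p set" and n assume "Suc (card \<rho>) = i" "n \<in> M" "mdeg n = Suc d'"
        then show "koszul_diff (coord v) \<rho> n = 0" using v d' unfolding tor_cycles_koszul_iff[OF I] by auto
      next
        fix \<tau>' :: "'p set" and m' assume "card \<tau>' = i" "m' \<in> M" "mdeg m' = d'" "free_pair \<tau>' m'"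
        then show "coord v \<tau>' m' = 0" using d' by (intro z) (simp add: koszul_pairs_def)
      qed (use True * d' in auto)
    next
      case False
      then show ?thesis using * by (intro z) (simp add: koszul_pairs_def)
    qed
  qed (auto simp: tor_cycles_def koszul_pairs_def)
  also have "?X = {(\<tau>, m) \<in> koszul_pairs i j. m \<in> M \<and> free_pair \<tau> m} \<union> {(\<tau>, m) \<in> koszul_pairs i j. m \<notin> M}"
    by auto
  also have "card \<dots> = card {(\<tau>, m) \<in> koszul_pairs i j. m \<in> M \<and> free_pair \<tau> m} + card {(\<tau>, m) \<in> koszul_pairs i j. m \<notin> M}"
    by (intro card_Un_disjoint) (auto intro: finite_subset[OF _ finite_koszul_pairs])
  finally show ?thesis .
qed

text \<open>
  Rank-nullity for the boundary map from homological degree \<open>i + 1\<close>, taken modulo the ideal: its kernel is the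
  space of cycles.
\<close>
lemma dim_tor_boundaries_koszul:
  assumes I: "ring_module.subspace (complement_ideal M :: ('p::finite, 'k::field) mpoly set)"
  shows "coords_dim (tor_boundaries koszul (complement_ideal M :: ('p, 'k) mpoly set) i j)
      + coords_dim (tor_cycles koszul (complement_ideal M :: ('p, 'k) mpoly set) (Suc i) j)
      = card (koszul_pairs (Suc i) j :: ('p set \<times> _) set) + card {(\<tau>, m) \<in> koszul_pairs i j. m \<notin> M}"
proof -
  let ?I = "complement_ideal M :: ('p, 'k) mpoly set"
  let ?K = "koszul :: ('p, 'k) aug_complex"
  let ?N = "{v \<in> graded_piece ?K i j. \<forall>b. v b \<in> ?I}"
  obtain E where E: "finite E" "graded_piece ?K (Suc i) j \<subseteq> coords.span E"
    by (rule graded_piece_basis[OF resolution_finite[OF koszul_resolution]])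
  obtain E' where E': "finite E'" "graded_piece ?K i j \<subseteq> coords.span E'"
    by (rule graded_piece_basis[OF resolution_finite[OF koszul_resolution]])
  have g: "bdry ?K (Suc i) w \<in> graded_piece ?K i j" if "w \<in> graded_piece ?K (Suc i) j" for w
    using bdry_graded[OF koszul_resolution that] by simp
  have "{v. \<exists>w\<in>graded_piece ?K (Suc i) j. v - bdry ?K (Suc i) w \<in> ?N} = tor_boundaries ?K ?I i j"
  proof (intro equalityI subsetI)
    fix v assume "v \<in> {v. \<exists>w\<in>graded_piece ?K (Suc i) j. v - bdry ?K (Suc i) w \<in> ?N}"
    then obtain w where w: "w \<in> graded_piece ?K (Suc i) j" "v - bdry ?K (Suc i) w \<in> ?N" by blast
    have "(v - bdry ?K (Suc i) w) + bdry ?K (Suc i) w \<in> graded_piece ?K i j"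
      using w g[OF w(1)] by (intro graded_piece_add) auto
    then show "v \<in> tor_boundaries ?K ?I i j" using w by (auto simp: tor_boundaries_def)
  next
    fix v assume "v \<in> tor_boundaries ?K ?I i j"
    then show "v \<in> {v. \<exists>w\<in>graded_piece ?K (Suc i) j. v - bdry ?K (Suc i) w \<in> ?N}"
      using g graded_piece_diff by (fastforce simp: tor_boundaries_def)
  qed
  moreover have "{w \<in> graded_piece ?K (Suc i) j. bdry ?K (Suc i) w \<in> ?N} = tor_cycles ?K ?I (Suc i) j"
    using g by (auto simp: tor_cycles_def)
  moreover have "coords_dim {v. \<exists>w\<in>graded_piece ?K (Suc i) j. v - bdry ?K (Suc i) w \<in> ?N} +
      coords_dim {w \<in> graded_piece ?K (Suc i) j. bdry ?K (Suc i) w \<in> ?N} =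
      coords_dim (graded_piece ?K (Suc i) j) + coords_dim ?N"
    by (rule coords.dim_image_plus_kernel_modulo[OF subspace_graded_piece subspace_tor_ideal_part[OF I] E E'(1)])
      (use E' in \<open>auto simp: bdry_add bdry_smult\<close>)
  ultimately show ?thesis
    by (simp only: dim_graded_piece_koszul dim_ideal_part_koszul[OF I])
qed

text \<open>
  Internal degree \<open>j\<close> means degree \<open>j - i\<close> in the quotient ring at the homological degree \<open>i\<close>, but \<open>j - i - 1\<close> at
  \<open>i + 1\<close>. The dimensions \<open>z\<close> of the cycles modulo the ideal enter as hypotheses because in these two
  degrees they may come from different matchings.
\<close>
lemma betti_monomial_ideal:
  fixes z :: "nat \<Rightarrow> int"
  assumes down: "\<And>m r. m + r \<in> M \<Longrightarrow> m \<in> M"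
    and z: "\<And>k. k = i \<or> k = Suc i \<Longrightarrow> 
       int (coords_dim (tor_cycles koszul (complement_ideal M :: ('p::finite, 'k::field) mpoly set) k j))
        = z k + int (card {(\<tau>, m) \<in> koszul_pairs k j. m \<notin> M})"
  shows "int (betti (complement_ideal M :: ('p, 'k) mpoly set) i j) =
     z i + z (Suc i) - int (card {(\<tau>, m) \<in> koszul_pairs (Suc i) j. m \<in> M})"
proof -
  let ?I = "complement_ideal M :: ('p, 'k) mpoly set"
  let ?K = "koszul :: ('p, 'k) aug_complex"
  have I: "ring_module.subspace ?I" by (rule subspace_complement_ideal) (rule down)
  define F where "F = (SOME F :: ('p, 'k) aug_complex. graded_free_resolution F)"
  have F: "graded_free_resolution F" unfolding F_def by (rule someI) (rule koszul_resolution)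
  have "betti ?I i j = coords_dim (tor_cycles ?K ?I i j) - coords_dim (tor_boundaries ?K ?I i j)"
    unfolding betti_def Let_def F_def[symmetric] by (rule tor_dim_unique[OF F koszul_resolution I])
  moreover have "coords_dim (tor_boundaries ?K ?I i j) \<le> coords_dim (tor_cycles ?K ?I i j)"
  proof -
    obtain E where E: "finite E" "graded_piece ?K i j \<subseteq> coords.span E"
      by (rule graded_piece_basis[OF resolution_finite[OF koszul_resolution]])
    have "tor_cycles ?K ?I i j \<subseteq> coords.span E" using E by (auto simp: tor_cycles_def)
    then show ?thesis
      by (rule coords.dim_mono_finite[OF tor_boundaries_subset[OF koszul_resolution I] E(1)])
  qed
  moreover note dim_tor_boundaries_koszul[OF I, of i j]
  moreover have "card (koszul_pairs (Suc i) j :: ('p set \<times> _) set) =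
    card {(\<tau>, m) \<in> koszul_pairs (Suc i) j. m \<in> M} +
    card {(\<tau>, m) \<in> koszul_pairs (Suc i) j. m \<notin> M}"
    by (subst card_Un_disjoint[symmetric])
      (auto intro: finite_subset[OF _ finite_koszul_pairs] intro!: arg_cong[where f = card])
  ultimately show ?thesis using z[of i] z[of "Suc i"] by simp
qed

section \<open>Squarefree monomials and simplicial complexes\<close>

definition mono_of :: "'p::finite set \<Rightarrow> 'p \<Rightarrow>\<^sub>0 nat" where
  "mono_of \<sigma> = (\<Sum>p\<in>\<sigma>. var_mon p)"

lemma lookup_mono_of [simp]: "lookup (mono_of \<sigma>) p = (if p \<in> \<sigma> then 1 else 0)"
  by (simp add: mono_of_def lookup_sum)

lemma poly_var_eq: "poly_var p = Poly_Mapping.single (var_mon p) 1"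
  by (simp add: poly_var_def var_mon_def)

lemma keys_mono_of [simp]: "keys (mono_of \<sigma>) = \<sigma>"
  by (auto simp: in_keys_iff split: if_splits)

lemma mdeg_mono_of [simp]: "mdeg (mono_of \<sigma>) = card \<sigma>"
  by (simp add: mdeg_def sum.If_cases)

lemma inj_mono_of: "inj mono_of"
  by (rule injI) (metis keys_mono_of)

definition face_monomials :: "'p::finite set set \<Rightarrow> ('p \<Rightarrow>\<^sub>0 nat) set" where
  "face_monomials \<Lambda> = mono_of ` \<Lambda>"

lemma face_monomials_iff:
  "m \<in> face_monomials \<Lambda> \<longleftrightarrow> (\<forall>p. lookup m p \<le> 1) \<and> keys m \<in> \<Lambda>"
proof
  assume *: "(\<forall>p. lookup m p \<le> 1) \<and> keys m \<in> \<Lambda>"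
  have "m = mono_of (keys m)"
  proof (rule poly_mapping_eqI)
    fix p
    show "lookup m p = lookup (mono_of (keys m)) p"
      using * le_antisym[of "lookup m p" 1] by (auto simp: in_keys_iff)
  qed
  then show "m \<in> face_monomials \<Lambda>" using * unfolding face_monomials_def by blast
qed (auto simp: face_monomials_def)

lemma face_monomials_down:
  fixes \<Gamma> :: "'p::finite set set"
  assumes down: "\<And>\<sigma> \<tau>. \<sigma> \<in> \<Gamma> \<Longrightarrow> \<tau> \<subseteq> \<sigma> \<Longrightarrow> \<tau> \<in> \<Gamma>" and m: "m + r \<in> face_monomials \<Gamma>"
  shows "m \<in> face_monomials \<Gamma>"
proof -
  have "lookup m p \<le> lookup (m + r) p" for p by (simp add: lookup_add)
  moreover have "keys m \<subseteq> keys (m + r)" by (auto simp: in_keys_iff lookup_add)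
  ultimately show ?thesis using m down unfolding face_monomials_iff by (meson order_trans)
qed

lemma mdeg_face_monomial: "m \<in> face_monomials \<Lambda> \<Longrightarrow> mdeg m = card (keys m)"
  by (auto simp: face_monomials_def)

lemma prod_poly_var: "(\<Prod>p\<in>\<sigma>. poly_var p) = Poly_Mapping.single (mono_of \<sigma>) 1"
proof -
  have "finite \<sigma>" by simp
  then show ?thesis
    by (induction \<sigma> rule: finite_induct)
      (simp_all add: mono_of_def poly_var_eq mult_single)
qed

lemma poly_mapping_sum_singles:
  "f = (\<Sum>m\<in>keys f. Poly_Mapping.single m (lookup f m))"
  by (rule poly_mapping_eqI) (auto simp: lookup_sum lookup_single when_def in_keys_iff)

text \<open>
  A monomial that is not squarefree is divisible by the square of a variable; a squarefree one is the product of
  the variables in its support.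
\<close>
lemma monomial_ideal_eq:
  assumes down: "\<And>\<sigma> \<tau>. \<sigma> \<in> \<Lambda> \<Longrightarrow> \<tau> \<subseteq> \<sigma> \<Longrightarrow> \<tau> \<in> \<Lambda>"
  shows "stanley_reisner_ideal \<Lambda> + squares_ideal =
    (complement_ideal (face_monomials \<Lambda>) :: ('p::finite, 'k::field) mpoly set)"
proof -
  let ?M = "face_monomials \<Lambda>" and ?I = "complement_ideal (face_monomials \<Lambda>) :: ('p, 'k) mpoly set"
  let ?SR = "stanley_reisner_ideal \<Lambda> :: ('p, 'k) mpoly set" and ?Sq = "squares_ideal :: ('p, 'k) mpoly set"
  have I: "ring_module.subspace ?I"
    by (rule subspace_complement_ideal) (rule face_monomials_down[OF down])
  have SRs: "ring_module.subspace ?SR" and Sqs: "ring_module.subspace ?Sq"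
    by (auto simp: stanley_reisner_ideal_def squares_ideal_def)
  have "?SR \<subseteq> ?I"
    unfolding stanley_reisner_ideal_def
    by (rule ring_module.span_minimal[OF _ I])
      (auto simp: prod_poly_var complement_ideal_def lookup_single when_def face_monomials_iff)
  moreover have "poly_var p ^ 2 \<in> ?I" for p
    by (auto simp: poly_var_eq power2_eq_square mult_single complement_ideal_def
        lookup_single when_def face_monomials_iff lookup_add dest!: spec[of _ p])
  then have "?Sq \<subseteq> ?I"
    unfolding squares_ideal_def by (intro ring_module.span_minimal[OF _ I]) auto
  ultimately have 1: "?SR + ?Sq \<subseteq> ?I"
    using ring_module.subspace_add[OF I] by (auto elim!: set_plus_elim)
  have "f \<in> ?SR + ?Sq" if f: "f \<in> ?I" for f
  proof -
    let ?K = "{m \<in> keys f. \<forall>p. lookup m p \<le> 1}"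
    let ?t = "\<lambda>m. Poly_Mapping.single m (lookup f m)"
    have "?t m \<in> ?SR" if m: "m \<in> ?K" for m
    proof -
      have "m \<notin> ?M" using f m by (auto simp: complement_ideal_def in_keys_iff)
      then have "keys m \<notin> \<Lambda>" using m unfolding face_monomials_iff by blast
      then have "Poly_Mapping.single (mono_of (keys m)) 1 \<in> ?SR"
        unfolding stanley_reisner_ideal_def by (intro ring_module.span_base) (auto simp: prod_poly_var)
      moreover have "m = 0 + mono_of (keys m)"
        using m face_monomials_iff[of m UNIV] by (auto simp: face_monomials_def)
      then have "?t m = Poly_Mapping.single 0 (lookup f m) * Poly_Mapping.single (mono_of (keys m)) 1"
        by (simp add: mult_single)
      ultimately show ?thesis using ring_module.subspace_scale[OF SRs] by simp
    qed
    then have "(\<Sum>m\<in>?K. ?t m) \<in> ?SR" by (rule ring_module.subspace_sum[OF SRs])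
    moreover have "?t m \<in> ?Sq" if m: "m \<in> keys f - ?K" for m
    proof -
      obtain p where p: "\<not> lookup m p \<le> 1" using m by auto
      define r where "r = m - (var_mon p + var_mon p)"
      have "m = r + (var_mon p + var_mon p)"
        by (rule poly_mapping_eqI) (use p in \<open>auto simp: r_def lookup_add lookup_minus\<close>)
      then have "?t m = Poly_Mapping.single r (lookup f m) * poly_var p ^ 2"
        by (simp add: power2_eq_square poly_var_eq mult_single)
      moreover have "poly_var p ^ 2 \<in> ?Sq"
        unfolding squares_ideal_def by (intro ring_module.span_base) auto
      ultimately show ?thesis using ring_module.subspace_scale[OF Sqs] by simp
    qed
    then have "(\<Sum>m\<in>keys f - ?K. ?t m) \<in> ?Sq" by (rule ring_module.subspace_sum[OF Sqs])
    ultimately have "(\<Sum>m\<in>?K. ?t m) + (\<Sum>m\<in>keys f - ?K. ?t m) \<in> ?SR + ?Sq"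
      by (rule set_plus_intro)
    moreover have "(\<Sum>m\<in>?K. ?t m) + (\<Sum>m\<in>keys f - ?K. ?t m) = (\<Sum>m\<in>keys f. ?t m)"
      by (subst sum.subset_diff[of ?K "keys f"]) (auto simp: add.commute)
    ultimately show ?thesis by (simp only: poly_mapping_sum_singles[of f, symmetric])
  qed
  then show ?thesis using 1 by blast
qed

section \<open>Counting free and critical pairs\<close>

text \<open>
  The points at which \<open>e\<^sub>\<tau> x\<^sup>\<sigma>\<close> has multidegree one. The differential moves such a point from \<open>\<tau>\<close> to \<open>\<sigma>\<close>
  and thereby preserves this set.
\<close>
definition unit_support :: "'a set \<Rightarrow> 'a set \<Rightarrow> 'a set" where
  "unit_support \<tau> \<sigma> = (\<tau> - \<sigma>) \<union> (\<sigma> - \<tau>)"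

definition face_pairs :: "'p::finite set \<Rightarrow> nat \<Rightarrow> nat \<Rightarrow> ('p set \<times> 'p set) set" where
  "face_pairs l i k = {(\<tau>, \<sigma>). card \<tau> = i \<and> card \<sigma> = k \<and> \<sigma> \<subseteq> l}"

definition free_face_pairs :: "'p::finite set \<Rightarrow> nat \<Rightarrow> nat \<Rightarrow> ('p set \<times> 'p set) set" where
  "free_face_pairs l i k =
     {(\<tau>, \<sigma>) \<in> face_pairs l i k. \<forall>p. first_elem (unit_support \<tau> \<sigma> \<inter> l) = Some p \<longrightarrow> p \<notin> \<tau>}"

definition critical_face_pairs :: "'p::finite set \<Rightarrow> nat \<Rightarrow> nat \<Rightarrow> ('p set \<times> 'p set) set" where
  "critical_face_pairs l i k = {(\<tau>, \<sigma>) \<in> face_pairs l i k. unit_support \<tau> \<sigma> \<inter> l = {}}"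

lemma card_face_pairs:
  "card (face_pairs (l :: 'p::finite set) i k) = (card (UNIV :: 'p set) choose i) * (card l choose k)"
proof -
  have "face_pairs l i k = {\<tau>. \<tau> \<subseteq> UNIV \<and> card \<tau> = i} \<times> {\<sigma>. \<sigma> \<subseteq> l \<and> card \<sigma> = k}"
    by (auto simp: face_pairs_def)
  then show ?thesis by (simp only: card_cartesian_product n_subsets finite)
qed

text \<open>
  These pairs satisfy \<open>\<sigma> = \<tau> \<inter> l\<close>, so \<open>\<sigma>\<close> is chosen in \<open>l\<close> and the rest of \<open>\<tau>\<close> outside \<open>l\<close>. They index a
  basis of the Koszul homology of the complete intersection of the variables outside \<open>l\<close> and the squares of the
  variables in \<open>l\<close>, which is an exterior algebra.
\<close>
lemma card_critical_face_pairs: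
  fixes l :: "'p::finite set"
  shows "int (card (critical_face_pairs l i k)) = int (card l choose k) * binom (card (UNIV :: 'p set) - card l) (int i - int k)"
proof -
  let ?R = "{\<sigma>. \<sigma> \<subseteq> l \<and> card \<sigma> = k} \<times> {\<rho>. \<rho> \<subseteq> - l \<and> card \<rho> + k = i}"
  have "bij_betw (\<lambda>(\<tau>, \<sigma>). (\<sigma>, \<tau> - l)) (critical_face_pairs l i k) ?R"
  proof (rule bij_betw_byWitness[where f' = "\<lambda>(\<sigma>, \<rho>). (\<sigma> \<union> \<rho>, \<sigma>)"])
    have eq: "\<tau> = \<sigma> \<union> (\<tau> - l)" if "(\<tau>, \<sigma>) \<in> critical_face_pairs l i k" for \<tau> \<sigma>
      using that by (auto simp: critical_face_pairs_def face_pairs_def unit_support_def)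
    then show "\<forall>a\<in>critical_face_pairs l i k. (case case a of (\<tau>, \<sigma>) \<Rightarrow> (\<sigma>, \<tau> - l) of (\<sigma>, \<rho>) \<Rightarrow> (\<sigma> \<union> \<rho>, \<sigma>)) = a"
      by auto
    show "(\<lambda>(\<tau>, \<sigma>). (\<sigma>, \<tau> - l)) ` critical_face_pairs l i k \<subseteq> ?R"
    proof (rule image_subsetI)
      fix x assume "x \<in> critical_face_pairs l i k"
      then obtain \<tau> \<sigma> where x: "x = (\<tau>, \<sigma>)" and c: "(\<tau>, \<sigma>) \<in> critical_face_pairs l i k" by (cases x) auto
      have s: "\<sigma> \<subseteq> l" "card \<sigma> = k" "card \<tau> = i" using c by (auto simp: critical_face_pairs_def face_pairs_def)
      have "card \<tau> = card \<sigma> + card (\<tau> - l)"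
        by (subst eq[OF c], subst card_Un_disjoint) (use s in auto)
      then show "(case x of (\<tau>, \<sigma>) \<Rightarrow> (\<sigma>, \<tau> - l)) \<in> ?R" using s x by auto
    qed
    show "(\<lambda>(\<sigma>, \<rho>). (\<sigma> \<union> \<rho>, \<sigma>)) ` ?R \<subseteq> critical_face_pairs l i k"
    proof (rule image_subsetI)
      fix x assume "x \<in> ?R"
      then obtain \<sigma> \<rho> where a: "x = (\<sigma>, \<rho>)" "\<sigma> \<subseteq> l" "\<rho> \<subseteq> - l" "card \<sigma> = k" "card \<rho> + k = i" by auto
      have "card (\<sigma> \<union> \<rho>) = card \<sigma> + card \<rho>" by (rule card_Un_disjoint) (use a in auto)
      then show "(case x of (\<sigma>, \<rho>) \<Rightarrow> (\<sigma> \<union> \<rho>, \<sigma>)) \<in> critical_face_pairs l i k"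
        using a by (auto simp: critical_face_pairs_def face_pairs_def unit_support_def)
    qed
  qed auto
  then have "card (critical_face_pairs l i k) = card ?R" by (rule bij_betw_same_card)
  also have "\<dots> = (card l choose k) * card {\<rho>. \<rho> \<subseteq> - l \<and> card \<rho> + k = i}"
    by (simp only: card_cartesian_product n_subsets finite)
  finally have "card (critical_face_pairs l i k) = (card l choose k) * card {\<rho>. \<rho> \<subseteq> - l \<and> card \<rho> + k = i}" .
  moreover have "int (card {\<rho>. \<rho> \<subseteq> - l \<and> card \<rho> + k = i}) = binom (card (UNIV :: 'p set) - card l) (int i - int k)"
  proof (cases "k \<le> i")
    case True
    then have "{\<rho>. \<rho> \<subseteq> - l \<and> card \<rho> + k = i} = {\<rho>. \<rho> \<subseteq> - l \<and> card \<rho> = i - k}" by auto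
    then show ?thesis using True
      by (simp only: n_subsets finite) (simp add: binom_def Compl_eq_Diff_UNIV card_Diff_subset nat_diff_distrib)
  next
    case False
    then have "{\<rho>. \<rho> \<subseteq> - l \<and> card \<rho> + k = i} = {}" by auto
    then show ?thesis using False by (simp add: binom_def)
  qed
  ultimately show ?thesis by simp
qed

text \<open>
  Moving the selected point is a bijection from the matched free pairs at \<open>(i, k + 1)\<close> to the pairs at
  \<open>(i + 1, k)\<close> that are not free.
\<close>
lemma card_free_face_pairs_Suc:
  fixes l :: "'p::finite set"
  shows "card (free_face_pairs l i (Suc k)) + card (free_face_pairs l (Suc i) k) =
    card (critical_face_pairs l i (Suc k)) + card (face_pairs l (Suc i) k)"
proof -
  let ?fe = "\<lambda>(\<tau>, \<sigma>). first_elem (unit_support \<tau> \<sigma> \<inter> l)"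
  let ?p = "\<lambda>x. the (?fe x)"
  let ?B = "{(\<tau>, \<sigma>) \<in> face_pairs l i (Suc k). \<exists>p. first_elem (unit_support \<tau> \<sigma> \<inter> l) = Some p \<and> p \<notin> \<tau>}"
  let ?C = "{(\<tau>, \<sigma>) \<in> face_pairs l (Suc i) k. \<exists>p. first_elem (unit_support \<tau> \<sigma> \<inter> l) = Some p \<and> p \<in> \<tau>}"
  have move1: "unit_support (insert p \<tau>) (\<sigma> - {p}) = unit_support \<tau> \<sigma>" if "p \<notin> \<tau>" "p \<in> \<sigma>" for p :: 'p and \<tau> \<sigma>
    using that by (auto simp: unit_support_def)
  have move2: "unit_support (\<tau> - {p}) (insert p \<sigma>) = unit_support \<tau> \<sigma>" if "p \<in> \<tau>" "p \<notin> \<sigma>" for p :: 'p and \<tau> \<sigma>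
    using that by (auto simp: unit_support_def)
  have "bij_betw (\<lambda>(\<tau>, \<sigma>). (insert (?p (\<tau>, \<sigma>)) \<tau>, \<sigma> - {?p (\<tau>, \<sigma>)})) ?B ?C"
  proof (rule bij_betw_byWitness[where f' = "\<lambda>(\<tau>, \<sigma>). (\<tau> - {?p (\<tau>, \<sigma>)}, insert (?p (\<tau>, \<sigma>)) \<sigma>)"])
    have B: "p \<in> \<sigma> \<and> p \<notin> \<tau> \<and> p \<in> l" if "first_elem (unit_support \<tau> \<sigma> \<inter> l) = Some p" "p \<notin> \<tau>" for \<tau> \<sigma> p
      using first_elem_Some[OF that(1)] that(2) by (auto simp: unit_support_def)
    have C: "p \<notin> \<sigma> \<and> p \<in> \<tau> \<and> p \<in> l" if "first_elem (unit_support \<tau> \<sigma> \<inter> l) = Some p" "p \<in> \<tau>" for \<tau> \<sigma> p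
      using first_elem_Some[OF that(1)] that(2) by (auto simp: unit_support_def)
    show "\<forall>a\<in>?B. (\<lambda>(\<tau>, \<sigma>). (\<tau> - {?p (\<tau>, \<sigma>)}, insert (?p (\<tau>, \<sigma>)) \<sigma>))
        ((\<lambda>(\<tau>, \<sigma>). (insert (?p (\<tau>, \<sigma>)) \<tau>, \<sigma> - {?p (\<tau>, \<sigma>)})) a) = a"
      using B by (auto simp: move1)
    show "\<forall>a\<in>?C. (\<lambda>(\<tau>, \<sigma>). (insert (?p (\<tau>, \<sigma>)) \<tau>, \<sigma> - {?p (\<tau>, \<sigma>)}))
        ((\<lambda>(\<tau>, \<sigma>). (\<tau> - {?p (\<tau>, \<sigma>)}, insert (?p (\<tau>, \<sigma>)) \<sigma>)) a) = a"
      using C by (auto simp: move2)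
    show "(\<lambda>(\<tau>, \<sigma>). (insert (?p (\<tau>, \<sigma>)) \<tau>, \<sigma> - {?p (\<tau>, \<sigma>)})) ` ?B \<subseteq> ?C"
      using B by (auto simp: face_pairs_def move1)
    show "(\<lambda>(\<tau>, \<sigma>). (\<tau> - {?p (\<tau>, \<sigma>)}, insert (?p (\<tau>, \<sigma>)) \<sigma>)) ` ?C \<subseteq> ?B"
      using C by (auto simp: face_pairs_def move2)
  qed
  then have "card ?B = card ?C" by (rule bij_betw_same_card)
  moreover have "free_face_pairs l i (Suc k) = critical_face_pairs l i (Suc k) \<union> ?B"
    by (auto simp: free_face_pairs_def critical_face_pairs_def)
  then have "card (free_face_pairs l i (Suc k)) = card (critical_face_pairs l i (Suc k)) + card ?B"
    by (simp only:) (rule card_Un_disjoint, auto simp: critical_face_pairs_def)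
  moreover have e: "face_pairs l (Suc i) k = free_face_pairs l (Suc i) k \<union> ?C"
    by (auto simp: free_face_pairs_def)
  have "card (face_pairs l (Suc i) k) = card (free_face_pairs l (Suc i) k) + card ?C"
    by (rule trans[OF arg_cong[where f = card, OF e] card_Un_disjoint])
      (auto simp: free_face_pairs_def)
  ultimately show ?thesis by simp
qed

lemma free_face_pairs_0: "free_face_pairs l i 0 = critical_face_pairs (l :: 'p::finite set) i 0"
proof -
  have "(\<forall>p. first_elem (unit_support \<tau> {} \<inter> l) = Some p \<longrightarrow> p \<notin> \<tau>) \<longleftrightarrow> unit_support \<tau> {} \<inter> l = {}" for \<tau>
  proof
    assume *: "\<forall>p. first_elem (unit_support \<tau> {} \<inter> l) = Some p \<longrightarrow> p \<notin> \<tau>"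
    show "unit_support \<tau> {} \<inter> l = {}"
    proof (rule ccontr)
      assume "unit_support \<tau> {} \<inter> l \<noteq> {}"
      then obtain p where p: "first_elem (unit_support \<tau> {} \<inter> l) = Some p" by (auto simp: first_elem_def)
      then show False using * first_elem_Some[OF p] by (auto simp: unit_support_def)
    qed
  qed simp
  then show ?thesis
    by (auto simp: free_face_pairs_def critical_face_pairs_def face_pairs_def)
qed

text \<open>
  The recursion for the number of free pairs that follows from \<open>card_free_face_pairs_Suc\<close>, for a set \<open>l\<close> of size \<open>s\<close> in a set of size \<open>n\<close>.
\<close>
fun free_count :: "nat \<Rightarrow> nat \<Rightarrow> nat \<Rightarrow> nat \<Rightarrow> int" where
  "free_count n s i 0 = binom (n - s) (int i)"
| "free_count n s i (Suc k) = int (s choose Suc k) * binom (n - s) (int i - int (Suc k)) +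
     int (n choose Suc i) * int (s choose k) - free_count n s (Suc i) k"

lemma card_free_face_pairs:
  fixes l :: "'p::finite set"
  shows "int (card (free_face_pairs l i k)) = free_count (card (UNIV :: 'p set)) (card l) i k"
proof (induction k arbitrary: i)
  case 0
  show ?case unfolding free_face_pairs_0 card_critical_face_pairs by simp
next
  case (Suc k)
  have "int (card (free_face_pairs l i (Suc k))) + int (card (free_face_pairs l (Suc i) k)) =
      int (card (critical_face_pairs l i (Suc k))) + int (card (face_pairs l (Suc i) k))"
    using card_free_face_pairs_Suc[of l i k] by (metis of_nat_add)
  then show ?case
    unfolding Suc.IH[of "Suc i"] card_critical_face_pairs card_face_pairs by simp
qed

section \<open>The matching of a simplicial complex\<close>

lemma face_monomials_add_var:
  assumes "m + var_mon r \<in> face_monomials \<Lambda>"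
  shows "r \<notin> keys m" "insert r (keys m) \<in> \<Lambda>" "\<And>p. lookup m p \<le> 1"
proof -
  have *: "\<And>p. lookup (m + var_mon r) p \<le> 1" "keys (m + var_mon r) \<in> \<Lambda>"
    using assms unfolding face_monomials_iff by auto
  show "r \<notin> keys m" using *(1)[of r] by (auto simp: in_keys_iff lookup_add)
  show "insert r (keys m) \<in> \<Lambda>" using *(2) by (simp add: keys_add_var_mon)
  show "lookup m p \<le> 1" for p using *(1)[of p] by (simp add: lookup_add)
qed

text \<open>
  The set \<open>line \<sigma>\<close> is the largest face above \<open>\<sigma>\<close>, assumed to exist for all faces with at least \<open>k0\<close> points. The
  selected point is the first one of multidegree one on it.
\<close>
lemma koszul_matching_faces:
  fixes \<Lambda> :: "'p::finite set set" and line :: "'p set \<Rightarrow> 'p set"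
  assumes down: "\<And>\<sigma> \<tau>. \<sigma> \<in> \<Lambda> \<Longrightarrow> \<tau> \<subseteq> \<sigma> \<Longrightarrow> \<tau> \<in> \<Lambda>"
    and line: "\<And>\<sigma>. \<sigma> \<in> \<Lambda> \<Longrightarrow> k0 \<le> card \<sigma> \<Longrightarrow> \<sigma> \<subseteq> line \<sigma>"
    and line_insert: "\<And>\<sigma> r. insert r \<sigma> \<in> \<Lambda> \<Longrightarrow> k0 \<le> card \<sigma> \<Longrightarrow> line (insert r \<sigma>) = line \<sigma>"
    and line_face: "\<And>\<sigma> r. \<sigma> \<in> \<Lambda> \<Longrightarrow> k0 \<le> card \<sigma> \<Longrightarrow> r \<in> line \<sigma> \<Longrightarrow> insert r \<sigma> \<in> \<Lambda>"
  shows "koszul_matching (face_monomials \<Lambda>) k0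
    (\<lambda>\<tau> m. first_elem (unit_support \<tau> (keys m) \<inter> line (keys m)))"
proof
  fix m r assume m: "m + var_mon r \<in> face_monomials \<Lambda>"
  note f = face_monomials_add_var[OF m]
  show "m \<in> face_monomials \<Lambda>" unfolding face_monomials_iff using f down by blast
  then have d: "mdeg m = card (keys m)" by (rule mdeg_face_monomial)
  fix \<rho> :: "'p set" assume k: "k0 \<le> mdeg m" and r: "r \<notin> \<rho>"
  have "unit_support (insert r \<rho>) (keys m) = unit_support \<rho> (insert r (keys m))"
    using r f(1) by (auto simp: unit_support_def)
  then show "first_elem (unit_support (insert r \<rho>) (keys m) \<inter> line (keys m)) =
      first_elem (unit_support \<rho> (keys (m + var_mon r)) \<inter> line (keys (m + var_mon r)))"
    using line_insert[OF f(2)] k d by (simp add: keys_add_var_mon)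
next
  fix m and \<tau> :: "'p set"
  assume m: "m \<in> face_monomials \<Lambda>" and k: "k0 \<le> mdeg m"
  have k': "k0 \<le> card (keys m)" using k mdeg_face_monomial[OF m] by simp
  have face: "keys m \<in> \<Lambda>" and sq: "\<And>p. lookup m p \<le> 1"
    using m unfolding face_monomials_iff by auto
  {
    fix p assume "first_elem (unit_support \<tau> (keys m) \<inter> line (keys m)) = Some p"
    from first_elem_Some[OF this]
    have p: "p \<in> unit_support \<tau> (keys m)" "p \<in> line (keys m)" by auto
    show "m + var_mon p \<in> face_monomials \<Lambda>" if "p \<in> \<tau>"
    proof -
      have "p \<notin> keys m" using p that by (auto simp: unit_support_def)
      then have "lookup (m + var_mon p) r \<le> 1" for r
        using sq[of r] by (auto simp: lookup_add in_keys_iff)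
      then show ?thesis using line_face[OF face k' p(2)] by (simp add: face_monomials_iff keys_add_var_mon)
    qed
    show "0 < lookup m p" if "p \<notin> \<tau>"
      using p(1) that by (auto simp: unit_support_def in_keys_iff)
  }
  fix r assume r: "first_elem (unit_support \<tau> (keys m) \<inter> line (keys m)) = None" "r \<notin> \<tau>"
  have "r \<notin> keys m"
  proof
    assume "r \<in> keys m"
    then have "r \<in> unit_support \<tau> (keys m) \<inter> line (keys m)"
      using line[OF face k'] r(2) by (auto simp: unit_support_def)
    then show False using r(1) unfolding first_elem_None by blast
  qed
  then show "lookup m r = 0" by (simp add: in_keys_iff)
qed

section \<open>The incidence complex of a projective plane\<close>

definition line_through :: "'p set set \<Rightarrow> 'p set \<Rightarrow> 'p set" where
  "line_through L \<sigma> = (THE l. l \<in> L \<and> \<sigma> \<subseteq> l)"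

lemma two_elements: "finite \<sigma> \<Longrightarrow> 2 \<le> card \<sigma> \<Longrightarrow> \<exists>a\<in>\<sigma>. \<exists>b\<in>\<sigma>. a \<noteq> b"
  using card_le_Suc0_iff_eq[of \<sigma>] by force

locale finite_plane =
  fixes L :: "'p::finite set set" and q :: nat
  assumes plane: "projective_plane_of_order (UNIV :: 'p set) L q"
begin

abbreviation "N \<equiv> q\<^sup>2 + q + 1"

lemma card_points: "card (UNIV :: 'p set) = N" and card_lines: "card L = N"
  and card_line: "l \<in> L \<Longrightarrow> card l = q + 1"
  using plane by (auto simp: projective_plane_of_order_def)

lemma line_ex1: "x \<noteq> y \<Longrightarrow> \<exists>!l. l \<in> L \<and> x \<in> l \<and> y \<in> l"
  using plane by (auto simp: projective_plane_of_order_def projective_plane_def linear_space_def)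

lemma order_ge_2: "2 \<le> q"
proof -
  have "L \<noteq> {}" using card_lines by (intro notI) simp
  then obtain l where l: "l \<in> L" by blast
  then have "3 \<le> card l" using plane by (auto simp: projective_plane_of_order_def projective_plane_def)
  then show ?thesis using card_line[OF l] by simp
qed

abbreviation "\<Lambda> \<equiv> incidence_complex L"

lemma incidence_complex_down: "\<sigma> \<in> \<Lambda> \<Longrightarrow> \<tau> \<subseteq> \<sigma> \<Longrightarrow> \<tau> \<in> \<Lambda>"
  by (auto simp: incidence_complex_def)

lemma line_unique:
  assumes "2 \<le> card \<sigma>" "\<sigma> \<subseteq> l" "l \<in> L" "\<sigma> \<subseteq> l'" "l' \<in> L"
  shows "l = l'"
proof -
  obtain a b where ab: "a \<in> \<sigma>" "b \<in> \<sigma>" "a \<noteq> b" using two_elements[OF _ assms(1)] by auto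
  have in_l: "a \<in> l" "b \<in> l" "a \<in> l'" "b \<in> l'" using ab assms by auto
  obtain m where m: "\<forall>x. x \<in> L \<and> a \<in> x \<and> b \<in> x \<longrightarrow> x = m"
    using line_ex1[OF ab(3)] by (elim ex1E)
  have "l = m" using spec[OF m, of l] assms(3) in_l by simp
  moreover have "l' = m" using spec[OF m, of l'] assms(5) in_l by simp
  ultimately show ?thesis by simp
qed

lemma line_through_eq: "2 \<le> card \<sigma> \<Longrightarrow> \<sigma> \<subseteq> l \<Longrightarrow> l \<in> L \<Longrightarrow> line_through L \<sigma> = l"
  unfolding line_through_def by (rule the_equality) (simp_all add: line_unique[of \<sigma> _ l])

text \<open>
  Any two points are joined by a line, so in degrees at most two the face ring agrees with the ring
  obtained by dividing out the squares alone.
\<close>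
lemma small_face: "card \<sigma> \<le> 2 \<Longrightarrow> \<sigma> \<in> \<Lambda>"
proof -
  assume c: "card \<sigma> \<le> 2"
  have "\<exists>a b. \<sigma> \<subseteq> {a, b}"
  proof (cases "\<sigma> = {}")
    case False
    then obtain a where a: "a \<in> \<sigma>" by auto
    have "card (\<sigma> - {a}) \<le> Suc 0" using a c by simp
    then have "\<forall>x\<in>\<sigma> - {a}. \<forall>y\<in>\<sigma> - {a}. x = y" by (subst (asm) card_le_Suc0_iff_eq) auto
    then show ?thesis by (cases "\<sigma> - {a} = {}") blast+
  qed auto
  then obtain a b where ab: "\<sigma> \<subseteq> {a, b}" by blast
  have "2 \<le> card (UNIV :: 'p set)" using card_points order_ge_2 by simp
  then obtain x y :: 'p where xy: "x \<noteq> y" using two_elements[of "UNIV :: 'p set"] by auto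
  have "\<exists>c. a \<noteq> c \<and> \<sigma> \<subseteq> {a, c}"
  proof (cases "a = b")
    case True
    then show ?thesis using ab xy by (intro exI[of _ "if a = x then y else x"]) auto
  next
    case False
    then show ?thesis using ab by blast
  qed
  then obtain c where "a \<noteq> c" "\<sigma> \<subseteq> {a, c}" by blast
  moreover from this obtain l where "l \<in> L" "a \<in> l" "c \<in> l" using line_ex1 by blast
  ultimately show "\<sigma> \<in> \<Lambda>" unfolding incidence_complex_def by blast
qed

lemma card_monomial_pairs:
  fixes \<Gamma> :: "'p set set"
  shows "card {(\<tau>, m) \<in> koszul_pairs i j. m \<in> face_monomials \<Gamma> \<and> Q \<tau> m} =
     card {(\<tau>, \<sigma>). card \<tau> = i \<and> int (card \<sigma>) = j - int i \<and> \<sigma> \<in> \<Gamma> \<and> Q \<tau> (mono_of \<sigma>)}"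
    (is "card ?A = card ?B")
proof -
  have "?A = (\<lambda>(\<tau>, \<sigma>). (\<tau>, mono_of \<sigma>)) ` ?B"
    by (auto simp: koszul_pairs_def face_monomials_def image_iff)
  moreover have "inj_on (\<lambda>(\<tau>, \<sigma>). (\<tau>, mono_of \<sigma>)) ?B"
    by (auto simp: inj_on_def dest: injD[OF inj_mono_of])
  ultimately show ?thesis by (simp add: card_image)
qed

text \<open>
  A face with at least two points lies on exactly one line.
\<close>
lemma card_pairs_by_lines:
  assumes k: "2 \<le> k"
  shows "card {(\<tau>, \<sigma>). card \<tau> = i \<and> card \<sigma> = k \<and> \<sigma> \<in> \<Lambda> \<and> Q \<tau> \<sigma>} =
     (\<Sum>l\<in>L. card {(\<tau>, \<sigma>) \<in> face_pairs l i k. Q \<tau> \<sigma>})"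
proof -
  have "{(\<tau>, \<sigma>). card \<tau> = i \<and> card \<sigma> = k \<and> \<sigma> \<in> \<Lambda> \<and> Q \<tau> \<sigma>} = (\<Union>l\<in>L. {(\<tau>, \<sigma>) \<in> face_pairs l i k. Q \<tau> \<sigma>})"
    by (auto simp: incidence_complex_def face_pairs_def)
  moreover have "card (\<Union>l\<in>L. {(\<tau>, \<sigma>) \<in> face_pairs l i k. Q \<tau> \<sigma>}) = (\<Sum>l\<in>L. card {(\<tau>, \<sigma>) \<in> face_pairs l i k. Q \<tau> \<sigma>})"
    by (rule card_UN_disjoint) (use k line_unique in \<open>auto simp: face_pairs_def\<close>)
  ultimately show ?thesis by simp
qed

lemma card_pairs_small:
  assumes k: "k \<le> 2"
  shows "card {(\<tau>, \<sigma>). card \<tau> = i \<and> card \<sigma> = k \<and> \<sigma> \<in> \<Lambda> \<and> Q \<tau> \<sigma>} =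
     card {(\<tau>, \<sigma>) \<in> face_pairs UNIV i k. Q \<tau> \<sigma>}"
  using k small_face by (intro arg_cong[where f = card]) (auto simp: face_pairs_def)

abbreviation "plane_ideal \<equiv> complement_ideal (face_monomials \<Lambda>)"

text \<open>
  The dimension of the space of cycles modulo the ideal, in homological degree \<open>i\<close> and polynomial degree \<open>d\<close>. Up
  to degree one the ring of squares governs, which is the case of a single line containing all points; from
  degree two on there is one contribution for every line.
\<close>
definition cycle_dim :: "nat \<Rightarrow> int \<Rightarrow> int" where
  "cycle_dim i d = (if d < 0 then 0 else if d \<le> 1 then free_count N N i (nat d)
     else int N * free_count N (q + 1) i (nat d))"

definition face_count :: "nat \<Rightarrow> int \<Rightarrow> int" where
  "face_count i d = (if d < 0 then 0 else if d \<le> 1 then int (N choose i) * int (N choose nat d)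
     else int N * (int (N choose i) * int ((q + 1) choose nat d)))"

lemma face_count: "int (card {(\<tau>, m) \<in> koszul_pairs i j. m \<in> face_monomials \<Lambda>}) = face_count i (j - int i)"
proof (cases "j - int i < 0")
  case True
  then have "{(\<tau>, m) \<in> koszul_pairs i j. m \<in> face_monomials \<Lambda>} = {}"
    by (auto simp: koszul_pairs_def)
  then show ?thesis using True by (simp only: face_count_def card.empty) simp
next
  case False
  then obtain k where k: "j - int i = int k" by (metis nonneg_int_cases not_less)
  have "card {(\<tau>, m) \<in> koszul_pairs i j. m \<in> face_monomials \<Lambda>} =
      card {(\<tau> :: 'p set, \<sigma>). card \<tau> = i \<and> card \<sigma> = k \<and> \<sigma> \<in> \<Lambda> \<and> True}"
    using card_monomial_pairs[of i j \<Lambda> "\<lambda>_ _. True"] by (simp only: k of_nat_eq_iff simp_thms)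
  also have "\<dots> = (if k \<le> 1 then card (face_pairs (UNIV :: 'p set) i k) else \<Sum>l\<in>L. card (face_pairs l i k))"
    using card_pairs_small[of k i "\<lambda>_ _. True"] card_pairs_by_lines[of k i "\<lambda>_ _. True"]
    by (cases "k \<le> 1") simp_all
  finally show ?thesis
    by (simp add: face_count_def card_face_pairs card_points card_lines card_line k algebra_simps)
qed

lemma free_count_lines:
  "(\<Sum>l\<in>L. int (card (free_face_pairs l i k))) = int N * free_count N (q + 1) i k"
  by (simp add: card_free_face_pairs card_points card_lines card_line)

text \<open>
  The differential preserves the line spanned by the monomial, so the lines contribute independently. The
  matching performs this splitting, since it selects a point on the line through \<open>\<sigma>\<close>.
\<close>
lemma dim_tor_cycles_large:
  assumes "2 \<le> j - int i"
  shows "int (coords_dim (tor_cycles koszul (plane_ideal :: ('p, 'k::field) mpoly set) i j)) =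
     cycle_dim i (j - int i) + int (card {(\<tau>, m) \<in> koszul_pairs i j. m \<notin> face_monomials \<Lambda>})"
proof -
  obtain k where k: "j - int i = int k" "2 \<le> k" using assms by (metis int_ops(3) nonneg_int_cases of_nat_le_iff of_nat_numeral order_trans zero_le_numeral)
  interpret km: koszul_matching "face_monomials \<Lambda>" 2
    "\<lambda>\<tau> m. first_elem (unit_support \<tau> (keys m) \<inter> line_through L (keys m))"
  proof (rule koszul_matching_faces)
    fix \<sigma> assume \<sigma>: "\<sigma> \<in> \<Lambda>" "2 \<le> card \<sigma>"
    then obtain l where l: "l \<in> L" "\<sigma> \<subseteq> l" by (auto simp: incidence_complex_def)
    note lt = line_through_eq[OF \<sigma>(2) l(2,1)]
    show "\<sigma> \<subseteq> line_through L \<sigma>" using l lt by simp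
    show "insert r \<sigma> \<in> \<Lambda>" if "r \<in> line_through L \<sigma>" for r
      using l lt that by (auto simp: incidence_complex_def)
  next
    fix \<sigma> r assume \<sigma>: "insert r \<sigma> \<in> \<Lambda>" "2 \<le> card \<sigma>"
    then obtain l where l: "l \<in> L" "insert r \<sigma> \<subseteq> l" by (auto simp: incidence_complex_def)
    have "2 \<le> card (insert r \<sigma>)" using \<sigma>(2) card_insert_le[of \<sigma> r] by linarith
    then show "line_through L (insert r \<sigma>) = line_through L \<sigma>"
      using line_through_eq[OF _ l(2,1)] line_through_eq[of \<sigma> l] \<sigma>(2) l by simp
  qed (rule incidence_complex_down)
  have "card {(\<tau>, m) \<in> koszul_pairs i j. m \<in> face_monomials \<Lambda> \<and> km.free_pair \<tau> m} =
    card {(\<tau>, \<sigma>). card \<tau> = i \<and> card \<sigma> = k \<and> \<sigma> \<in> \<Lambda> \<and> km.free_pair \<tau> (mono_of \<sigma>)}"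
    unfolding card_monomial_pairs by (simp add: k)
  also have "\<dots> = (\<Sum>l\<in>L. card {(\<tau>, \<sigma>) \<in> face_pairs l i k. km.free_pair \<tau> (mono_of \<sigma>)})"
    by (rule card_pairs_by_lines) (rule k)
  also have "\<dots> = (\<Sum>l\<in>L. card (free_face_pairs l i k))"
  proof (rule sum.cong[OF refl])
    fix l assume l: "l \<in> L"
    have "km.free_pair \<tau> (mono_of \<sigma>) \<longleftrightarrow> (\<forall>p. first_elem (unit_support \<tau> \<sigma> \<inter> l) = Some p \<longrightarrow> p \<notin> \<tau>)"
      if "(\<tau>, \<sigma>) \<in> face_pairs l i k" for \<tau> \<sigma>
      using line_through_eq[of \<sigma> l] that l k by (auto simp: km.free_pair_def face_pairs_def)
    then show "card {(\<tau>, \<sigma>) \<in> face_pairs l i k. km.free_pair \<tau> (mono_of \<sigma>)} = card (free_face_pairs l i k)"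
      unfolding free_face_pairs_def by (intro arg_cong[where f = card]) blast
  qed
  finally have "int (card {(\<tau>, m) \<in> koszul_pairs i j. m \<in> face_monomials \<Lambda> \<and> km.free_pair \<tau> m}) = cycle_dim i (j - int i)"
    using k free_count_lines by (simp add: cycle_dim_def)
  moreover have sMI: "ring_module.subspace (plane_ideal :: ('p, 'k) mpoly set)"
    by (rule subspace_complement_ideal) (rule face_monomials_down[OF incidence_complex_down])
  ultimately show ?thesis using km.dim_tor_cycles_koszul[OF sMI, of j i] assms by simp
qed

text \<open>
  The cycle condition in polynomial degree \<open>d \<le> 1\<close> involves only monomials of degree \<open>d\<close> and \<open>d + 1\<close>, for which the
  plane cannot be told from the full simplex. So the matching of the full simplex applies, which needs no line
  spanned by the monomial.
\<close>
lemma dim_tor_cycles_small: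
  assumes "0 \<le> j - int i" "j - int i \<le> 1"
  shows "int (coords_dim (tor_cycles koszul (plane_ideal :: ('p, 'k::field) mpoly set) i j)) =
     cycle_dim i (j - int i) + int (card {(\<tau>, m) \<in> koszul_pairs i j. m \<notin> face_monomials \<Lambda>})"
proof -
  obtain k where k: "j - int i = int k" "k \<le> 1" using assms by (metis nonneg_int_cases of_nat_le_1_iff)
  let ?All = "complement_ideal (face_monomials UNIV) :: ('p, 'k) mpoly set"
  interpret km: koszul_matching "face_monomials (UNIV :: 'p set set)" 0
    "\<lambda>\<tau> m. first_elem (unit_support \<tau> (keys m) \<inter> UNIV)"
    by (rule koszul_matching_faces[where line = "\<lambda>_. UNIV"]) auto
  have agree: "m \<in> face_monomials \<Lambda> \<longleftrightarrow> m \<in> face_monomials UNIV" if "mdeg m \<le> 2" for m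
    using small_face that by (auto simp: face_monomials_def)
  have sMI: "ring_module.subspace (plane_ideal :: ('p, 'k) mpoly set)"
    by (rule subspace_complement_ideal) (rule face_monomials_down[OF incidence_complex_down])
  have sAll: "ring_module.subspace ?All"
    by (rule subspace_complement_ideal) (rule face_monomials_down, auto)
  have "tor_cycles koszul (plane_ideal :: ('p, 'k) mpoly set) i j = tor_cycles koszul ?All i j"
  proof (rule set_eqI)
    fix v
    show "v \<in> tor_cycles koszul (plane_ideal :: ('p, 'k) mpoly set) i j \<longleftrightarrow> v \<in> tor_cycles koszul ?All i j"
      unfolding tor_cycles_koszul_iff[OF sMI] tor_cycles_koszul_iff[OF sAll]
      using agree k by auto
  qed
  moreover have "{(\<tau>, m) \<in> koszul_pairs i j. m \<notin> face_monomials UNIV} =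
      {(\<tau>, m) \<in> koszul_pairs i j. m \<notin> face_monomials \<Lambda>}"
    using agree k by (auto simp: koszul_pairs_def)
  moreover have "card {(\<tau>, m) \<in> koszul_pairs i j. m \<in> face_monomials UNIV \<and> km.free_pair \<tau> m} =
      card (free_face_pairs (UNIV :: 'p set) i k)"
    unfolding card_monomial_pairs km.free_pair_def
    by (intro arg_cong[where f = card]) (auto simp: k free_face_pairs_def face_pairs_def)
  then have "int (card {(\<tau>, m) \<in> koszul_pairs i j. m \<in> face_monomials UNIV \<and> km.free_pair \<tau> m}) = cycle_dim i (j - int i)"
    using k by (simp add: cycle_dim_def card_free_face_pairs card_points)
  ultimately show ?thesis using km.dim_tor_cycles_koszul[OF sAll, of j i] assms by simp
qed

lemma dim_tor_cycles:
  "int (coords_dim (tor_cycles koszul (plane_ideal :: ('p, 'k::field) mpoly set) i j)) =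
     cycle_dim i (j - int i) + int (card {(\<tau>, m) \<in> koszul_pairs i j. m \<notin> face_monomials \<Lambda>})"
proof (cases "j - int i < 0")
  case True
  have e: "koszul_pairs i j = ({} :: ('p set \<times> _) set)" using True by (auto simp: koszul_pairs_def)
  obtain E where E: "finite E" "graded_piece (koszul :: ('p, 'k) aug_complex) i j \<subseteq> coords.span E"
    by (rule graded_piece_basis[OF resolution_finite[OF koszul_resolution]])
  have "coords_dim (tor_cycles koszul (plane_ideal :: ('p, 'k) mpoly set) i j) \<le> coords_dim (graded_piece (koszul :: ('p, 'k) aug_complex) i j)"
    by (rule coords.dim_mono_finite[OF _ E]) (auto simp: tor_cycles_def)
  then show ?thesis using True by (simp add: dim_graded_piece_koszul e cycle_dim_def)
next
  case False
  then show ?thesis using dim_tor_cycles_small[of j i] dim_tor_cycles_large[of j i]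
    by (cases "j - int i \<le> 1") auto
qed

lemma betti_plane:
  "int (betti (plane_ideal :: ('p, 'k::field) mpoly set) i j) =
     cycle_dim i (j - int i) + cycle_dim (Suc i) (j - int i - 1) - face_count (Suc i) (j - int i - 1)"
proof -
  have "int (betti (plane_ideal :: ('p, 'k) mpoly set) i j) =
     cycle_dim i (j - int i) + cycle_dim (Suc i) (j - int (Suc i)) -
     int (card {(\<tau>, m) \<in> koszul_pairs (Suc i) j. m \<in> face_monomials \<Lambda>})"
    by (rule betti_monomial_ideal[where z = "\<lambda>k. cycle_dim k (j - int k)"])
      (auto intro: face_monomials_down[OF incidence_complex_down] dim_tor_cycles)
  then show ?thesis by (simp add: face_count algebra_simps)
qed

end


section \<open>Binomial coefficients\<close>

lemma binom_of_nat [simp]: "binom a (int b) = int (a choose b)"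
  by (simp add: binom_def)

lemma binom_of_nat_add: "binom a (int i + 1) = int (a choose (i + 1))" "binom a (int i + 2) = int (a choose (i + 2))"
proof -
  have e: "int i + 2 = int (i + 2)" "int i + 1 = int (i + 1)" by simp_all
  show "binom a (int i + 1) = int (a choose (i + 1))" "binom a (int i + 2) = int (a choose (i + 2))"
    unfolding e by (simp_all only: binom_of_nat)
qed

lemma binom_neg: "b < 0 \<Longrightarrow> binom a b = 0"
  by (simp add: binom_def)

lemma binom_zero_left: "binom 0 b = (if b = 0 then 1 else 0)"
  by (cases "b < 0") (auto simp: binom_def binomial_eq_0_iff nat_eq_iff)

lemma binom_nonzero_iff: "binom a b \<noteq> 0 \<longleftrightarrow> 0 \<le> b \<and> b \<le> int a"
  by (auto simp: binom_def binomial_eq_0_iff nat_le_iff)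

lemma choose_Suc_step: "Suc a * (n choose Suc a) = (n - a) * (n choose a)"
  by (simp only: binomial_absorption binomial_absorb_comp)

lemma int_choose_step: "(int a + 1) * int (n choose Suc a) = (int n - int a) * int (n choose a)"
proof (cases "a \<le> n")
  case True
  then show ?thesis using arg_cong[where f = int, OF choose_Suc_step[of a n]]
    by (simp only: of_nat_mult of_nat_Suc of_nat_diff add.commute)
qed (simp add: binomial_eq_0)

lemma int_choose_2: "2 * int (n choose 2) = int n * (int n - 1)"
  using int_choose_step[of 1 n] by (simp add: numeral_2_eq_2 algebra_simps)

lemma int_choose_3: "6 * int (n choose 3) = int n * (int n - 1) * (int n - 2)"
proof -
  have "3 * int (n choose 3) = (int n - 2) * int (n choose 2)" using int_choose_step[of 2 n] by simp
  then show ?thesis using int_choose_2[of n] by algebra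
qed

section \<open>Evaluation of the Betti numbers\<close>

context finite_plane
begin

lemma betti_below: "int (betti (plane_ideal :: ('p, 'k::field) mpoly set) i j) = 0" if "j < int i"
  unfolding betti_plane using that by (simp add: cycle_dim_def face_count_def)

lemma betti_row_0: "int (betti (plane_ideal :: ('p, 'k::field) mpoly set) i (int i)) = (if i = 0 then 1 else 0)"
  unfolding betti_plane by (simp add: cycle_dim_def face_count_def)

lemma betti_row_1: "int (betti (plane_ideal :: ('p, 'k::field) mpoly set) i (int i + 1)) = (if i = 1 then int N else 0)"
  unfolding betti_plane by (auto simp: cycle_dim_def face_count_def binom_zero_left)

text \<open>
  The common value of the Betti numbers with \<open>j = i + 2\<close>, where \<open>i \<ge> 1\<close>.
\<close>
definition row_2_value :: "nat \<Rightarrow> int" where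
  "row_2_value i = - int q * (int q + 1) * binom N (int i + 2)
            + (int q ^ 2 + int q + 1) *
              (binom (q^2) (int i + 2) + int q * binom N (int i + 1)
               - (int q + 1) * binom (q^2) (int i) + binom (q + 1) 2 * binom (q^2) (int i - 2))"

text \<open>
  The two regimes meet here: cycles in polynomial degree two split over the lines, while the boundaries come from
  degree one, where the complex is that of the ring of squares.
\<close>
lemma betti_row_2:
  "int (betti (plane_ideal :: ('p, 'k::field) mpoly set) i (int i + 2)) = (if i = 0 then 0 else row_2_value i)"
proof -
  have f1: "free_count N s a (Suc 0) = int s * binom (N - s) (int a - 1) + int (N choose Suc a)
      - binom (N - s) (int a + 1)" for s a
    by (simp del: binomial_Suc_Suc add: add.commute)
  have f2: "free_count N (q + 1) i (Suc (Suc 0)) = int (q + 1 choose 2) * binom (q\<^sup>2) (int i - 2)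
      + int (N choose (i + 1)) * int (q + 1) - free_count N (q + 1) (Suc i) (Suc 0)"
    by (simp del: binomial_Suc_Suc add: numeral_2_eq_2)
  have 1: "cycle_dim i 2 = int N * (int (q + 1 choose 2) * binom (q\<^sup>2) (int i - 2)
      + int (N choose (i + 1)) * int (q + 1) - (int (q + 1) * binom (q\<^sup>2) (int i) + int (N choose (i + 2))
      - binom (q\<^sup>2) (int i + 2)))"
    using f2 f1[of "q + 1" "Suc i"] by (simp del: binomial_Suc_Suc free_count.simps add: cycle_dim_def numeral_2_eq_2 add.commute)
  have 2: "cycle_dim (Suc i) 1 = (if i = 0 then int N else 0) + int (N choose (i + 2))"
    using f1[of N "Suc i"] by (simp del: binomial_Suc_Suc free_count.simps add: cycle_dim_def binom_zero_left)
  have 3: "face_count (Suc i) 1 = int (N choose (i + 1)) * int N"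
    by (simp del: binomial_Suc_Suc add: face_count_def)
  have b: "int (betti (plane_ideal :: ('p, 'k::field) mpoly set) i (int i + 2)) =
      cycle_dim i 2 + cycle_dim (Suc i) 1 - face_count (Suc i) 1"
    unfolding betti_plane by simp
  have c: "binom N (int i + 2) = int (N choose (i + 2))" "binom N (int i + 1) = int (N choose (i + 1))"
    "binom (q + 1) 2 = int (q + 1 choose 2)"
    using binom_of_nat_add[of N i] binom_of_nat[of "q + 1" 2] by (simp_all only: of_nat_numeral)
  have Nq: "int N = int q ^ 2 + int q + 1" by simp
  show ?thesis
  proof (cases "i = 0")
    case True
    have "binom (q\<^sup>2) (int i + 2) = int (q\<^sup>2 choose 2)" "binom (q\<^sup>2) (int i) = 1" "binom (q\<^sup>2) (int i - 2) = 0"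
      using binom_of_nat[of "q\<^sup>2" 2] binom_of_nat[of "q\<^sup>2" 0] True by (simp_all add: binom_neg)
    moreover have "int (N choose (i + 1)) = int N" "int (N choose (i + 2)) = int (N choose 2)"
      unfolding True add_0 choose_one by (rule refl)+
    ultimately have v: "cycle_dim i 2 + cycle_dim (Suc i) 1 - face_count (Suc i) 1 =
        int N * (int N * int (q + 1) - (int (q + 1) + int (N choose 2) - int (q\<^sup>2 choose 2)))
          + (int N + int (N choose 2)) - int N * int N"
      unfolding 1 2 3 using True by (simp only: mult_zero_right mult_1_right add_0 if_True refl)
    have identity: "2 * (n * (n * (Q + 1) - (Q + 1 + c2 - b2)) + (n + c2) - n * n) = 0"
      if "n = Q ^ 2 + Q + 1" "2 * c2 = n * (n - 1)" "2 * b2 = Q ^ 2 * (Q ^ 2 - 1)" for n Q c2 b2 :: int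
      using that by algebra
    have "2 * (cycle_dim i 2 + cycle_dim (Suc i) 1 - face_count (Suc i) 1) = 0"
      unfolding v of_nat_add[of q 1] of_nat_1
      by (rule identity[OF Nq int_choose_2 int_choose_2[of "q\<^sup>2", unfolded of_nat_power]])
    then show ?thesis unfolding b using True by simp
  next
    case False
    define x y z u v w where "x = int (q + 1 choose 2)" and "y = binom (q\<^sup>2) (int i - 2)"
      and "z = int (N choose (i + 1))" and "u = binom (q\<^sup>2) (int i)" and "v = int (N choose (i + 2))"
      and "w = binom (q\<^sup>2) (int i + 2)"
    show ?thesis
      unfolding row_2_value_def b 1 2 3 c x_def[symmetric] y_def[symmetric] z_def[symmetric] u_def[symmetric]
        v_def[symmetric] w_def[symmetric] Nq
      using False by (simp add: algebra_simps power2_eq_square)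
  qed
qed

text \<open>
  Both polynomial degrees \<open>k\<close> and \<open>k - 1\<close> split over the lines, so the recursion for the free pairs cancels
  everything except the critical pairs of each line.
\<close>
lemma betti_row_ge_3:
  assumes k: "3 \<le> k"
  shows "int (betti (plane_ideal :: ('p, 'k::field) mpoly set) i (int i + int k)) =
     (int q ^ 2 + int q + 1) * binom (q + 1) (int k) * binom (q^2) (int i - int k)"
proof -
  obtain k' where k': "k = Suc k'" "2 \<le> k'" using k by (cases k) auto
  let ?f = "free_count N (q + 1) (Suc i) k'"
  have 1: "cycle_dim i (int k) = int N * (int (q + 1 choose k) * binom (q\<^sup>2) (int i - int k)
      + int (N choose Suc i) * int (q + 1 choose k') - ?f)"
    unfolding k'(1) cycle_dim_def using k'(2) by (simp del: of_nat_Suc binomial_Suc_Suc add: nat_int)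
  have 2: "cycle_dim (Suc i) (int k - 1) = int N * ?f"
    unfolding k'(1) cycle_dim_def using k'(2) by simp
  have 3: "face_count (Suc i) (int k - 1) = int N * (int (N choose Suc i) * int (q + 1 choose k'))"
    unfolding k'(1) face_count_def using k'(2) by simp
  have cancel: "n * (c * b + e * g - f) + n * f - n * (e * g) = n * c * b" for n c b e g f :: int
    by (simp add: algebra_simps)
  have N: "int q ^ 2 + int q + 1 = int N" by simp
  have "int i + int k - int i = int k" by simp
  then show ?thesis unfolding betti_plane N binom_of_nat by (simp only: 1 2 3 cancel)
qed


lemma row_2_value_1: "row_2_value 1 = int (N choose 3) - int (q + 1 choose 3) * int N"
proof -
  have e: "int 1 + 2 = int 3" "int 1 + 1 = int 2" by simp_all
  have neg: "binom (q\<^sup>2) (int 1 - 2) = 0" by (rule binom_neg) simp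
  have q1: "int (q\<^sup>2 choose 1) = int q ^ 2" by simp
  have v: "row_2_value 1 = - int q * (int q + 1) * int (N choose 3) + (int q ^ 2 + int q + 1) *
     (int (q\<^sup>2 choose 3) + int q * int (N choose 2) - (int q + 1) * int q ^ 2)"
    unfolding row_2_value_def neg unfolding e binom_of_nat q1 by simp
  have identity: "6 * (- Q * (Q + 1) * c3 + (Q ^ 2 + Q + 1) * (b3 + Q * c2 - (Q + 1) * Q ^ 2)) = 6 * (c3 - d3 * n)"
    if "n = Q ^ 2 + Q + 1" "6 * c3 = n * (n - 1) * (n - 2)" "2 * c2 = n * (n - 1)"
      "6 * b3 = Q ^ 2 * (Q ^ 2 - 1) * (Q ^ 2 - 2)" "6 * d3 = (Q + 1) * Q * (Q - 1)" for Q n c3 c2 b3 d3 :: int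
    using that by algebra
  have "6 * row_2_value 1 = 6 * (int (N choose 3) - int (q + 1 choose 3) * int N)"
    unfolding v
    by (rule identity) (use int_choose_3[of "q\<^sup>2"] int_choose_3[of "q + 1"] in \<open>simp_all only: int_choose_3 int_choose_2, simp_all\<close>)
  then show ?thesis by simp
qed

text \<open>
  The difference of the two sides is the sum of \<open>dim H\<^sup>1\<close> of the restriction of the incidence complex to
  \<open>A\<close>, over all sets \<open>A\<close> of \<open>a\<close> points; it vanishes for \<open>a = 1\<close> and \<open>a = 2\<close>. The induction step rests on
  \<open>(q - a) (N - a) \<le> (q\<^sup>2 - a) (q + 1 - a)\<close>.
\<close>
lemma line_sections_bound:
  assumes "1 \<le> a"
  shows "int q * (int q + 1 - int a) * int (N choose a) \<le> int N * int (q\<^sup>2 choose a)"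
  using assms
proof (induction a rule: dec_induct)
  case base
  show ?case by (simp add: algebra_simps power2_eq_square)
next
  case (step a)
  show ?case
  proof (cases "q \<le> a")
    case True
    then have "int q * (int q + 1 - int (Suc a)) * int (N choose Suc a) \<le> 0"
      by (intro mult_nonpos_nonneg mult_nonneg_nonpos) auto
    also have "0 \<le> int N * int (q\<^sup>2 choose Suc a)" by simp
    finally show ?thesis .
  next
    case False
    define A B where "A = int (q\<^sup>2 choose a)" and "B = int (N choose a)"
    have qa: "int a \<le> int q" "1 \<le> int a" using False step.hyps by auto
    have "q \<le> q\<^sup>2" by (simp add: power2_eq_square)
    then have qq: "0 \<le> int q ^ 2 - int a" using qa by (metis diff_ge_0_iff_ge dual_order.trans of_nat_le_iff of_nat_power)
    have B0: "0 \<le> B" by (simp add: B_def)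
    have "(int a + 1) * (int q * (int q + 1 - int (Suc a)) * int (N choose Suc a)) =
        int q * (int q - int a) * ((int a + 1) * int (N choose Suc a))"
      by (simp add: algebra_simps)
    also have "\<dots> = int q * ((int q - int a) * (int N - int a)) * B"
      unfolding int_choose_step B_def by (simp add: algebra_simps)
    also have "\<dots> \<le> int q * ((int q ^ 2 - int a) * (int q + 1 - int a)) * B"
    proof -
      have "(int q - int a) * (int N - int a) + int q * (int a - 1) = (int q ^ 2 - int a) * (int q + 1 - int a)"
        by (simp add: algebra_simps power2_eq_square)
      moreover have "0 \<le> int q * (int a - 1)" using qa by simp
      ultimately have "(int q - int a) * (int N - int a) \<le> (int q ^ 2 - int a) * (int q + 1 - int a)" by linarith
      then show ?thesis using B0 by (intro mult_right_mono mult_left_mono) auto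
    qed
    also have "\<dots> = (int q ^ 2 - int a) * (int q * (int q + 1 - int a) * B)" by (simp add: algebra_simps)
    also have "\<dots> \<le> (int q ^ 2 - int a) * (int N * A)"
      using step.IH qq unfolding A_def B_def by (intro mult_left_mono) auto
    also have "\<dots> = int N * ((int a + 1) * int (q\<^sup>2 choose Suc a))"
      unfolding int_choose_step A_def of_nat_power by (simp only: mult.left_commute)
    also have "\<dots> = (int a + 1) * (int N * int (q\<^sup>2 choose Suc a))" by (rule mult.left_commute)
    finally show ?thesis by (simp only: mult_le_cancel_left_pos[of "int a + 1"])
  qed
qed

text \<open>
  The link of a point \<open>p\<close> consists of \<open>q + 1\<close> disjoint simplices. The difference of the two sides is the sum, over
  the sets of \<open>i\<close> points different from \<open>p\<close>, of the number of lines through \<open>p\<close> that meet the set, minus one.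
  For \<open>i = 1\<close> there is equality.
\<close>
lemma point_links_bound:
  assumes "2 \<le> i" "i \<le> q\<^sup>2 + q"
  shows "(int q + 1) * int (q\<^sup>2 choose i) < int q * int (q\<^sup>2 + q choose i)"
  using assms
proof (induction i rule: dec_induct)
  case base
  have q: "0 < int q" using order_ge_2 by simp
  have "2 * ((int q + 1) * int (q\<^sup>2 choose 2)) = (int q + 1) * (2 * int (q\<^sup>2 choose 2))"
    by (simp only: mult.left_commute)
  also have "\<dots> = (int q + 1) * (int q ^ 2 * (int q ^ 2 - 1))" unfolding int_choose_2 by simp
  also have "\<dots> < (int q + 1) * (int q ^ 2 * (int q ^ 2 - 1)) + int q * (int q * int q) * (int q + 1)"
    using q by simp
  also have "\<dots> = int q * (int (q\<^sup>2 + q) * (int (q\<^sup>2 + q) - 1))" by (simp add: algebra_simps power2_eq_square)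
  also have "\<dots> = int q * (2 * int (q\<^sup>2 + q choose 2))" unfolding int_choose_2 by simp
  also have "\<dots> = 2 * (int q * int (q\<^sup>2 + q choose 2))" by simp
  finally show ?case by simp
next
  case (step i)
  let ?M = "q\<^sup>2 + q"
  have "int i < int ?M" unfolding of_nat_less_iff using step.prems by simp
  then have pos: "0 < int ?M - int i" by (simp only: diff_gt_0_iff_gt)
  show ?case
  proof (cases "q\<^sup>2 \<le> i")
    case True
    have "0 < int q * int (?M choose Suc i)" using order_ge_2 step.prems zero_less_binomial[OF step.prems] by simp
    moreover have "q\<^sup>2 choose Suc i = 0" using True by (intro binomial_eq_0) simp
    ultimately show ?thesis by (simp only: of_nat_0 mult_zero_right)
  next
    case False
    have "(int i + 1) * ((int q + 1) * int (q\<^sup>2 choose Suc i)) = (int q + 1) * ((int i + 1) * int (q\<^sup>2 choose Suc i))"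
      by (simp only: mult.left_commute)
    also have "\<dots> = (int (q\<^sup>2) - int i) * ((int q + 1) * int (q\<^sup>2 choose i))"
      unfolding int_choose_step by (simp only: mult.left_commute)
    also have "\<dots> \<le> (int ?M - int i) * ((int q + 1) * int (q\<^sup>2 choose i))"
      by (intro mult_right_mono) auto
    also have "\<dots> < (int ?M - int i) * (int q * int (?M choose i))"
      using step pos by (intro mult_strict_left_mono) auto
    also have "\<dots> = (int i + 1) * (int q * int (?M choose Suc i))"
      using int_choose_step[of i ?M] by (simp only: mult.left_commute)
    finally show ?thesis by (simp only: mult_less_cancel_left_pos[of "int i + 1"])
  qed
qed

text \<open>
  With \<open>M = N - 1\<close>, the Pascal rule and \<open>N (M choose (i + 1)) = (i + 2) (N choose (i + 2))\<close> write the value as a sum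
  of three contributions, from squarefree multidegrees, from multidegrees with one square, and from those with
  two squares. The first is nonnegative by \<open>line_sections_bound\<close>, and the second is
  positive by \<open>point_links_bound\<close> unless \<open>i = 1\<close>, where the value is the number of noncollinear triples.
\<close>
lemma row_2_value_pos:
  assumes i: "1 \<le> i" "i \<le> q\<^sup>2 + q"
  shows "0 < row_2_value i"
proof (cases "i = 1")
  case True
  have q: "2 \<le> int q" using order_ge_2 by simp
  have q1: "int (q + 1) = int q + 1" and Nq: "int N = int q ^ 2 + int q + 1" by simp_all
  have identity: "6 * (c3 - d3 * n) = n * (Q * (Q + 1) * Q ^ 2)"
    if "n = Q ^ 2 + Q + 1" "6 * c3 = n * (n - 1) * (n - 2)" "6 * d3 = (Q + 1) * (Q + 1 - 1) * (Q + 1 - 2)" for Q n c3 d3 :: int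
    using that by algebra
  have "6 * row_2_value i = int N * (int q * (int q + 1) * (int q ^ 2))"
    unfolding True row_2_value_1 by (rule identity[OF Nq int_choose_3 int_choose_3[of "q + 1", unfolded q1]])
  also have "\<dots> > 0"
  proof (intro mult_pos_pos)
    show "0 < int N" by (simp only: of_nat_0_less_iff)
  qed (use q in auto)
  finally show ?thesis by simp
next
  case False
  let ?M = "q\<^sup>2 + q"
  define b2 b0 c2 m e where "b2 = int (q\<^sup>2 choose (i + 2))" and "b0 = int (q\<^sup>2 choose i)"
    and "c2 = int (N choose (i + 2))" and "m = int (?M choose i)"
    and "e = binom (q + 1) 2 * binom (q^2) (int i - 2)"
  have N: "N = Suc ?M" by simp
  have c1: "int N * int (N choose (i + 1)) = int N * m + (int i + 2) * c2"
  proof -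
    have "int (N choose (i + 1)) = m + int (?M choose Suc i)" by (simp add: m_def)
    moreover have "int N * int (?M choose Suc i) = (int i + 2) * c2"
      using arg_cong[where f = int, OF Suc_times_binomial_eq[of ?M "Suc i"]] by (simp add: c2_def algebra_simps)
    ultimately show ?thesis by (simp only: distrib_left)
  qed
  have "binom N (int i + 2) = c2" "binom N (int i + 1) = int (N choose (i + 1))" "binom (q\<^sup>2) (int i + 2) = b2"
    by (simp_all only: c2_def b2_def binom_of_nat_add)
  then have "row_2_value i = - int q * (int q + 1) * c2 + int N * (b2 + int q * int (N choose (i + 1)) - (int q + 1) * b0 + e)"
    by (simp add: row_2_value_def b0_def e_def)
  also have "\<dots> = - int q * (int q + 1) * c2 + int N * b2 + int q * (int N * int (N choose (i + 1))) - int N * ((int q + 1) * b0) + int N * e"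
    by (simp only: algebra_simps)
  also have "\<dots> = (int N * b2 - int q * (int q + 1 - int (i + 2)) * c2) + int N * (int q * m - (int q + 1) * b0) + int N * e"
    unfolding c1 by (simp add: algebra_simps)
  finally have v: "row_2_value i = \<dots>" .
  have "0 \<le> int N * b2 - int q * (int q + 1 - int (i + 2)) * c2"
    using line_sections_bound[of "i + 2"] by (simp add: b2_def c2_def)
  moreover have "0 < int N * (int q * m - (int q + 1) * b0)"
  proof (intro mult_pos_pos)
    show "0 < int N" by (simp only: of_nat_0_less_iff)
    show "0 < int q * m - (int q + 1) * b0"
      using point_links_bound[of i] i False by (simp add: m_def b0_def)
  qed
  moreover have "0 \<le> int N * e" by (simp add: e_def binom_def)
  ultimately show ?thesis unfolding v by linarith
qed

lemma row_2_value_zero: "q\<^sup>2 + q < i \<Longrightarrow> row_2_value i = 0"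
proof -
  assume i: "q\<^sup>2 + q < i"
  have z: "binom a b = 0" if "int a < b" for a b using binom_nonzero_iff[of a b] that by linarith
  have Ni: "int N \<le> int i" unfolding of_nat_le_iff using i by simp
  have qi: "int (q\<^sup>2) + 2 < int i" using i order_ge_2 by linarith
  have "binom N (int i + 2) = 0" "binom N (int i + 1) = 0" "binom (q\<^sup>2) (int i + 2) = 0"
    "binom (q\<^sup>2) (int i) = 0" "binom (q\<^sup>2) (int i - 2) = 0"
    by (rule z, use Ni qi in linarith)+
  then show ?thesis unfolding row_2_value_def by simp
qed

end

section \<open>The theorem\<close>

theorem corollary3p6:
  fixes L :: "'p::finite set set" and q :: nat
    and I :: "('p, 'k::field) mpoly set"
  assumes plane: "projective_plane_of_order (UNIV :: 'p set) L q"
    and I: "I = stanley_reisner_ideal (incidence_complex L) + squares_ideal"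
  shows "(\<forall>j::int. int (betti I 1 j) =
            (if j = 2 then int q ^ 2 + int q + 1
             else if j = 3 then binom (q^2 + q + 1) 3 - binom (q + 1) 3 * (int q ^ 2 + int q + 1)
             else 0))
    \<and> (\<forall>(i::nat) (j::int). i \<ge> 2 \<longrightarrow>
         (j \<le> int i + 1 \<longrightarrow> betti I i j = 0)
       \<and> (j = int i + 2 \<longrightarrow> int (betti I i j) =
            - int q * (int q + 1) * binom (q^2 + q + 1) (int i + 2)
            + (int q ^ 2 + int q + 1) *
              (binom (q^2) (int i + 2) + int q * binom (q^2 + q + 1) (int i + 1)
               - (int q + 1) * binom (q^2) (int i) + binom (q + 1) 2 * binom (q^2) (int i - 2)))
       \<and> (j \<ge> int i + 3 \<longrightarrow> int (betti I i j) =
            (int q ^ 2 + int q + 1) * binom (q + 1) (j - int i) * binom (q^2) (2 * int i - j)))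
    \<and> (\<forall>(i::nat) (j::int). betti I i j \<noteq> 0 \<longleftrightarrow>
         (i = 0 \<and> j = 0 \<or> i = 1 \<and> j = 2)
       \<or> (1 \<le> i \<and> i \<le> q^2 + q \<and> j = int i + 2)
       \<or> (2 \<le> i \<and> max (int i + 3) (2 * int i - int q ^ 2) \<le> j
                \<and> j \<le> min (2 * int i) (int i + int q + 1)))"
proof -
  interpret finite_plane L q by unfold_locales (rule plane)
  have I': "I = complement_ideal (face_monomials (incidence_complex L))"
    unfolding I by (rule monomial_ideal_eq) (rule incidence_complex_down)
  have rows: "int (betti I i j) =
     (if j < int i then 0
      else if j = int i then (if i = 0 then 1 else 0)
      else if j = int i + 1 then (if i = 1 then int N else 0)
      else if j = int i + 2 then (if i = 0 then 0 else row_2_value i)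
      else (int q ^ 2 + int q + 1) * binom (q + 1) (j - int i) * binom (q^2) (2 * int i - j))" for i j
  proof -
    consider "j < int i" | "j = int i" | "j = int i + 1" | "j = int i + 2" | "int i + 3 \<le> j" by linarith
    then show ?thesis
    proof cases
      case 5
      define k where "k = nat (j - int i)"
      have k: "j = int i + int k" "3 \<le> k" using 5 by (auto simp: k_def)
      have "2 * int i - j = int i - int k" "j - int i = int k" using k by auto
      then show ?thesis using betti_row_ge_3[OF k(2), of i, where 'k = 'k] k unfolding I' by simp
    qed (use betti_below[of j i, where 'k = 'k] betti_row_0[of i, where 'k = 'k] betti_row_1[of i, where 'k = 'k]
        betti_row_2[of i, where 'k = 'k] in \<open>simp_all add: I'\<close>)
  qed
  have part1: "int (betti I 1 j) =
            (if j = 2 then int q ^ 2 + int q + 1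
             else if j = 3 then binom (q^2 + q + 1) 3 - binom (q + 1) 3 * (int q ^ 2 + int q + 1)
             else 0)" for j
  proof -
    have "binom N 3 = int (N choose 3)" "binom (q + 1) 3 = int (q + 1 choose 3)"
      using binom_of_nat[of N 3] binom_of_nat[of "q + 1" 3] by simp_all
    then show ?thesis unfolding rows[of 1 j] row_2_value_1 by (auto simp: binom_neg)
  qed
  have part3: "betti I i j \<noteq> 0 \<longleftrightarrow>
         (i = 0 \<and> j = 0 \<or> i = 1 \<and> j = 2)
       \<or> (1 \<le> i \<and> i \<le> q^2 + q \<and> j = int i + 2)
       \<or> (2 \<le> i \<and> max (int i + 3) (2 * int i - int q ^ 2) \<le> j
                \<and> j \<le> min (2 * int i) (int i + int q + 1))" for i j
  proof -
    have nz: "betti I i j \<noteq> 0 \<longleftrightarrow> int (betti I i j) \<noteq> 0" by simp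
    consider "j < int i + 2" | "j = int i + 2" | "int i + 3 \<le> j" by linarith
    then show ?thesis
    proof cases
      case 1
      have "int N \<noteq> 0" by (simp only: of_nat_eq_0_iff)
      then show ?thesis using 1 unfolding nz rows by (auto simp del: of_nat_Suc of_nat_add)
    next
      case 2
      have "row_2_value i \<noteq> 0 \<longleftrightarrow> i \<le> q\<^sup>2 + q" if "1 \<le> i"
        using row_2_value_pos[OF that] row_2_value_zero[of i] by (cases "i \<le> q\<^sup>2 + q") auto
      then show ?thesis using 2 unfolding nz rows by auto
    next
      case 3
      have "int q ^ 2 + int q + 1 \<noteq> 0" using of_nat_neq_0[of "q\<^sup>2 + q", where 'a = int] by (simp add: add.commute)
      then have "int (betti I i j) \<noteq> 0 \<longleftrightarrow> binom (q + 1) (j - int i) \<noteq> 0 \<and> binom (q\<^sup>2) (2 * int i - j) \<noteq> 0"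
        using 3 unfolding rows by auto
      then show ?thesis unfolding nz binom_nonzero_iff using 3 by (auto simp: max_def min_def)
    qed
  qed
  have part2: "(j \<le> int i + 1 \<longrightarrow> betti I i j = 0)
       \<and> (j = int i + 2 \<longrightarrow> int (betti I i j) = row_2_value i)
       \<and> (j \<ge> int i + 3 \<longrightarrow> int (betti I i j) =
            (int q ^ 2 + int q + 1) * binom (q + 1) (j - int i) * binom (q^2) (2 * int i - j))"
    if "2 \<le> i" for i j
    using that rows[of i j] by (auto split: if_splits)
  show ?thesis
    using part1 part2 part3 unfolding row_2_value_def by blast
qed

end
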